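(* Let $X=\mathbb{C}^2=\operatorname{Spec}A$ with $A=\mathbb{C}[x,y]$, and let $X_\infty=\operatorname{Spec}\mathbb{C}[a_i,b_i\mid i\ge 0]$ be its arc space, with universal arc $x\mapsto\sum_{i\ge0} a_it^i$, $y\mapsto\sum_{i\ge0} b_it^i$. Then $\operatorname{Cont}^2(x)\cap\operatorname{Cont}^3(y)=\operatorname{Spec}\mathbb{C}[a_2^{\pm1},a_3,\dots,b_3^{\pm1},b_4,\dots]$. Let $D\subset \operatorname{Cont}^2(x)\cap\operatorname{Cont}^3(y)$ be the (irreducible) closed subset defined in $\operatorname{Cont}^2(x)\cap\operatorname{Cont}^3(y)$ by the ideal $(a_2^3-b_3^2,\ 3a_2^2a_3-2b_3b_4)$. Let $\alpha$ be the generic point of $D$, let $K$ be its residue field, i.e. the quotient field of $\mathbb{C}[a_2^{\pm1},a_3,\dots,b_3^{\pm1},b_4,\dots]/(a_2^3-b_3^2,3a_2^2a_3-2b_3b_4)$, let $\alpha^*:A\to K[[t]]$ be the ring homomorphism corresponding to $\alpha$, and let $v=v_\alpha$ be the divisorial valuation corresponding to $\alpha$. Let $v'$ be the toric valuation with $v'(x)=3$, $v'(y)=4$. Let $Z\subset X$ be the closed subset defined by $x^3-y^2=0$, and for $m\in\mathbb{N}$ let $\psi_m:X_\infty\to X_m$ be the canonical projection. Then the following hold: (i) $\alpha^*(x^3-y^2)=c_8t^8+c_9t^9+\cdots$, where $c_8\in K$ is transcendental over the subfield $\mathbb{C}(a_2,a_3,b_3,b_4)$ of $K$ (generated by the images of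 $a_2,a_3,b_3,b_4$); (ii) $D=\operatorname{Cont}^2(x)\cap\operatorname{Cont}^3(y)\cap\psi_7^{-1}(Z_7)=\operatorname{Cont}^2(x)\cap\operatorname{Cont}^3(y)\cap\operatorname{Cont}^{\ge 8}(x^3-y^2)$; (iii) $C_X(v)=\overline{D}$; (iv) $v|_A\le v'|_A$, i.e. $v(f)\le v'(f)$ for every $f\in A\setminus\{0\}$; (v) $C_X(v)\not\supset C_X(v')$.
   Context: For a scheme $X$ of finite type over $\mathbb{C}$, an arc of $X$ is a morphism $\alpha:\operatorname{Spec}K[[t]]\to X$ with $K\supset\mathbb{C}$ a field extension; $X_\infty$ denotes the arc space and $X_m$ the space of $m$-jets $\operatorname{Spec}K[t]/(t^{m+1})\to X$. $K$-valued points of $X_\infty$ correspond bijectively to arcs $\operatorname{Spec}K[[t]]\to X$, and a point of $X_\infty$ with residue field $K$ is identified with the corresponding arc. For closed $Z\subset X$, $Z_m\subset X_m$ is the jet space of $Z$. For $X=\operatorname{Spec}A$ affine and an arc $\alpha$, $\alpha^*:A\to K[[t]]$ is the corresponding ring homomorphism. For $f\in A$: $\operatorname{Cont}^m(f)=\{\alpha\in X_\infty\mid \operatorname{ord}_t\alpha^*(f)=m\}$, $\operatorname{Cont}^{\ge m}(f)=\{\alpha\in X_\infty\mid\operatorname{ord}_t\alpha^*(f)\ge m\}$. An arc of a variety $X$ is fat if it does not factor through a proper closed subset of $X$. For a fat arc $\alpha$, $\alpha^*$ extends to an injection $K(X)\to K((t))$ and $v_\alpha(f)=\operatorname{ord}_t\alpha^*(f)$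 defines a valuation $v_\alpha$ on $K(X)$. A divisor over $X$ is a prime divisor $E$ on a normal variety $X_1$ with a proper birational morphism $X_1\to X$ (up to identification of divisors giving the same valuation $\operatorname{val}_E$). A divisorial valuation over $X$ is a valuation $v=q\operatorname{val}_E$ with $q$ a positive integer and $E$ a divisor over $X$. The maximal divisorial set corresponding to a divisorial valuation $v$ is $C_X(v)=\overline{\{\alpha\in X_\infty\mid v_\alpha=v\}}$ (fat arcs $\alpha$; Zariski closure in $X_\infty$). All overlines denote Zariski closure in $X_\infty$. The toric valuation $v'$ on $\mathbb{C}^2$ with $v'(x)=p$, $v'(y)=q$ is the monomial valuation $v'(\sum c_{ij}x^iy^j)=\min\{pi+qj\mid c_{ij}\ne0\}$. *)

theory Defs
  imports
    "HOL-Algebra.Algebraic_Closure_Type"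
    "HOL-Algebra.Generated_Fields"
    "HOL-Library.Poly_Mapping"
    "HOL-Library.Extended_Nat"
    "HOL-Analysis.Abstract_Topology"
    "HOL-Computational_Algebra.Computational_Algebra"
begin

no_notation eq_closure_of (\<open>closure'_of\<index>\<close>)

section \<open>Spectra\<close>

definition Spec :: "('a, 'm) ring_scheme \<Rightarrow> 'a set set" where
  "Spec A = {P. primeideal P A}"

definition zeros :: "('a, 'm) ring_scheme \<Rightarrow> 'a set \<Rightarrow> 'a set set" where
  "zeros A T = {P \<in> Spec A. T \<subseteq> P}"

definition zariski :: "('a, 'm) ring_scheme \<Rightarrow> 'a set topology" where
  "zariski A = topology (\<lambda>U. \<exists>T \<subseteq> carrier A. U = Spec A - zeros A T)"

definition irreducible_subset :: "'a topology \<Rightarrow> 'a set \<Rightarrow> bool" where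
  "irreducible_subset T S \<longleftrightarrow> S \<subseteq> topspace T \<and> S \<noteq> {} \<and>
     (\<forall>C C'. closedin T C \<and> closedin T C' \<and> S \<subseteq> C \<union> C' \<longrightarrow> S \<subseteq> C \<or> S \<subseteq> C')"

definition generic_point :: "'a topology \<Rightarrow> 'a set \<Rightarrow> 'a \<Rightarrow> bool" where
  "generic_point T S x \<longleftrightarrow> x \<in> S \<and> S \<subseteq> T closure_of {x}"


section \<open>Quotient fields and residue fields\<close>

definition frac_rel :: "('a, 'm) ring_scheme \<Rightarrow> (('a \<times> 'a) \<times> ('a \<times> 'a)) set" where
  "frac_rel A = {((a, b), (c, d)). a \<in> carrier A \<and> b \<in> carrier A - {\<zero>\<^bsub>A\<^esub>} \<and>
     c \<in> carrier A \<and> d \<in> carrier A - {\<zero>\<^bsub>A\<^esub>} \<and> a \<otimes>\<^bsub>A\<^esub> d = c \<otimes>\<^bsub>A\<^esub> b}"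

definition frac_class :: "('a, 'm) ring_scheme \<Rightarrow> 'a \<Rightarrow> 'a \<Rightarrow> ('a \<times> 'a) set" where
  "frac_class A a b = frac_rel A `` {(a, b)}"

definition frac_field :: "('a, 'm) ring_scheme \<Rightarrow> ('a \<times> 'a) set ring" where
  "frac_field A = \<lparr>
     carrier = (carrier A \<times> (carrier A - {\<zero>\<^bsub>A\<^esub>})) // frac_rel A,
     monoid.mult = (\<lambda>U V. \<Union>(a, b) \<in> U. \<Union>(c, d) \<in> V.
       frac_class A (a \<otimes>\<^bsub>A\<^esub> c) (b \<otimes>\<^bsub>A\<^esub> d)),
     one = frac_class A \<one>\<^bsub>A\<^esub> \<one>\<^bsub>A\<^esub>,
     ring.zero = frac_class A \<zero>\<^bsub>A\<^esub> \<one>\<^bsub>A\<^esub>,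
     add = (\<lambda>U V. \<Union>(a, b) \<in> U. \<Union>(c, d) \<in> V.
       frac_class A (a \<otimes>\<^bsub>A\<^esub> d \<oplus>\<^bsub>A\<^esub> c \<otimes>\<^bsub>A\<^esub> b) (b \<otimes>\<^bsub>A\<^esub> d)) \<rparr>"

definition residue_field :: "('a, 'm) ring_scheme \<Rightarrow> 'a set \<Rightarrow> ('a set \<times> 'a set) set ring" where
  "residue_field A P = frac_field (A Quot P)"

definition residue :: "('a, 'm) ring_scheme \<Rightarrow> 'a set \<Rightarrow> 'a \<Rightarrow> ('a set \<times> 'a set) set" where
  "residue A P r = frac_class (A Quot P) (P +>\<^bsub>A\<^esub> r) \<one>\<^bsub>A Quot P\<^esub>"


section \<open>The plane, its arcs and its jets\<close>

text \<open>Here \<^typ>\<open>complex poly poly\<close> is read as $(\mathbf{C}[x])[y]$: the coefficient of $x^i y^j$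
  in \<open>f\<close> is \<open>coeff (coeff f j) i\<close>.\<close>

type_synonym plane_poly = "complex poly poly"

definition plane_ring :: "plane_poly ring" where
  "plane_ring = ring_of_type_algebra"

definition xvar :: plane_poly where "xvar = [:[:0, 1:]:]"
definition yvar :: plane_poly where "yvar = [:0, 1:]"

datatype coord = Ca nat | Cb nat

fun coord_index :: "coord \<Rightarrow> nat" where
  "coord_index (Ca i) = i"
| "coord_index (Cb i) = i"

type_synonym arc_poly = "(coord \<Rightarrow>\<^sub>0 nat) \<Rightarrow>\<^sub>0 complex"

definition arc_ring :: "arc_poly ring" where
  "arc_ring = ring_of_type_algebra"

definition arc_const :: "complex \<Rightarrow> arc_poly" where
  "arc_const c = Poly_Mapping.single 0 c"

definition arc_var :: "coord \<Rightarrow> arc_poly" where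
  "arc_var c = Poly_Mapping.single (Poly_Mapping.single c 1) 1"

definition universal_arc :: "plane_poly \<Rightarrow> arc_poly fps" where
  "universal_arc f =
     (\<Sum>j \<le> Polynomial.degree f. \<Sum>i \<le> Polynomial.degree (Polynomial.coeff f j).
        fps_const (arc_const (Polynomial.coeff (Polynomial.coeff f j) i)) *
        Abs_fps (\<lambda>k. arc_var (Ca k)) ^ i * Abs_fps (\<lambda>k. arc_var (Cb k)) ^ j)"

text \<open>The arc of a point \<open>P\<close>, as a map to power series over the residue field of \<open>P\<close>; a power
  series is given by its sequence of coefficients.\<close>

definition arc_map :: "arc_poly set \<Rightarrow> plane_poly \<Rightarrow> nat \<Rightarrow> (arc_poly set \<times> arc_poly set) set" where
  "arc_map P f n = residue arc_ring P (fps_nth (universal_arc f) n)"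

definition series_ord :: "('k, 'm) ring_scheme \<Rightarrow> (nat \<Rightarrow> 'k) \<Rightarrow> enat" where
  "series_ord K s = (INF n \<in> {n. s n \<noteq> \<zero>\<^bsub>K\<^esub>}. enat n)"

definition arc_ord :: "arc_poly set \<Rightarrow> plane_poly \<Rightarrow> enat" where
  "arc_ord P f = series_ord (residue_field arc_ring P) (arc_map P f)"

definition Cont :: "nat \<Rightarrow> plane_poly \<Rightarrow> arc_poly set set" where
  "Cont m f = {P \<in> Spec arc_ring. arc_ord P f = enat m}"

definition Cont_ge :: "nat \<Rightarrow> plane_poly \<Rightarrow> arc_poly set set" where
  "Cont_ge m f = {P \<in> Spec arc_ring. arc_ord P f \<ge> enat m}"

definition jet_ring :: "nat \<Rightarrow> arc_poly ring" where
  "jet_ring m = arc_ring \<lparr> carrier :=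
     {p. \<forall>u \<in> Poly_Mapping.keys p. \<forall>c \<in> Poly_Mapping.keys u. coord_index c \<le> m} \<rparr>"

definition jet_proj :: "nat \<Rightarrow> arc_poly set \<Rightarrow> arc_poly set" where
  "jet_proj m P = P \<inter> carrier (jet_ring m)"

text \<open>The jet of a point \<open>Q\<close> of the \<open>m\<close>-th jet space is given by the coefficients of
  $t^0, \dots, t^m$ over the residue field of \<open>Q\<close>; these coefficients of the universal arc do lie in
  \<open>jet_ring m\<close>.  Closed subsets \<open>Z\<close> carry their reduced structure, with ideal \<open>\<Inter>Z\<close>.\<close>

definition jets_in :: "nat \<Rightarrow> plane_poly set set \<Rightarrow> arc_poly set set" where
  "jets_in m Z = {Q \<in> Spec (jet_ring m). \<forall>f \<in> \<Inter>Z. \<forall>n \<le> m.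
     residue (jet_ring m) Q (fps_nth (universal_arc f) n) = \<zero>\<^bsub>residue_field (jet_ring m) Q\<^esub>}"

definition fat_arc :: "arc_poly set \<Rightarrow> bool" where
  "fat_arc P \<longleftrightarrow> P \<in> Spec arc_ring \<and>
     \<not> (\<exists>Z. closedin (zariski plane_ring) Z \<and> Z \<noteq> Spec plane_ring \<and>
           (\<forall>f \<in> \<Inter>Z. \<forall>n. arc_map P f n = \<zero>\<^bsub>residue_field arc_ring P\<^esub>))"


section \<open>Valuations on the function field of the plane\<close>

text \<open>A valuation is a function on nonzero elements; its value at \<open>0\<close> has no meaning.\<close>

type_synonym plane_fun = "plane_poly fract"

definition frac_val :: "(plane_poly \<Rightarrow> int) \<Rightarrow> plane_fun \<Rightarrow> int" where
  "frac_val w \<phi> = w (fst (quot_of_fract \<phi>)) - w (snd (quot_of_fract \<phi>))"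

definition arc_val :: "arc_poly set \<Rightarrow> plane_fun \<Rightarrow> int" where
  "arc_val P = frac_val (\<lambda>f. int (the_enat (arc_ord P f)))"

definition toric_val :: "nat \<Rightarrow> nat \<Rightarrow> plane_fun \<Rightarrow> int" where
  "toric_val p q = frac_val (\<lambda>f.
     Min {int (p * i + q * j) | i j. Polynomial.coeff (Polynomial.coeff f j) i \<noteq> 0})"

definition maximal_divisorial_set :: "(plane_fun \<Rightarrow> int) \<Rightarrow> arc_poly set set" where
  "maximal_divisorial_set v =
     zariski arc_ring closure_of {P. fat_arc P \<and> (\<forall>\<phi>. \<phi> \<noteq> 0 \<longrightarrow> arc_val P \<phi> = v \<phi>)}"

text \<open>A divisor \<open>E\<close> over the plane is given by an affine open chart of the normal variety it lies on
  which meets \<open>E\<close>: the coordinate ring \<open>B\<close> of the chart, a subring of the function field, and the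
  height one prime \<open>P\<close> of \<open>E\<close> in it.  Conversely every normal affine chart over the plane is open
  in a normal variety that is proper and birational over the plane, by Nagata compactification.\<close>

definition fun_field :: "plane_fun ring" where
  "fun_field = ring_of_type_algebra"

definition normal_chart :: "plane_fun set \<Rightarrow> bool" where
  "normal_chart B \<longleftrightarrow>
     (\<exists>G. finite G \<and> B = generate_ring fun_field (range (\<lambda>c. to_fract [:[:c:]:]) \<union> G)) \<and>
     range to_fract \<subseteq> B \<and>
     (\<forall>\<phi> (p :: plane_fun poly). Polynomial.lead_coeff p = 1 \<and> range (Polynomial.coeff p) \<subseteq> B \<and>
        poly p \<phi> = 0 \<longrightarrow> \<phi> \<in> B)"

definition height_one_prime :: "plane_fun set \<Rightarrow> plane_fun set \<Rightarrow> bool" where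
  "height_one_prime B P \<longleftrightarrow> P \<in> Spec (fun_field \<lparr> carrier := B \<rparr>) \<and> P \<noteq> {0} \<and>
     (\<forall>Q \<in> Spec (fun_field \<lparr> carrier := B \<rparr>). Q \<subseteq> P \<longrightarrow> Q = {0} \<or> Q = P)"

definition localized :: "plane_fun set \<Rightarrow> plane_fun set \<Rightarrow> plane_fun set \<Rightarrow> plane_fun set" where
  "localized B P J = {b / s | b s. b \<in> J \<and> s \<in> B - P}"

text \<open>The order along \<open>E\<close> is the exponent of a uniformizer of the local ring at \<open>E\<close>.\<close>

definition divisorial_valuation :: "(plane_fun \<Rightarrow> int) \<Rightarrow> bool" where
  "divisorial_valuation v \<longleftrightarrow>
     (\<exists>B P (q :: nat) \<pi>. normal_chart B \<and> height_one_prime B P \<and> q > 0 \<and>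
        localized B P P = (\<lambda>u. \<pi> * u) ` localized B P B \<and>
        (\<forall>\<phi>. \<phi> \<noteq> 0 \<longrightarrow> (\<exists>n u. u \<in> localized B P B \<and> inverse u \<in> localized B P B \<and>
           \<phi> = \<pi> powi n * u \<and> v \<phi> = int q * n)))"


section \<open>The contact locus and its subset \<open>D\<close>\<close>

type_synonym laurent_poly = "(coord \<Rightarrow>\<^sub>0 int) \<Rightarrow>\<^sub>0 complex"

definition laurent_var :: "coord \<Rightarrow> laurent_poly" where
  "laurent_var c = Poly_Mapping.single (Poly_Mapping.single c 1) 1"

definition contact_coords :: "coord set" where
  "contact_coords = {Ca i | i. i \<ge> 2} \<union> {Cb i | i. i \<ge> 3}"

text \<open>$\mathbf{C}[a_2^{\pm 1}, a_3, \dots, b_3^{\pm 1}, b_4, \dots]$\<close>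

definition contact_ring :: "laurent_poly ring" where
  "contact_ring = (ring_of_type_algebra :: laurent_poly ring) \<lparr> carrier :=
     {p. \<forall>u \<in> Poly_Mapping.keys p. Poly_Mapping.keys u \<subseteq> contact_coords \<and>
           (\<forall>c. c \<noteq> Ca 2 \<and> c \<noteq> Cb 3 \<longrightarrow> Poly_Mapping.lookup u c \<ge> 0)} \<rparr>"

text \<open>The ring homomorphism killing $a_0, a_1, b_0, b_1, b_2$, and the induced map of spectra.\<close>

definition contact_restrict :: "arc_poly \<Rightarrow> laurent_poly" where
  "contact_restrict p = (\<Sum>u \<in> Poly_Mapping.keys p.
     if Poly_Mapping.keys u \<subseteq> contact_coords
     then Poly_Mapping.single (Poly_Mapping.map int u) (Poly_Mapping.lookup p u) else 0)"

definition contact_point :: "laurent_poly set \<Rightarrow> arc_poly set" where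
  "contact_point Q = {p \<in> carrier arc_ring. contact_restrict p \<in> Q}"

definition D_ideal :: "laurent_poly set" where
  "D_ideal = genideal contact_ring
     {laurent_var (Ca 2) ^ 3 - laurent_var (Cb 3) ^ 2,
      3 * laurent_var (Ca 2) ^ 2 * laurent_var (Ca 3) - 2 * laurent_var (Cb 3) * laurent_var (Cb 4)}"

definition D_set :: "arc_poly set set" where
  "D_set = contact_point ` zeros contact_ring D_ideal"

end

theory Submission
  imports Defs
begin

text \<open>
  The subset \<open>D\<close> has a monomial parametrization.  Its two equations say that there is a
  parameter \<open>s = b\<^sub>3 / a\<^sub>2\<close> with \<open>a\<^sub>2 = s\<^sup>2\<close>, \<open>b\<^sub>3 = s\<^sup>3\<close> and \<open>b\<^sub>4 = (3/2) s a\<^sub>3\<close>, the other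
  coordinates being free.  Hence the ideal of \<open>D\<close> is the kernel of a homomorphism \<open>D_eval\<close> to an
  integral domain (lemma \<open>D_eval_cong\<close> is the essential inclusion), so it is prime; its
  contraction \<open>D_point\<close> to the arc ring is the generic point, and the generic arc becomes an explicit
  pair of power series over a field.  A point of the contact locus lies on \<open>D\<close> iff the coefficients
  of \<open>t\<^sup>6\<close> and \<open>t\<^sup>7\<close> in \<open>x\<^sup>3 - y\<^sup>2\<close> vanish, because these coefficients are the two equations;
  this is (ii).

  The coefficient of \<open>t\<^sup>8\<close> contains \<open>a\<^sub>4\<close> linearly, with a coefficient that is a unit, and
  \<open>a\<^sub>4\<close> is a free coordinate.  Translating \<open>a\<^sub>4\<close> by a complex number does not change the kernel
  \<open>D_point\<close> (\<open>D_eval_kernel\<close>), so every algebraic relation for \<open>c\<^sub>8\<close> whose coefficients do not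
  involve \<open>a\<^sub>4\<close> has infinitely many roots.  This proves (i).

  For the valuation, put \<open>u = y / x\<close> and \<open>z = (x - u\<^sup>2) / u\<^sup>4\<close>.  Then
  \<open>x = u\<^sup>2 + u\<^sup>4 z\<close> and \<open>y = u x\<close>, so \<open>\<complex>[u, z]\<close> is a normal chart over the plane, and
  \<open>x\<^sup>3 - y\<^sup>2\<close> vanishes to order 8 along \<open>u = 0\<close>.  The generic arc of \<open>D\<close> lifts to this chart with
  \<open>u\<close> of order one and with \<open>z\<close> starting with \<open>c\<^sub>8 / s\<^sup>8\<close>, which is transcendental over
  \<open>\<complex>\<close>; therefore \<open>v\<close> is the order along \<open>u = 0\<close> (\<open>subdegree_generic_arc\<close>) and is
  divisorial.  An arc with valuation \<open>v\<close> has the contact orders 2, 3 and 8 with \<open>x\<close>, \<open>y\<close> and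
  \<open>x\<^sup>3 - y\<^sup>2\<close>, so it lies on \<open>D\<close> by (ii), and this gives (iii).

  For (iv), a polynomial is expanded in powers of \<open>x\<^sup>3 - y\<^sup>2\<close> with coefficients of degree at most one
  in \<open>y\<close>.  Distinct monomials of such a coefficient have distinct \<open>v\<close>-values, no cancellation
  occurs in the expansion, and \<open>v \<le> v'\<close> on monomials while both valuations are 8 on
  \<open>x\<^sup>3 - y\<^sup>2\<close>; see \<open>chart_ord_le_toric\<close>.  For (v), the polynomial \<open>4 b\<^sub>4\<^sup>2 - 9 a\<^sub>2 a\<^sub>3\<^sup>2\<close> vanishes
  on \<open>D\<close> but not at the arc \<open>(t\<^sup>3, w t\<^sup>4)\<close> with \<open>w\<close> transcendental, whose valuation is \<open>v'\<close>.
\<close>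

alias keys = Poly_Mapping.keys
alias lookup = Poly_Mapping.lookup
alias single = Poly_Mapping.single
alias coeff = Polynomial.coeff
alias degree = Polynomial.degree
alias monom = Polynomial.monom

abbreviation plane_coeff :: "plane_poly \<Rightarrow> nat \<Rightarrow> nat \<Rightarrow> complex" where
  "plane_coeff f i j \<equiv> Polynomial.coeff (Polynomial.coeff f j) i"



section \<open>Ring homomorphisms between types and evaluation of polynomials\<close>

locale type_ring_hom =
  fixes h :: "'a::comm_ring_1 \<Rightarrow> 'b::comm_ring_1"
  assumes hom_one: "h 1 = 1"
    and hom_add: "h (x + y) = h x + h y"
    and hom_mult: "h (x * y) = h x * h y"
begin

lemma hom_zero: "h 0 = 0"
  using hom_add[of 0 0] by simp

lemma hom_uminus: "h (- x) = - h x"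
  using hom_add[of x "- x"] hom_zero by (simp add: eq_neg_iff_add_eq_0 add.commute)

lemma hom_diff: "h (x - y) = h x - h y"
  using hom_add[of x "- y"] hom_uminus[of y] by simp

lemma hom_sum: "h (sum f A) = (\<Sum>x\<in>A. h (f x))"
  by (induction A rule: infinite_finite_induct) (simp_all add: hom_zero hom_add)

lemma hom_power: "h (x ^ n) = h x ^ n"
  by (induction n) (simp_all add: hom_one hom_mult)

lemma hom_of_nat: "h (of_nat n) = of_nat n"
  by (induction n) (simp_all add: hom_zero hom_one hom_add)

lemma hom_numeral: "h (numeral n) = numeral n"
  using hom_of_nat[of "numeral n"] by simp

lemmas hom_simps = hom_zero hom_one hom_add hom_mult hom_uminus hom_diff hom_sum hom_power hom_numeral

lemma hom_dvd: "x dvd y \<Longrightarrow> h x dvd h y"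
  by (auto simp: dvd_def hom_mult)

end

lemma type_ring_hom_comp:
  "type_ring_hom g \<Longrightarrow> type_ring_hom h \<Longrightarrow> type_ring_hom (\<lambda>x. h (g x))"
  by (simp add: type_ring_hom_def)

lemma type_ring_hom_id: "type_ring_hom (\<lambda>x. x)"
  by (simp add: type_ring_hom_def)

lemma type_ring_hom_to_fract: "type_ring_hom (to_fract :: 'a::idom \<Rightarrow> 'a fract)"
  by unfold_locales auto

lemma type_ring_hom_fps_const: "type_ring_hom (fps_const :: 'a::comm_ring_1 \<Rightarrow> 'a fps)"
  by unfold_locales auto

lemma type_ring_hom_pCons: "type_ring_hom (\<lambda>c :: 'a::comm_ring_1. [:c:])"
  by unfold_locales (auto simp: one_pCons)

lemma type_ring_hom_fps_map:
  assumes "type_ring_hom h"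
  shows "type_ring_hom (\<lambda>F. Abs_fps (\<lambda>n. h (fps_nth F n)))"
proof -
  interpret type_ring_hom h by fact
  show ?thesis
    by unfold_locales (auto simp: fps_eq_iff hom_simps fps_mult_nth)
qed


subsection \<open>Polynomials in one variable and in two variables\<close>

definition poly_hom :: "('a::comm_ring_1 \<Rightarrow> 'b::comm_ring_1) \<Rightarrow> 'b \<Rightarrow> 'a poly \<Rightarrow> 'b" where
  "poly_hom c \<xi> p = (\<Sum>i \<le> degree p. c (coeff p i) * \<xi> ^ i)"

lemma poly_hom_upto:
  assumes "type_ring_hom c" "degree p \<le> n"
  shows "poly_hom c \<xi> p = (\<Sum>i \<le> n. c (coeff p i) * \<xi> ^ i)"
  unfolding poly_hom_def
  by (rule sum.mono_neutral_left)
     (use assms in \<open>auto simp: coeff_eq_0 type_ring_hom.hom_zero\<close>)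

lemma poly_hom_pCons:
  assumes "type_ring_hom c"
  shows "poly_hom c \<xi> (pCons a p) = c a + \<xi> * poly_hom c \<xi> p"
proof -
  have "poly_hom c \<xi> (pCons a p) = (\<Sum>i \<le> Suc (degree p). c (coeff (pCons a p) i) * \<xi> ^ i)"
    by (rule poly_hom_upto[OF assms]) (rule degree_pCons_le)
  also have "\<dots> = c a + (\<Sum>i \<le> degree p. c (coeff p i) * \<xi> ^ Suc i)"
    by (subst sum.atMost_Suc_shift) simp
  finally show ?thesis
    by (simp add: poly_hom_def sum_distrib_left mult_ac)
qed

lemma poly_hom_0: "type_ring_hom c \<Longrightarrow> poly_hom c \<xi> 0 = 0"
  by (simp add: poly_hom_def type_ring_hom.hom_zero)

lemma type_ring_hom_poly_hom:
  assumes c: "type_ring_hom c"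
  shows "type_ring_hom (poly_hom c \<xi>)"
proof -
  interpret type_ring_hom c by fact
  have add: "poly_hom c \<xi> (p + q) = poly_hom c \<xi> p + poly_hom c \<xi> q" for p q
  proof -
    define n where "n = max (degree p) (degree q)"
    have n: "degree p \<le> n" "degree q \<le> n" "degree (p + q) \<le> n"
      by (auto simp: n_def degree_add_le_max)
    show ?thesis
      by (simp add: poly_hom_upto[OF c n(1)] poly_hom_upto[OF c n(2)] poly_hom_upto[OF c n(3)]
          hom_add distrib_right sum.distrib)
  qed
  have smult: "poly_hom c \<xi> (Polynomial.smult a p) = c a * poly_hom c \<xi> p" for a p
    by (subst poly_hom_upto[OF c, of _ "degree p"])
       (auto simp: poly_hom_def hom_mult sum_distrib_left mult_ac degree_smult_le)
  have mult: "poly_hom c \<xi> (p * q) = poly_hom c \<xi> p * poly_hom c \<xi> q" for p q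
  proof (induction p)
    case 0
    then show ?case by (simp add: poly_hom_0[OF c])
  next
    case (pCons a p)
    then show ?case
      by (simp add: add smult poly_hom_pCons[OF c] hom_zero algebra_simps)
  qed
  have "poly_hom c \<xi> 1 = 1"
    by (simp add: poly_hom_def hom_one)
  then show ?thesis using add mult by (simp add: type_ring_hom_def)
qed

definition plane_eval ::
    "(complex \<Rightarrow> 'b::comm_ring_1) \<Rightarrow> 'b \<Rightarrow> 'b \<Rightarrow> plane_poly \<Rightarrow> 'b" where
  "plane_eval c \<xi> \<eta> f = poly_hom (poly_hom c \<xi>) \<eta> f"

definition pconst :: "complex \<Rightarrow> plane_poly" where
  "pconst c = [:[:c:]:]"

lemma type_ring_hom_pconst: "type_ring_hom pconst"
  unfolding pconst_def by unfold_locales (auto simp: one_pCons)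

lemma type_ring_hom_plane_eval:
  "type_ring_hom c \<Longrightarrow> type_ring_hom (plane_eval c \<xi> \<eta>)"
  unfolding plane_eval_def[abs_def]
  by (intro type_ring_hom_poly_hom)

lemma plane_eval_gens:
  assumes c: "type_ring_hom c"
  shows "plane_eval c \<xi> \<eta> (pconst a) = c a" "plane_eval c \<xi> \<eta> xvar = \<xi>" "plane_eval c \<xi> \<eta> yvar = \<eta>"
proof -
  note c' = type_ring_hom_poly_hom[OF c, of \<xi>]
  interpret type_ring_hom c by fact
  interpret c': type_ring_hom "poly_hom c \<xi>" by fact
  show "plane_eval c \<xi> \<eta> (pconst a) = c a" "plane_eval c \<xi> \<eta> xvar = \<xi>" "plane_eval c \<xi> \<eta> yvar = \<eta>"
    by (simp_all add: plane_eval_def pconst_def xvar_def yvar_def poly_hom_pCons[OF c']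
        poly_hom_pCons[OF c] poly_hom_0[OF c] poly_hom_0[OF c'] hom_zero hom_one c'.hom_zero
        c'.hom_one)
qed

lemma plane_induct [case_names const x y add mult]:
  assumes const: "\<And>c. P (pconst c)" and x: "P xvar" and y: "P yvar"
    and add: "\<And>f g. P f \<Longrightarrow> P g \<Longrightarrow> P (f + g)"
    and mult: "\<And>f g. P f \<Longrightarrow> P g \<Longrightarrow> P (f * g)"
  shows "P f"
proof -
  have inner: "P [:p:]" for p
  proof (induction p)
    case 0
    show ?case using const[of 0] by (simp add: pconst_def)
  next
    case (pCons a p)
    have "[:pCons a p:] = pconst a + xvar * [:p:]"
      by (simp add: pconst_def xvar_def)
    then show ?case using pCons by (simp only: const x add mult)
  qed
  show ?thesis
  proof (induction f)
    case 0
    show ?case using const[of 0] by (simp add: pconst_def)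
  next
    case (pCons p f)
    have "pCons p f = [:p:] + yvar * f"
      by (simp add: yvar_def)
    then show ?case using pCons by (simp only: inner y add mult)
  qed
qed

text \<open>Homomorphisms out of the polynomial ring are only ever compared on \<open>x\<close>, \<open>y\<close> and the constants;
  most identities between arcs, charts and parametrizations below are instances of this.\<close>

lemma plane_hom_eqI:
  assumes "type_ring_hom h" "type_ring_hom k"
    and "\<And>c. h (pconst c) = k (pconst c)" "h xvar = k xvar" "h yvar = k yvar"
  shows "h f = k f"
proof -
  interpret h: type_ring_hom h by fact
  interpret k: type_ring_hom k by fact
  show ?thesis
    by (induction f rule: plane_induct) (use assms(3-) in \<open>auto simp: h.hom_simps k.hom_simps\<close>)
qed

subsection \<open>Polynomials given by finitely supported maps\<close>

lemma pm_sum_single: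
  fixes p :: "'a \<Rightarrow>\<^sub>0 'b::comm_monoid_add"
  shows "p = (\<Sum>u \<in> keys p. single u (lookup p u))"
proof (rule poly_mapping_eqI)
  fix k
  show "lookup p k = lookup
     (\<Sum>u\<in>keys p. single u (lookup p u)) k"
    by (cases "k \<in> keys p")
       (auto simp: lookup_sum lookup_single when_def in_keys_iff sum.delta')
qed

text \<open>A multiplicative map \<open>e\<close> on exponents and a homomorphism \<open>c\<close> on coefficients extend to the monoid
  algebra.  This covers the evaluation of polynomials as well as the passage to Laurent polynomials.\<close>

definition pm_eval :: "('c::comm_ring_1 \<Rightarrow> 'r) \<Rightarrow> ('m \<Rightarrow> 'r) \<Rightarrow> ('m \<Rightarrow>\<^sub>0 'c) \<Rightarrow> 'r::comm_ring_1" where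
  "pm_eval c e p = (\<Sum>u \<in> keys p. c (lookup p u) * e u)"

lemma type_ring_hom_pm_eval:
  fixes e :: "'m::comm_monoid_add \<Rightarrow> 'r::comm_ring_1"
  assumes c: "type_ring_hom c" and e0: "e 0 = 1" and e_add: "\<And>u v. e (u + v) = e u * e v"
  shows "type_ring_hom (pm_eval c e)"
proof -
  interpret type_ring_hom c by fact
  have upto: "pm_eval c e p = (\<Sum>u \<in> S. c (lookup p u) * e u)"
    if "finite S" "keys p \<subseteq> S" for p S
    unfolding pm_eval_def
    by (rule sum.mono_neutral_left) (use that in \<open>auto simp: in_keys_iff hom_zero\<close>)
  have add: "pm_eval c e (p + q) = pm_eval c e p + pm_eval c e q" for p q
  proof -
    let ?S = "keys p \<union> keys q"
    have "finite ?S" "keys (p + q) \<subseteq> ?S" "keys p \<subseteq> ?S" "keys q \<subseteq> ?S"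
      using Poly_Mapping.keys_add[of p q] by auto
    then show ?thesis
      by (simp add: upto[of ?S] lookup_add hom_add distrib_right sum.distrib)
  qed
  have sum: "pm_eval c e (sum f A) = (\<Sum>x\<in>A. pm_eval c e (f x))" if "finite A" for f and A :: "'m set"
    using that by (induction A) (simp_all add: add, simp add: pm_eval_def)
  have sum2: "pm_eval c e (sum f A) = (\<Sum>x\<in>A. pm_eval c e (f x))" if "finite A" for f and A :: "('m \<times> 'm) set"
    using that by (induction A) (simp_all add: add, simp add: pm_eval_def)
  have single: "pm_eval c e (single u a) = c a * e u" for u a
    by (simp add: pm_eval_def hom_zero)
  have mult: "pm_eval c e (p * q) = pm_eval c e p * pm_eval c e q" for p q
  proof -
    let ?K = "keys p \<times> keys q"
    have "p * q = (\<Sum>(u, v) \<in> ?K. single (u + v) (lookup p u * lookup q v))"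
      using arg_cong2[OF pm_sum_single[of p] pm_sum_single[of q], of "(*)"]
      by (simp add: sum_product sum.cartesian_product mult_single)
    then have "pm_eval c e (p * q) =
        (\<Sum>(u, v) \<in> ?K. c (lookup p u * lookup q v) * e (u + v))"
      by (simp add: sum2 split_def single)
    also have "\<dots> = pm_eval c e p * pm_eval c e q"
      by (simp add: pm_eval_def sum_product sum.cartesian_product hom_mult e_add mult_ac)
    finally show ?thesis .
  qed
  have "pm_eval c e 1 = 1"
    using single[of 0 1] by (simp add: e0 hom_one)
  then show ?thesis using add mult by (simp add: type_ring_hom_def)
qed

lemma pm_eval_single:
  "type_ring_hom c \<Longrightarrow> pm_eval c e (single u a) = c a * e u"
  by (simp add: pm_eval_def type_ring_hom.hom_zero)

definition arc_eval :: "(complex \<Rightarrow> 'r) \<Rightarrow> (coord \<Rightarrow> 'r) \<Rightarrow> arc_poly \<Rightarrow> 'r::comm_ring_1" where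
  "arc_eval c \<sigma> = pm_eval c (\<lambda>u. \<Prod>x \<in> keys u. \<sigma> x ^ lookup u x)"

lemma keys_add_nat:
  "keys (u + v) = keys u \<union> keys (v :: 'a \<Rightarrow>\<^sub>0 nat)"
  by (auto simp: in_keys_iff lookup_add)

lemma type_ring_hom_arc_eval:
  assumes "type_ring_hom c"
  shows "type_ring_hom (arc_eval c \<sigma>)"
  unfolding arc_eval_def
proof (rule type_ring_hom_pm_eval[OF assms])
  fix u v :: "coord \<Rightarrow>\<^sub>0 nat"
  let ?S = "keys u \<union> keys v"
  have 1: "(\<Prod>x \<in> keys w. \<sigma> x ^ lookup w x) = (\<Prod>x \<in> ?S. \<sigma> x ^ lookup w x)"
    if "keys w \<subseteq> ?S" for w
    by (rule prod.mono_neutral_left) (use that in \<open>auto simp: in_keys_iff\<close>)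
  show "(\<Prod>x \<in> keys (u + v). \<sigma> x ^ lookup (u + v) x) =
    (\<Prod>x \<in> keys u. \<sigma> x ^ lookup u x) *
    (\<Prod>x \<in> keys v. \<sigma> x ^ lookup v x)"
    by (simp add: 1[of u] 1[of v] keys_add_nat lookup_add power_add prod.distrib)
qed simp

lemma arc_eval_gens:
  assumes "type_ring_hom c"
  shows "arc_eval c \<sigma> (arc_const a) = c a" "arc_eval c \<sigma> (arc_var x) = \<sigma> x"
  using assms
  by (simp_all add: arc_eval_def arc_const_def arc_var_def pm_eval_single type_ring_hom.hom_one)

lemma type_ring_hom_arc_const: "type_ring_hom arc_const"
  unfolding arc_const_def
  by unfold_locales (auto simp: single_add mult_single)

lemma arc_poly_induct [case_names const var add mult]:
  assumes const: "\<And>c. P (arc_const c)" and var: "\<And>x. P (arc_var x)"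
    and add: "\<And>f g. P f \<Longrightarrow> P g \<Longrightarrow> P (f + g)"
    and mult: "\<And>f g. P f \<Longrightarrow> P g \<Longrightarrow> P (f * g)"
  shows "P p"
proof -
  have P1: "P 1" using const[of 1] by (simp add: arc_const_def)
  have pow: "P (f ^ n)" if "P f" for f n
    by (induction n) (auto simp: that P1 mult)
  have prod: "P (\<Prod>x\<in>A. f x)" if "\<And>x. P (f x)" for f and A :: "coord set"
    by (induction A rule: infinite_finite_induct) (auto simp: that P1 mult)
  have sum: "P (\<Sum>x\<in>A. f x)" if "\<And>x. P (f x)" for f and A :: "(coord \<Rightarrow>\<^sub>0 nat) set"
    using const[of 0] by (induction A rule: infinite_finite_induct) (auto simp: that add arc_const_def)
  have varpow: "arc_var x ^ n = single (single x n) 1" for x n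
    by (induction n) (auto simp: arc_var_def mult_single simp flip: single_add)
  have prodvar: "(\<Prod>x\<in>A. arc_var x ^ f x) = single (\<Sum>x\<in>A. single x (f x)) 1"
    for f and A :: "coord set"
    by (induction A rule: infinite_finite_induct) (auto simp: varpow mult_single)
  have mono: "single u a =
      arc_const a * (\<Prod>x \<in> keys u. arc_var x ^ lookup u x)" for u a
    by (simp add: prodvar arc_const_def mult_single flip: pm_sum_single)
  have "P (single u a)" for u a
    unfolding mono by (intro mult const prod pow var)
  then have "P (\<Sum>u \<in> keys p. single u (lookup p u))"
    by (intro sum)
  then show ?thesis by (simp flip: pm_sum_single)
qed

lemma arc_hom_eqI:
  assumes "type_ring_hom h" "type_ring_hom k"
    and "\<And>c. h (arc_const c) = k (arc_const c)" "\<And>x. h (arc_var x) = k (arc_var x)"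
  shows "h f = k f"
proof -
  interpret h: type_ring_hom h by fact
  interpret k: type_ring_hom k by fact
  show ?thesis
    by (induction f rule: arc_poly_induct) (use assms(3-) in \<open>auto simp: h.hom_simps k.hom_simps\<close>)
qed


subsection \<open>The universal arc\<close>

lemma universal_arc_eq_plane_eval:
  "universal_arc f = plane_eval (\<lambda>c. fps_const (arc_const c))
     (Abs_fps (\<lambda>k. arc_var (Ca k))) (Abs_fps (\<lambda>k. arc_var (Cb k))) f"
  unfolding universal_arc_def plane_eval_def poly_hom_def by (simp add: sum_distrib_right)

lemma type_ring_hom_universal_arc: "type_ring_hom universal_arc"
  unfolding universal_arc_eq_plane_eval[abs_def]
  by (intro type_ring_hom_plane_eval type_ring_hom_comp[OF type_ring_hom_arc_const type_ring_hom_fps_const])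

lemma universal_arc_gens:
  "universal_arc (pconst c) = fps_const (arc_const c)"
  "universal_arc xvar = Abs_fps (\<lambda>k. arc_var (Ca k))"
  "universal_arc yvar = Abs_fps (\<lambda>k. arc_var (Cb k))"
  using plane_eval_gens[OF type_ring_hom_comp[OF type_ring_hom_arc_const type_ring_hom_fps_const]]
  by (simp_all add: universal_arc_eq_plane_eval)


definition arc_of :: "(arc_poly \<Rightarrow> 'b::comm_ring_1) \<Rightarrow> plane_poly \<Rightarrow> 'b fps" where
  "arc_of h = plane_eval (\<lambda>c. fps_const (h (arc_const c)))
      (Abs_fps (\<lambda>k. h (arc_var (Ca k)))) (Abs_fps (\<lambda>k. h (arc_var (Cb k))))"

lemma type_ring_hom_arc_of_const:
  "type_ring_hom h \<Longrightarrow> type_ring_hom (\<lambda>c. fps_const (h (arc_const c)))"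
  by (intro type_ring_hom_comp[OF type_ring_hom_comp[OF type_ring_hom_arc_const] type_ring_hom_fps_const])

lemma type_ring_hom_arc_of: "type_ring_hom h \<Longrightarrow> type_ring_hom (arc_of h)"
  unfolding arc_of_def by (intro type_ring_hom_plane_eval type_ring_hom_arc_of_const)

lemma arc_of_gens:
  assumes "type_ring_hom h"
  shows "arc_of h (pconst c) = fps_const (h (arc_const c))"
    "arc_of h xvar = Abs_fps (\<lambda>k. h (arc_var (Ca k)))"
    "arc_of h yvar = Abs_fps (\<lambda>k. h (arc_var (Cb k)))"
  unfolding arc_of_def by (simp_all add: plane_eval_gens[OF type_ring_hom_arc_of_const[OF assms]])

text \<open>A homomorphism applied to the coefficients turns the universal arc into the arc with the
  specialized coordinates, since both sides are homomorphisms that agree on \<open>x\<close>, \<open>y\<close> and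
  the constants.\<close>

lemma hom_universal_arc:
  assumes h: "type_ring_hom h"
  shows "h (fps_nth (universal_arc f) n) = fps_nth (arc_of h f) n"
proof -
  interpret type_ring_hom h by fact
  have "Abs_fps (\<lambda>n. h (fps_nth (universal_arc f) n)) = arc_of h f"
    by (rule plane_hom_eqI[OF type_ring_hom_comp[OF type_ring_hom_universal_arc type_ring_hom_fps_map[OF h]]
          type_ring_hom_arc_of[OF h]])
       (auto simp: universal_arc_gens arc_of_gens[OF h] fps_eq_iff hom_zero)
  then show ?thesis by (metis fps_nth_Abs_fps)
qed


section \<open>The Zariski topology\<close>

lemma SpecD:
  assumes "P \<in> Spec A"
  shows "P \<subseteq> carrier A" "primeideal P A"
  using assms by (auto simp: Spec_def dest!: primeideal.axioms(1) ideal.Icarr)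

lemma Spec_mult_iff:
  assumes "P \<in> Spec A" "a \<in> carrier A" "b \<in> carrier A"
  shows "a \<otimes>\<^bsub>A\<^esub> b \<in> P \<longleftrightarrow> a \<in> P \<or> b \<in> P"
proof -
  interpret primeideal P A using assms(1) by (simp add: Spec_def)
  show ?thesis
    using I_prime[OF assms(2,3)] I_l_closed[OF _ assms(2)] I_r_closed[OF _ assms(3)] by blast
qed

text \<open>The zero set of all products \<open>s t\<close> with \<open>s \<in> S\<close> and \<open>t \<in> T\<close> is the union of the two zero sets,
  because the points are prime ideals; an intersection of zero sets is the zero set of the union.\<close>

lemma istopology_zariski: "istopology (\<lambda>U. \<exists>T \<subseteq> carrier A. U = Spec A - zeros A T)"
  unfolding istopology_def
proof (intro conjI allI impI)
  fix U V
  assume "\<exists>T\<subseteq>carrier A. U = Spec A - zeros A T" "\<exists>T\<subseteq>carrier A. V = Spec A - zeros A T"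
  then obtain S T where S: "S \<subseteq> carrier A" "U = Spec A - zeros A S"
    and T: "T \<subseteq> carrier A" "V = Spec A - zeros A T" by blast
  show "\<exists>T\<subseteq>carrier A. U \<inter> V = Spec A - zeros A T"
  proof (cases "Spec A = {}")
    case True
    then show ?thesis using S T by blast
  next
    case False
    then obtain P where "primeideal P A" by (auto simp: Spec_def)
    then interpret P: primeideal P A .
    define W where "W = {s \<otimes>\<^bsub>A\<^esub> t | s t. s \<in> S \<and> t \<in> T}"
    have "W \<subseteq> carrier A" using S(1) T(1) by (auto simp: W_def)
    moreover have "Q \<in> U \<inter> V \<longleftrightarrow> Q \<in> Spec A - zeros A W" for Q
    proof
      assume "Q \<in> U \<inter> V"
      then obtain s t where "Q \<in> Spec A" "s \<in> S" "s \<notin> Q" "t \<in> T" "t \<notin> Q"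
        using S T by (auto simp: zeros_def)
      moreover from this have "s \<otimes>\<^bsub>A\<^esub> t \<notin> Q"
        using Spec_mult_iff[of Q A s t] S T by blast
      ultimately show "Q \<in> Spec A - zeros A W"
        by (auto simp: zeros_def W_def)
    next
      assume "Q \<in> Spec A - zeros A W"
      then obtain s t where "Q \<in> Spec A" "s \<in> S" "t \<in> T" "s \<otimes>\<^bsub>A\<^esub> t \<notin> Q"
        by (auto simp: zeros_def W_def)
      moreover from this have "s \<notin> Q" "t \<notin> Q"
        using Spec_mult_iff[of Q A s t] S T by blast+
      ultimately show "Q \<in> U \<inter> V" using S T by (auto simp: zeros_def)
    qed
    ultimately show ?thesis by blast
  qed
next
  fix K
  assume K: "\<forall>U\<in>K. \<exists>T\<subseteq>carrier A. U = Spec A - zeros A T"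
  define W where "W = \<Union>{T. T \<subseteq> carrier A \<and> Spec A - zeros A T \<in> K}"
  have "Q \<in> \<Union>K \<longleftrightarrow> Q \<in> Spec A - zeros A W" for Q
  proof
    assume "Q \<in> \<Union>K"
    then obtain U where U: "U \<in> K" "Q \<in> U" by (rule UnionE)
    then obtain T where "T \<subseteq> carrier A" "U = Spec A - zeros A T"
      using bspec[OF K, of U] by auto
    with U have "T \<subseteq> carrier A" "Spec A - zeros A T \<in> K" "Q \<in> Spec A - zeros A T" by simp_all
    then show "Q \<in> Spec A - zeros A W" by (auto simp: zeros_def W_def)
  next
    assume "Q \<in> Spec A - zeros A W"
    then obtain t T where "Q \<in> Spec A" "t \<in> T" "t \<notin> Q" "T \<subseteq> carrier A" "Spec A - zeros A T \<in> K"
      by (auto simp: zeros_def W_def)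
    then have "Q \<in> Spec A - zeros A T" by (auto simp: zeros_def)
    then show "Q \<in> \<Union>K" using \<open>Spec A - zeros A T \<in> K\<close> by (rule UnionI[rotated])
  qed
  then have "\<Union>K = Spec A - zeros A W" by (rule Set.set_eqI)
  moreover have "W \<subseteq> carrier A" by (auto simp: W_def)
  ultimately show "\<exists>T\<subseteq>carrier A. \<Union>K = Spec A - zeros A T" by (intro exI conjI)
qed

lemma openin_zariski: "openin (zariski A) U \<longleftrightarrow> (\<exists>T \<subseteq> carrier A. U = Spec A - zeros A T)"
  unfolding zariski_def by (simp add: topology_inverse'[OF istopology_zariski])

lemma topspace_zariski [simp]: "topspace (zariski A) = Spec A"
proof
  show "topspace (zariski A) \<subseteq> Spec A"
    unfolding topspace_def openin_zariski by blast
  have "openin (zariski A) (Spec A)" if "Spec A \<noteq> {}"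
  proof -
    from that obtain P where "primeideal P A" by (auto simp: Spec_def)
    then interpret P: primeideal P A .
    have "\<one>\<^bsub>A\<^esub> \<notin> Q" if "Q \<in> Spec A" for Q
    proof -
      interpret Q: primeideal Q A using that by (simp add: Spec_def)
      show ?thesis using Q.I_notcarr Q.one_imp_carrier by blast
    qed
    then have "Spec A = Spec A - zeros A {\<one>\<^bsub>A\<^esub>}" by (auto simp: zeros_def)
    then show ?thesis unfolding openin_zariski by (intro exI[of _ "{\<one>\<^bsub>A\<^esub>}"]) auto
  qed
  then show "Spec A \<subseteq> topspace (zariski A)"
    by (cases "Spec A = {}") (simp_all add: openin_subset)
qed

lemma closedin_zariski: "closedin (zariski A) C \<longleftrightarrow> (\<exists>T \<subseteq> carrier A. C = zeros A T)"
proof -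
  have "zeros A T \<subseteq> Spec A" for T by (auto simp: zeros_def)
  then have "(C \<subseteq> Spec A \<and> Spec A - C = Spec A - zeros A T) \<longleftrightarrow> C = zeros A T" for T by blast
  then show ?thesis
    unfolding closedin_def openin_zariski topspace_zariski by blast
qed

text \<open>The smallest closed set that contains \<open>S\<close> is cut out by the functions vanishing at all of \<open>S\<close>.\<close>

lemma closure_of_zariski:
  assumes "S \<subseteq> Spec A"
  shows "zariski A closure_of S = {Q \<in> Spec A. carrier A \<inter> \<Inter>S \<subseteq> Q}"
proof (rule Set.set_eqI)
  fix Q
  show "Q \<in> zariski A closure_of S \<longleftrightarrow> Q \<in> {Q \<in> Spec A. carrier A \<inter> \<Inter>S \<subseteq> Q}"
  proof
    assume Q: "Q \<in> zariski A closure_of S"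
    have "closedin (zariski A) (zeros A (carrier A \<inter> \<Inter>S))" "S \<subseteq> zeros A (carrier A \<inter> \<Inter>S)"
      using assms by (auto simp: closedin_zariski zeros_def)
    then have "zariski A closure_of S \<subseteq> zeros A (carrier A \<inter> \<Inter>S)"
      by (simp add: closure_of_minimal)
    then show "Q \<in> {Q \<in> Spec A. carrier A \<inter> \<Inter>S \<subseteq> Q}"
      using Q by (auto simp: zeros_def)
  next
    assume Q: "Q \<in> {Q \<in> Spec A. carrier A \<inter> \<Inter>S \<subseteq> Q}"
    have "\<exists>P\<in>S. P \<in> U" if U: "Q \<in> U" "openin (zariski A) U" for U
    proof -
      obtain T where T: "T \<subseteq> carrier A" "U = Spec A - zeros A T"
        using U(2) by (auto simp: openin_zariski)
      then obtain t where "t \<in> T" "t \<notin> Q" using U(1) Q by (auto simp: zeros_def)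
      then have "t \<notin> \<Inter>S" using Q T by auto
      then show ?thesis using T \<open>t \<in> T\<close> assms by (auto simp: zeros_def)
    qed
    then show "Q \<in> zariski A closure_of S"
      using Q by (auto simp: in_closure_of)
  qed
qed

lemma closure_of_zariski_point:
  assumes "P \<in> Spec A"
  shows "zariski A closure_of {P} = {Q \<in> Spec A. P \<subseteq> Q}"
  using closure_of_zariski[of "{P}" A] SpecD(1)[OF assms] assms by auto


section \<open>Quotient fields and residue fields\<close>

context domain
begin

lemma frac_rel_iff:
  "((a, b), (c, d)) \<in> frac_rel R \<longleftrightarrow> a \<in> carrier R \<and> b \<in> carrier R - {\<zero>} \<and>
     c \<in> carrier R \<and> d \<in> carrier R - {\<zero>} \<and> a \<otimes> d = c \<otimes> b"
  by (simp add: frac_rel_def)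

lemma equiv_frac_rel: "equiv (carrier R \<times> (carrier R - {\<zero>})) (frac_rel R)"
proof (rule equivI)
  show "frac_rel R \<subseteq> (carrier R \<times> (carrier R - {\<zero>})) \<times> (carrier R \<times> (carrier R - {\<zero>}))"
    by (auto simp: frac_rel_def)
  show "refl_on (carrier R \<times> (carrier R - {\<zero>})) (frac_rel R)"
    by (auto simp: refl_on_def frac_rel_def)
  show "sym (frac_rel R)"
    by (auto simp: sym_def frac_rel_def)
  show "trans (frac_rel R)"
  proof (rule transI, clarsimp simp: frac_rel_iff)
    fix a b c d e f
    assume *: "a \<in> carrier R" "b \<in> carrier R" "c \<in> carrier R" "d \<in> carrier R" "e \<in> carrier R" "f \<in> carrier R"
      "b \<noteq> \<zero>" "d \<noteq> \<zero>" "f \<noteq> \<zero>" and eq: "a \<otimes> d = c \<otimes> b" "c \<otimes> f = e \<otimes> d"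
    have "d \<otimes> (a \<otimes> f) = (a \<otimes> d) \<otimes> f" using * by (simp add: m_ac)
    also have "\<dots> = (c \<otimes> f) \<otimes> b" using * eq(1) by (simp add: m_ac)
    also have "\<dots> = d \<otimes> (e \<otimes> b)" using * eq(2) by (simp add: m_ac)
    finally show "a \<otimes> f = e \<otimes> b" using * m_lcancel[of d "a \<otimes> f" "e \<otimes> b"] by simp
  qed
qed

lemma frac_class_eq_iff:
  assumes "a \<in> carrier R" "b \<in> carrier R - {\<zero>}" "c \<in> carrier R" "d \<in> carrier R - {\<zero>}"
  shows "frac_class R a b = frac_class R c d \<longleftrightarrow> a \<otimes> d = c \<otimes> b"
  unfolding frac_class_def
  using eq_equiv_class_iff[OF equiv_frac_rel, of "(a, b)" "(c, d)"] assms
  by (simp add: frac_rel_iff)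

lemma frac_class_memD:
  assumes "(a', b') \<in> frac_class R a b"
  shows "a' \<in> carrier R" "b' \<in> carrier R - {\<zero>}" "a \<otimes> b' = a' \<otimes> b" "a \<in> carrier R" "b \<in> carrier R - {\<zero>}"
  using assms by (auto simp: frac_class_def frac_rel_def)

lemma frac_class_self:
  "a \<in> carrier R \<Longrightarrow> b \<in> carrier R - {\<zero>} \<Longrightarrow> (a, b) \<in> frac_class R a b"
  by (simp add: frac_class_def frac_rel_def)

lemma frac_class_in_carrier [simp]:
  assumes "a \<in> carrier R" "b \<in> carrier R" "b \<noteq> \<zero>"
  shows "frac_class R a b \<in> carrier (frac_field R)"
  using assms quotientI[of "(a, b)" "carrier R \<times> (carrier R - {\<zero>})" "frac_rel R"]
  by (simp add: frac_field_def frac_class_def)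

lemma frac_fieldE:
  assumes "x \<in> carrier (frac_field R)"
  obtains a b where "a \<in> carrier R" "b \<in> carrier R" "b \<noteq> \<zero>" "x = frac_class R a b"
  using assms unfolding frac_field_def frac_class_def by (auto elim!: quotientE)

lemma frac_field_one: "\<one>\<^bsub>frac_field R\<^esub> = frac_class R \<one> \<one>"
  and frac_field_zero: "\<zero>\<^bsub>frac_field R\<^esub> = frac_class R \<zero> \<one>"
  by (simp_all add: frac_field_def)

text \<open>The operations of the quotient field are unions over all representatives; they are well defined
  once the united sets agree.\<close>

lemma UN_const_frac_class:
  assumes "a \<in> carrier R" "b \<in> carrier R - {\<zero>}" "c \<in> carrier R" "d \<in> carrier R - {\<zero>}"
    and "\<And>a' b' c' d'. (a', b') \<in> frac_class R a b \<Longrightarrow> (c', d') \<in> frac_class R c d \<Longrightarrow> F a' b' c' d' = C"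
  shows "(\<Union>(a', b') \<in> frac_class R a b. \<Union>(c', d') \<in> frac_class R c d. F a' b' c' d') = C"
proof -
  have "(\<Union>(a', b') \<in> frac_class R a b. \<Union>(c', d') \<in> frac_class R c d. F a' b' c' d') =
    (\<Union>x \<in> frac_class R a b. \<Union>y \<in> frac_class R c d. C)"
    using assms(5) by (intro SUP_cong) (auto split: prod.splits)
  also have "\<dots> = C"
    using frac_class_self[OF assms(1,2)] frac_class_self[OF assms(3,4)] by auto
  finally show ?thesis .
qed

lemma frac_field_mult:
  assumes "a \<in> carrier R" "b \<in> carrier R" "b \<noteq> \<zero>" "c \<in> carrier R" "d \<in> carrier R" "d \<noteq> \<zero>"
  shows "frac_class R a b \<otimes>\<^bsub>frac_field R\<^esub> frac_class R c d = frac_class R (a \<otimes> c) (b \<otimes> d)"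
proof -
  have "(\<Union>(a', b') \<in> frac_class R a b. \<Union>(c', d') \<in> frac_class R c d. frac_class R (a' \<otimes> c') (b' \<otimes> d')) =
    frac_class R (a \<otimes> c) (b \<otimes> d)"
  proof (rule UN_const_frac_class)
    fix a' b' c' d' assume "(a', b') \<in> frac_class R a b" "(c', d') \<in> frac_class R c d"
    note eq = frac_class_memD(3)[OF this(1)] frac_class_memD(3)[OF this(2)]
      and * = frac_class_memD(1,2,4,5)[OF this(1)] frac_class_memD(1,2,4,5)[OF this(2)]
    have "(a' \<otimes> c') \<otimes> (b \<otimes> d) = (a' \<otimes> b) \<otimes> (c' \<otimes> d)" using * by (simp add: m_ac)
    also have "\<dots> = (a \<otimes> b') \<otimes> (c \<otimes> d')" by (simp only: eq)
    also have "\<dots> = (a \<otimes> c) \<otimes> (b' \<otimes> d')" using * by (simp add: m_ac)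
    finally show "frac_class R (a' \<otimes> c') (b' \<otimes> d') = frac_class R (a \<otimes> c) (b \<otimes> d)"
      using * integral_iff by (subst frac_class_eq_iff) auto
  qed (use assms in auto)
  then show ?thesis by (simp add: frac_field_def)
qed

lemma frac_field_add:
  assumes "a \<in> carrier R" "b \<in> carrier R" "b \<noteq> \<zero>" "c \<in> carrier R" "d \<in> carrier R" "d \<noteq> \<zero>"
  shows "frac_class R a b \<oplus>\<^bsub>frac_field R\<^esub> frac_class R c d = frac_class R (a \<otimes> d \<oplus> c \<otimes> b) (b \<otimes> d)"
proof -
  have "(\<Union>(a', b') \<in> frac_class R a b. \<Union>(c', d') \<in> frac_class R c d.
      frac_class R (a' \<otimes> d' \<oplus> c' \<otimes> b') (b' \<otimes> d')) =
    frac_class R (a \<otimes> d \<oplus> c \<otimes> b) (b \<otimes> d)"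
  proof (rule UN_const_frac_class)
    fix a' b' c' d' assume "(a', b') \<in> frac_class R a b" "(c', d') \<in> frac_class R c d"
    note eq = frac_class_memD(3)[OF this(1)] frac_class_memD(3)[OF this(2)]
      and * = frac_class_memD(1,2,4,5)[OF this(1)] frac_class_memD(1,2,4,5)[OF this(2)]
    have "(a' \<otimes> d' \<oplus> c' \<otimes> b') \<otimes> (b \<otimes> d) = (a' \<otimes> b) \<otimes> (d \<otimes> d') \<oplus> (c' \<otimes> d) \<otimes> (b \<otimes> b')"
      using * by (simp add: l_distr r_distr m_ac)
    also have "\<dots> = (a \<otimes> b') \<otimes> (d \<otimes> d') \<oplus> (c \<otimes> d') \<otimes> (b \<otimes> b')" by (simp only: eq)
    also have "\<dots> = (a \<otimes> d \<oplus> c \<otimes> b) \<otimes> (b' \<otimes> d')" using * by (simp add: l_distr r_distr m_ac)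
    finally show "frac_class R (a' \<otimes> d' \<oplus> c' \<otimes> b') (b' \<otimes> d') = frac_class R (a \<otimes> d \<oplus> c \<otimes> b) (b \<otimes> d)"
      using * integral_iff by (subst frac_class_eq_iff) auto
  qed (use assms in auto)
  then show ?thesis by (simp add: frac_field_def)
qed

lemma frac_class_zero_iff:
  assumes "a \<in> carrier R" "b \<in> carrier R" "b \<noteq> \<zero>"
  shows "frac_class R a b = \<zero>\<^bsub>frac_field R\<^esub> \<longleftrightarrow> a = \<zero>"
  unfolding frac_field_zero using assms by (subst frac_class_eq_iff) auto

lemma field_frac_field: "field (frac_field R)" (is "field ?Q")
proof (rule cring.cring_fieldI2)
  show "cring ?Q"
  proof (rule cringI)
    show "abelian_group ?Q"
    proof (rule abelian_groupI)
      fix x y z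
      assume "x \<in> carrier ?Q" "y \<in> carrier ?Q" "z \<in> carrier ?Q"
      then show "x \<oplus>\<^bsub>?Q\<^esub> y \<oplus>\<^bsub>?Q\<^esub> z = x \<oplus>\<^bsub>?Q\<^esub> (y \<oplus>\<^bsub>?Q\<^esub> z)"
        by (elim frac_fieldE) (simp add: frac_field_add integral_iff l_distr r_distr m_ac a_ac)
    next
      fix x y
      assume "x \<in> carrier ?Q" "y \<in> carrier ?Q"
      then show "x \<oplus>\<^bsub>?Q\<^esub> y = y \<oplus>\<^bsub>?Q\<^esub> x" "x \<oplus>\<^bsub>?Q\<^esub> y \<in> carrier ?Q"
        by (elim frac_fieldE, simp add: frac_field_add integral_iff m_ac a_ac)+
    next
      fix x
      assume "x \<in> carrier ?Q"
      then obtain a b where *: "a \<in> carrier R" "b \<in> carrier R" "b \<noteq> \<zero>" "x = frac_class R a b"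
        by (elim frac_fieldE)
      then show "\<zero>\<^bsub>?Q\<^esub> \<oplus>\<^bsub>?Q\<^esub> x = x"
        by (simp add: frac_field_zero frac_field_add)
      have "(\<ominus> a) \<otimes> b \<oplus> a \<otimes> b = \<zero>" using * by (simp add: l_minus l_neg)
      then have "frac_class R (\<ominus> a) b \<oplus>\<^bsub>?Q\<^esub> x = \<zero>\<^bsub>?Q\<^esub>"
        using * by (simp add: frac_field_add frac_class_zero_iff integral_iff)
      then show "\<exists>y\<in>carrier ?Q. y \<oplus>\<^bsub>?Q\<^esub> x = \<zero>\<^bsub>?Q\<^esub>"
        using * by (intro bexI[of _ "frac_class R (\<ominus> a) b"]) auto
    qed (simp add: frac_field_zero)
  next
    show "comm_monoid ?Q"
    proof (rule comm_monoidI)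
      fix x y z
      assume "x \<in> carrier ?Q" "y \<in> carrier ?Q" "z \<in> carrier ?Q"
      then show "x \<otimes>\<^bsub>?Q\<^esub> y \<otimes>\<^bsub>?Q\<^esub> z = x \<otimes>\<^bsub>?Q\<^esub> (y \<otimes>\<^bsub>?Q\<^esub> z)"
        by (elim frac_fieldE) (simp add: frac_field_mult integral_iff m_ac)
    next
      fix x y
      assume "x \<in> carrier ?Q" "y \<in> carrier ?Q"
      then show "x \<otimes>\<^bsub>?Q\<^esub> y = y \<otimes>\<^bsub>?Q\<^esub> x" "x \<otimes>\<^bsub>?Q\<^esub> y \<in> carrier ?Q"
        by (elim frac_fieldE, simp add: frac_field_mult integral_iff m_ac)+
    next
      fix x
      assume "x \<in> carrier ?Q"
      then show "\<one>\<^bsub>?Q\<^esub> \<otimes>\<^bsub>?Q\<^esub> x = x"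
        by (elim frac_fieldE) (simp add: frac_field_one frac_field_mult)
    qed (simp add: frac_field_one)
  next
    fix x y z
    assume "x \<in> carrier ?Q" "y \<in> carrier ?Q" "z \<in> carrier ?Q"
    then obtain a b c d e f where *: "a \<in> carrier R" "b \<in> carrier R" "b \<noteq> \<zero>" "x = frac_class R a b"
      "c \<in> carrier R" "d \<in> carrier R" "d \<noteq> \<zero>" "y = frac_class R c d"
      "e \<in> carrier R" "f \<in> carrier R" "f \<noteq> \<zero>" "z = frac_class R e f"
      by (elim frac_fieldE)
    have "(a \<otimes> d \<oplus> c \<otimes> b) \<otimes> e \<otimes> (b \<otimes> f \<otimes> (d \<otimes> f)) =
        (a \<otimes> e \<otimes> (d \<otimes> f) \<oplus> c \<otimes> e \<otimes> (b \<otimes> f)) \<otimes> (b \<otimes> d \<otimes> f)"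
      using * by (simp add: l_distr r_distr m_ac)
    then show "(x \<oplus>\<^bsub>?Q\<^esub> y) \<otimes>\<^bsub>?Q\<^esub> z = x \<otimes>\<^bsub>?Q\<^esub> z \<oplus>\<^bsub>?Q\<^esub> y \<otimes>\<^bsub>?Q\<^esub> z"
      using * by (simp add: frac_field_mult frac_field_add integral_iff frac_class_eq_iff)
  qed
next
  show "\<zero>\<^bsub>frac_field R\<^esub> \<noteq> \<one>\<^bsub>frac_field R\<^esub>"
    using frac_class_zero_iff[of \<one> \<one>] by (auto simp: frac_field_one)
next
  fix x
  assume "x \<in> carrier (frac_field R)" "x \<noteq> \<zero>\<^bsub>frac_field R\<^esub>"
  then obtain a b where *: "a \<in> carrier R" "b \<in> carrier R" "b \<noteq> \<zero>" "x = frac_class R a b" "a \<noteq> \<zero>"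
    by (elim frac_fieldE) (auto simp: frac_class_zero_iff)
  then have "x \<otimes>\<^bsub>frac_field R\<^esub> frac_class R b a = \<one>\<^bsub>frac_field R\<^esub>"
    by (simp add: frac_field_mult frac_field_one integral_iff frac_class_eq_iff m_ac)
  then show "\<exists>y\<in>carrier (frac_field R). x \<otimes>\<^bsub>frac_field R\<^esub> y = \<one>\<^bsub>frac_field R\<^esub>"
    using * by (intro bexI[of _ "frac_class R b a"]) auto
qed

text \<open>The extension sends \<open>a / b\<close> to the unique element \<open>y\<close> with \<open>y \<phi>(b) = \<phi>(a)\<close>.  All identities are
  checked against this characterization, which avoids computing with inverses.\<close>

lemma frac_field_extend:
  assumes F: "field F" and \<phi>: "\<phi> \<in> ring_hom R F"
    and inj: "\<And>a. a \<in> carrier R \<Longrightarrow> \<phi> a = \<zero>\<^bsub>F\<^esub> \<Longrightarrow> a = \<zero>"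
  obtains \<iota> where "\<iota> \<in> ring_hom (frac_field R) F"
    "\<And>a b. a \<in> carrier R \<Longrightarrow> b \<in> carrier R \<Longrightarrow> b \<noteq> \<zero> \<Longrightarrow>
       \<iota> (frac_class R a b) = \<phi> a \<otimes>\<^bsub>F\<^esub> inv\<^bsub>F\<^esub> (\<phi> b)"
proof -
  interpret F: field F by fact
  let ?q = "\<lambda>a b. \<phi> a \<otimes>\<^bsub>F\<^esub> inv\<^bsub>F\<^esub> (\<phi> b)"
  have \<phi>F: "\<phi> a \<in> carrier F" if "a \<in> carrier R" for a
    using \<phi> that by (rule ring_hom_closed)
  have \<phi>i: "inv\<^bsub>F\<^esub> (\<phi> b) \<in> carrier F" "inv\<^bsub>F\<^esub> (\<phi> b) \<otimes>\<^bsub>F\<^esub> \<phi> b = \<one>\<^bsub>F\<^esub>"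
    if "b \<in> carrier R" "b \<noteq> \<zero>" for b
  proof -
    have "\<phi> b \<in> Units F" using \<phi>F inj[of b] that by (auto simp: F.field_Units)
    then show "inv\<^bsub>F\<^esub> (\<phi> b) \<in> carrier F" "inv\<^bsub>F\<^esub> (\<phi> b) \<otimes>\<^bsub>F\<^esub> \<phi> b = \<one>\<^bsub>F\<^esub>"
      by (rule F.Units_inv_closed, rule F.Units_l_inv)
  qed
  have q: "?q a b \<in> carrier F" "?q a b \<otimes>\<^bsub>F\<^esub> \<phi> b = \<phi> a"
    if "a \<in> carrier R" "b \<in> carrier R" "b \<noteq> \<zero>" for a b
    using that \<phi>F \<phi>i by (simp_all add: F.m_assoc)
  have q_unique: "?q a b = y"
    if "a \<in> carrier R" "b \<in> carrier R" "b \<noteq> \<zero>" "y \<in> carrier F" "y \<otimes>\<^bsub>F\<^esub> \<phi> b = \<phi> a" for a b y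
    using that q[of a b] \<phi>F[of b] inj[of b] F.m_rcancel[of "\<phi> b" "?q a b" y] by auto
  define \<iota> where "\<iota> U = (let ab = (SOME ab. ab \<in> U) in ?q (fst ab) (snd ab))" for U
  have \<iota>: "\<iota> (frac_class R a b) = ?q a b" if ab: "a \<in> carrier R" "b \<in> carrier R" "b \<noteq> \<zero>" for a b
  proof -
    obtain a' b' where ab': "(SOME ab. ab \<in> frac_class R a b) = (a', b')" by fastforce
    have "(a', b') \<in> frac_class R a b"
      unfolding ab'[symmetric] by (rule someI[of _ "(a, b)"]) (use ab in \<open>auto simp: frac_class_self\<close>)
    note * = frac_class_memD[OF this]
    have eq: "\<phi> a \<otimes>\<^bsub>F\<^esub> \<phi> b' = \<phi> a' \<otimes>\<^bsub>F\<^esub> \<phi> b"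
      using arg_cong[OF *(3), of \<phi>] ring_hom_mult[OF \<phi>, of a b'] ring_hom_mult[OF \<phi>, of a' b] * by auto
    have cl: "\<phi> a \<in> carrier F" "\<phi> b \<in> carrier F" "\<phi> a' \<in> carrier F" "\<phi> b' \<in> carrier F"
      "inv\<^bsub>F\<^esub> (\<phi> b) \<in> carrier F" "\<phi> b \<otimes>\<^bsub>F\<^esub> inv\<^bsub>F\<^esub> (\<phi> b) = \<one>\<^bsub>F\<^esub>"
      using * \<phi>F \<phi>i[of b] F.m_comm[of "\<phi> b"] by auto
    have "?q a b \<otimes>\<^bsub>F\<^esub> \<phi> b' = (\<phi> a \<otimes>\<^bsub>F\<^esub> \<phi> b') \<otimes>\<^bsub>F\<^esub> inv\<^bsub>F\<^esub> (\<phi> b)"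
      using cl by (simp add: F.m_ac)
    also have "\<dots> = \<phi> a' \<otimes>\<^bsub>F\<^esub> (\<phi> b \<otimes>\<^bsub>F\<^esub> inv\<^bsub>F\<^esub> (\<phi> b))"
      using cl(1-5) by (simp add: F.m_assoc eq)
    finally have "?q a' b' = ?q a b"
      using * cl q by (intro q_unique) auto
    then show ?thesis by (simp add: \<iota>_def ab')
  qed
  have "\<iota> \<in> ring_hom (frac_field R) F"
  proof (rule ring_hom_memI)
    fix x assume "x \<in> carrier (frac_field R)"
    then obtain a b where *: "a \<in> carrier R" "b \<in> carrier R" "b \<noteq> \<zero>" "x = frac_class R a b"
      by (elim frac_fieldE)
    then show "\<iota> x \<in> carrier F" using q by (simp add: \<iota>)
    fix y assume "y \<in> carrier (frac_field R)"
    then obtain c d where **: "c \<in> carrier R" "d \<in> carrier R" "d \<noteq> \<zero>" "y = frac_class R c d"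
      by (elim frac_fieldE)
    obtain u v where uv: "u = ?q a b" "v = ?q c d" by blast
    then have u: "u \<in> carrier F" "u \<otimes>\<^bsub>F\<^esub> \<phi> b = \<phi> a" and v: "v \<in> carrier F" "v \<otimes>\<^bsub>F\<^esub> \<phi> d = \<phi> c"
      using q * ** by auto
    have cl: "\<phi> b \<in> carrier F" "\<phi> d \<in> carrier F" using * ** \<phi>F by auto
    have bd: "b \<otimes> d \<noteq> \<zero>" using * ** by (simp add: integral_iff)
    have "(u \<otimes>\<^bsub>F\<^esub> v) \<otimes>\<^bsub>F\<^esub> (\<phi> b \<otimes>\<^bsub>F\<^esub> \<phi> d) = (u \<otimes>\<^bsub>F\<^esub> \<phi> b) \<otimes>\<^bsub>F\<^esub> (v \<otimes>\<^bsub>F\<^esub> \<phi> d)"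
      using u(1) v(1) cl by (simp add: F.m_ac)
    then have "?q (a \<otimes> c) (b \<otimes> d) = u \<otimes>\<^bsub>F\<^esub> v"
      using * ** bd u v by (intro q_unique) (auto simp: ring_hom_mult[OF \<phi>])
    then show "\<iota> (x \<otimes>\<^bsub>frac_field R\<^esub> y) = \<iota> x \<otimes>\<^bsub>F\<^esub> \<iota> y"
      using * ** bd uv by (simp add: frac_field_mult \<iota>)
    have "(u \<oplus>\<^bsub>F\<^esub> v) \<otimes>\<^bsub>F\<^esub> (\<phi> b \<otimes>\<^bsub>F\<^esub> \<phi> d) = (u \<otimes>\<^bsub>F\<^esub> \<phi> b) \<otimes>\<^bsub>F\<^esub> \<phi> d \<oplus>\<^bsub>F\<^esub> (v \<otimes>\<^bsub>F\<^esub> \<phi> d) \<otimes>\<^bsub>F\<^esub> \<phi> b"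
      using u(1) v(1) cl by (simp add: F.l_distr F.r_distr F.m_ac)
    then have "?q (a \<otimes> d \<oplus> c \<otimes> b) (b \<otimes> d) = u \<oplus>\<^bsub>F\<^esub> v"
      using * ** bd u v by (intro q_unique) (auto simp: ring_hom_mult[OF \<phi>] ring_hom_add[OF \<phi>])
    then show "\<iota> (x \<oplus>\<^bsub>frac_field R\<^esub> y) = \<iota> x \<oplus>\<^bsub>F\<^esub> \<iota> y"
      using * ** bd uv by (simp add: frac_field_add \<iota>)
  next
    show "\<iota> \<one>\<^bsub>frac_field R\<^esub> = \<one>\<^bsub>F\<^esub>"
      by (simp add: frac_field_one \<iota> ring_hom_one[OF \<phi>])
  qed
  then show thesis using \<iota> that by blast
qed

end


lemma domain_Quot: "P \<in> Spec A \<Longrightarrow> domain (A Quot P)"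
  by (auto simp: Spec_def intro: primeideal.quotient_is_domain)

lemma field_residue_field: "P \<in> Spec A \<Longrightarrow> field (residue_field A P)"
  unfolding residue_field_def by (intro domain.field_frac_field domain_Quot)

lemma coset_eq_zero_iff:
  assumes "P \<in> Spec A" "r \<in> carrier A"
  shows "P +>\<^bsub>A\<^esub> r = \<zero>\<^bsub>A Quot P\<^esub> \<longleftrightarrow> r \<in> P"
proof -
  interpret primeideal P A using assms(1) by (simp add: Spec_def)
  show ?thesis
    using rcos_const_imp_mem[OF assms(2)] a_rcos_const[of r] by (auto simp: FactRing_def)
qed

lemma coset_hom: "P \<in> Spec A \<Longrightarrow> (+>\<^bsub>A\<^esub>) P \<in> ring_hom A (A Quot P)"
  by (auto simp: Spec_def primeideal_def intro: ideal.rcos_ring_hom)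

lemma coset_in_carrier: "P \<in> Spec A \<Longrightarrow> r \<in> carrier A \<Longrightarrow> P +>\<^bsub>A\<^esub> r \<in> carrier (A Quot P)"
  by (rule ring_hom_closed[OF coset_hom])

lemma residue_eq_zero_iff:
  assumes "P \<in> Spec A" "r \<in> carrier A"
  shows "residue A P r = \<zero>\<^bsub>residue_field A P\<^esub> \<longleftrightarrow> r \<in> P"
proof -
  interpret Q: domain "A Quot P" using assms(1) by (rule domain_Quot)
  show ?thesis
    unfolding residue_def residue_field_def
    using coset_eq_zero_iff[OF assms] coset_in_carrier[OF assms] by (subst Q.frac_class_zero_iff) auto
qed

lemma residue_hom:
  assumes "P \<in> Spec A"
  shows "residue A P \<in> ring_hom A (residue_field A P)"
proof -
  interpret Q: domain "A Quot P" using assms by (rule domain_Quot)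
  note c = coset_hom[OF assms] and cc = coset_in_carrier[OF assms]
  show ?thesis
    unfolding residue_def residue_field_def
    by (rule ring_hom_memI)
       (use cc in \<open>simp_all add: Q.frac_field_mult Q.frac_field_add ring_hom_mult[OF c] ring_hom_add[OF c]
          ring_hom_one[OF c] Q.frac_field_one\<close>)
qed

lemma Quot_carrierE:
  assumes "U \<in> carrier (A Quot P)"
  obtains r where "r \<in> carrier A" "U = P +>\<^bsub>A\<^esub> r"
  using assms by (auto simp: FactRing_simps)

lemma frac_class_residue:
  assumes P: "P \<in> Spec A" and ab: "a \<in> carrier A" "b \<in> carrier A" "b \<notin> P"
  shows "frac_class (A Quot P) (P +>\<^bsub>A\<^esub> a) (P +>\<^bsub>A\<^esub> b) =
    residue A P a \<otimes>\<^bsub>residue_field A P\<^esub> inv\<^bsub>residue_field A P\<^esub> (residue A P b)"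
proof -
  interpret Q: domain "A Quot P" using P by (rule domain_Quot)
  interpret K: field "residue_field A P" using P by (rule field_residue_field)
  let ?a = "P +>\<^bsub>A\<^esub> a" and ?b = "P +>\<^bsub>A\<^esub> b"
  have *: "?a \<in> carrier (A Quot P)" "?b \<in> carrier (A Quot P)" "?b \<noteq> \<zero>\<^bsub>A Quot P\<^esub>"
    using coset_eq_zero_iff[OF P ab(2)] coset_in_carrier[OF P] ab by auto
  have b: "residue A P b \<in> Units (residue_field A P)"
    using residue_eq_zero_iff[OF P] ab ring_hom_closed[OF residue_hom[OF P]] K.field_Units by auto
  have a: "residue A P a \<in> carrier (residue_field A P)"
    using ab ring_hom_closed[OF residue_hom[OF P]] by auto
  have x: "frac_class (A Quot P) ?a ?b \<in> carrier (residue_field A P)"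
    using * by (simp add: residue_field_def)
  have "frac_class (A Quot P) ?a ?b \<otimes>\<^bsub>residue_field A P\<^esub> residue A P b = residue A P a"
    using * by (simp add: residue_def residue_field_def Q.frac_field_mult Q.frac_class_eq_iff Q.m_ac)
  then have "residue A P a \<otimes>\<^bsub>residue_field A P\<^esub> inv\<^bsub>residue_field A P\<^esub> (residue A P b) =
      frac_class (A Quot P) ?a ?b \<otimes>\<^bsub>residue_field A P\<^esub>
        (residue A P b \<otimes>\<^bsub>residue_field A P\<^esub> inv\<^bsub>residue_field A P\<^esub> (residue A P b))"
    using x b K.m_assoc[of "frac_class (A Quot P) ?a ?b" "residue A P b" "inv\<^bsub>residue_field A P\<^esub> (residue A P b)"]
    by auto
  then show ?thesis using x b by simp
qed

lemma residue_fieldE: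
  assumes "P \<in> Spec A" "x \<in> carrier (residue_field A P)"
  obtains a b where "a \<in> carrier A" "b \<in> carrier A" "b \<notin> P"
    "x = residue A P a \<otimes>\<^bsub>residue_field A P\<^esub> inv\<^bsub>residue_field A P\<^esub> (residue A P b)"
proof -
  interpret Q: domain "A Quot P" using assms(1) by (rule domain_Quot)
  obtain u v where *: "u \<in> carrier (A Quot P)" "v \<in> carrier (A Quot P)" "v \<noteq> \<zero>\<^bsub>A Quot P\<^esub>"
      "x = frac_class (A Quot P) u v"
    using assms(2) unfolding residue_field_def by (rule Q.frac_fieldE)
  obtain a b where ab: "a \<in> carrier A" "u = P +>\<^bsub>A\<^esub> a" "b \<in> carrier A" "v = P +>\<^bsub>A\<^esub> b"
    using *(1,2) by (elim Quot_carrierE)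
  then show thesis
    using * that coset_eq_zero_iff[OF assms(1)] frac_class_residue[OF assms(1)] by metis
qed

text \<open>A homomorphism to a field whose kernel is exactly \<open>P\<close> factors through the quotient by \<open>P\<close>, injectively,
  and hence through its quotient field.\<close>

lemma residue_field_extend:
  assumes P: "P \<in> Spec A" and F: "field F" and \<phi>: "\<phi> \<in> ring_hom A F"
    and ker: "\<And>a. a \<in> carrier A \<Longrightarrow> \<phi> a = \<zero>\<^bsub>F\<^esub> \<longleftrightarrow> a \<in> P"
  obtains \<iota> where "\<iota> \<in> ring_hom (residue_field A P) F"
    "\<And>a. a \<in> carrier A \<Longrightarrow> \<iota> (residue A P a) = \<phi> a"
proof -
  interpret P: primeideal P A using P by (simp add: Spec_def)
  interpret Q: domain "A Quot P" using P by (rule domain_Quot)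
  interpret F: field F by fact
  define \<psi> where "\<psi> U = \<phi> (SOME a. a \<in> U)" for U
  have \<psi>: "\<psi> (P +>\<^bsub>A\<^esub> a) = \<phi> a" if a: "a \<in> carrier A" for a
  proof -
    have "a \<in> P +>\<^bsub>A\<^esub> a" using a by (rule P.a_rcos_self)
    then have "(SOME x. x \<in> P +>\<^bsub>A\<^esub> a) \<in> P +>\<^bsub>A\<^esub> a" by (rule someI)
    then obtain p where p: "p \<in> P" "(SOME x. x \<in> P +>\<^bsub>A\<^esub> a) = p \<oplus>\<^bsub>A\<^esub> a"
      by (auto simp: a_r_coset_def r_coset_def)
    then have "p \<in> carrier A" by auto
    then show ?thesis
      using p a ker[of p] ring_hom_closed[OF \<phi> a] by (simp add: \<psi>_def ring_hom_add[OF \<phi>])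
  qed
  have hom: "\<psi> \<in> ring_hom (A Quot P) F"
  proof (rule ring_hom_memI)
    fix U assume "U \<in> carrier (A Quot P)"
    then obtain a where a: "a \<in> carrier A" "U = P +>\<^bsub>A\<^esub> a" by (rule Quot_carrierE)
    then show "\<psi> U \<in> carrier F" using ring_hom_closed[OF \<phi>] by (simp add: \<psi>)
    fix V assume "V \<in> carrier (A Quot P)"
    then obtain b where b: "b \<in> carrier A" "V = P +>\<^bsub>A\<^esub> b" by (rule Quot_carrierE)
    note h = coset_hom[OF P]
    show "\<psi> (U \<otimes>\<^bsub>A Quot P\<^esub> V) = \<psi> U \<otimes>\<^bsub>F\<^esub> \<psi> V" "\<psi> (U \<oplus>\<^bsub>A Quot P\<^esub> V) = \<psi> U \<oplus>\<^bsub>F\<^esub> \<psi> V"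
      using a b by (simp_all add: \<psi> ring_hom_mult[OF \<phi>] ring_hom_add[OF \<phi>]
          flip: ring_hom_mult[OF h] ring_hom_add[OF h])
  next
    show "\<psi> \<one>\<^bsub>A Quot P\<^esub> = \<one>\<^bsub>F\<^esub>"
      using \<psi>[of "\<one>\<^bsub>A\<^esub>"] by (simp add: FactRing_def ring_hom_one[OF \<phi>])
  qed
  have inj: "U = \<zero>\<^bsub>A Quot P\<^esub>" if "U \<in> carrier (A Quot P)" "\<psi> U = \<zero>\<^bsub>F\<^esub>" for U
    using that ker coset_eq_zero_iff[OF P] by (elim Quot_carrierE) (simp add: \<psi>)
  obtain \<iota> where \<iota>: "\<iota> \<in> ring_hom (frac_field (A Quot P)) F"
    "\<And>a b. a \<in> carrier (A Quot P) \<Longrightarrow> b \<in> carrier (A Quot P) \<Longrightarrow> b \<noteq> \<zero>\<^bsub>A Quot P\<^esub> \<Longrightarrow>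
       \<iota> (frac_class (A Quot P) a b) = \<psi> a \<otimes>\<^bsub>F\<^esub> inv\<^bsub>F\<^esub> (\<psi> b)"
    using Q.frac_field_extend[OF F hom inj] by blast
  have "\<iota> (residue A P a) = \<phi> a" if a: "a \<in> carrier A" for a
    using a coset_in_carrier[OF P a] ring_hom_closed[OF \<phi> a]
    by (simp add: residue_def \<iota>(2) \<psi> ring_hom_one[OF hom])
  then show thesis using \<iota>(1) that by (simp add: residue_field_def)
qed

text \<open>A homomorphism of fields is injective, and the image of the residue field is closed under division;
  so it is enough that every element of the target is a fraction of values of \<open>\<phi>\<close>.\<close>

lemma residue_field_iso:
  assumes P: "P \<in> Spec A" and F: "field F" and \<phi>: "\<phi> \<in> ring_hom A F"
    and ker: "\<And>a. a \<in> carrier A \<Longrightarrow> \<phi> a = \<zero>\<^bsub>F\<^esub> \<longleftrightarrow> a \<in> P"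
    and surj: "\<And>y. y \<in> carrier F \<Longrightarrow>
      \<exists>a \<in> carrier A. \<exists>b \<in> carrier A. b \<notin> P \<and> y \<otimes>\<^bsub>F\<^esub> \<phi> b = \<phi> a"
  obtains \<iota> where "\<iota> \<in> ring_iso (residue_field A P) F"
    "\<And>a. a \<in> carrier A \<Longrightarrow> \<iota> (residue A P a) = \<phi> a"
proof -
  interpret F: field F by fact
  interpret K: field "residue_field A P" using P by (rule field_residue_field)
  obtain \<iota> where \<iota>: "\<iota> \<in> ring_hom (residue_field A P) F"
    "\<And>a. a \<in> carrier A \<Longrightarrow> \<iota> (residue A P a) = \<phi> a"
    using residue_field_extend[OF P F \<phi> ker] by blast
  interpret \<iota>: ring_hom_ring "residue_field A P" F \<iota>
    by (rule ring_hom_ringI2[OF K.ring_axioms F.ring_axioms \<iota>(1)])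
  have "inj_on \<iota> (carrier (residue_field A P))"
    using non_trivial_field_hom_is_inj[OF \<iota>(1) K.field_axioms F.field_axioms] by (auto simp: inj_on_def)
  moreover have "\<iota> ` carrier (residue_field A P) = carrier F"
  proof (intro equalityI subsetI)
    fix y assume y: "y \<in> carrier F"
    then obtain a b where ab: "a \<in> carrier A" "b \<in> carrier A" "b \<notin> P" "y \<otimes>\<^bsub>F\<^esub> \<phi> b = \<phi> a"
      using surj by blast
    let ?a = "residue A P a" and ?b = "residue A P b"
    have c: "?a \<in> carrier (residue_field A P)" "?b \<in> carrier (residue_field A P)"
      using ab ring_hom_closed[OF residue_hom[OF P]] by auto
    moreover have "?b \<noteq> \<zero>\<^bsub>residue_field A P\<^esub>" using ab residue_eq_zero_iff[OF P] by auto
    ultimately have u: "?b \<in> Units (residue_field A P)" by (simp add: K.field_Units)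
    let ?x = "?a \<otimes>\<^bsub>residue_field A P\<^esub> inv\<^bsub>residue_field A P\<^esub> ?b"
    have x: "?x \<in> carrier (residue_field A P)" using c u by simp
    have "?x \<otimes>\<^bsub>residue_field A P\<^esub> ?b = ?a" using c u by (simp add: K.m_assoc)
    then have "\<iota> ?x \<otimes>\<^bsub>F\<^esub> \<phi> b = \<phi> a"
      using x c ab \<iota>(2) by (metis ring_hom_mult[OF \<iota>(1)])
    moreover have "\<phi> b \<noteq> \<zero>\<^bsub>F\<^esub>" "\<phi> b \<in> carrier F" using ab ker ring_hom_closed[OF \<phi>] by auto
    ultimately have "\<iota> ?x = y"
      using ab(4) y x F.m_rcancel[of "\<phi> b" "\<iota> ?x" y] by simp
    then show "y \<in> \<iota> ` carrier (residue_field A P)" using x by blast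
  qed auto
  ultimately have "\<iota> \<in> ring_iso (residue_field A P) F"
    using \<iota>(1) by (simp add: ring_iso_def bij_betw_def)
  then show thesis using \<iota>(2) that by blast
qed


section \<open>Subrings of a type and their prime ideals\<close>

text \<open>All rings of the statement except the residue fields are subrings of rings given by a type.  For
  these, ideals and prime ideals can be described by the operations of the type, and carriers only
  occur as closure conditions.\<close>

definition type_ring :: "'a::comm_ring_1 set \<Rightarrow> 'a ring" where
  "type_ring S = ring_of_type_algebra \<lparr> carrier := S \<rparr>"

lemma type_ring_simps [simp]:
  "carrier (type_ring S) = S" "x \<otimes>\<^bsub>type_ring S\<^esub> y = x * y" "x \<oplus>\<^bsub>type_ring S\<^esub> y = x + y"
  "\<one>\<^bsub>type_ring S\<^esub> = 1" "\<zero>\<^bsub>type_ring S\<^esub> = 0"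
  by (simp_all add: type_ring_def ring_of_type_algebra_def)

lemma type_ring_UNIV: "type_ring UNIV = ring_of_type_algebra"
  by (simp add: type_ring_def ring_of_type_algebra_def)

lemma arc_ring_eq: "arc_ring = type_ring UNIV"
  and plane_ring_eq: "plane_ring = type_ring UNIV"
  by (simp_all add: arc_ring_def plane_ring_def type_ring_UNIV)

locale type_subring =
  fixes S :: "'a::comm_ring_1 set"
  assumes one_mem [simp]: "1 \<in> S"
    and add_mem: "x \<in> S \<Longrightarrow> y \<in> S \<Longrightarrow> x + y \<in> S"
    and mult_mem: "x \<in> S \<Longrightarrow> y \<in> S \<Longrightarrow> x * y \<in> S"
    and uminus_mem: "x \<in> S \<Longrightarrow> - x \<in> S"
begin

lemma zero_mem [simp]: "0 \<in> S"
  using add_mem[OF one_mem uminus_mem[OF one_mem]] by simp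

lemma diff_mem: "x \<in> S \<Longrightarrow> y \<in> S \<Longrightarrow> x - y \<in> S"
  using add_mem[of x "- y"] uminus_mem by simp

lemma power_mem: "x \<in> S \<Longrightarrow> x ^ n \<in> S"
  by (induction n) (auto simp: mult_mem)

lemma sum_mem: "(\<And>i. i \<in> I \<Longrightarrow> f i \<in> S) \<Longrightarrow> sum f I \<in> S"
  by (induction I rule: infinite_finite_induct) (auto simp: add_mem)

lemma of_nat_mem: "of_nat n \<in> S"
  by (induction n) (auto simp: add_mem)

lemma numeral_mem: "numeral n \<in> S"
  using of_nat_mem[of "numeral n"] by simp

lemmas mem_intros = zero_mem one_mem add_mem mult_mem uminus_mem diff_mem power_mem sum_mem numeral_mem

lemma cring_type_ring: "cring (type_ring S)"
proof (rule cringI)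
  show "abelian_group (type_ring S)"
    by (rule abelian_groupI) (auto simp: add_mem add_ac intro: bexI[of _ "- x" for x] uminus_mem)
  show "comm_monoid (type_ring S)"
    by (rule comm_monoidI) (auto simp: mult_mem mult_ac)
qed (auto simp: distrib_right)

lemma minus_type_ring: "x \<in> S \<Longrightarrow> \<ominus>\<^bsub>type_ring S\<^esub> x = - x"
proof -
  assume "x \<in> S"
  interpret cring "type_ring S" by (rule cring_type_ring)
  show ?thesis using minus_equality[of "- x" x] \<open>x \<in> S\<close> uminus_mem by simp
qed

lemma ideal_type_ring_iff:
  "ideal I (type_ring S) \<longleftrightarrow> I \<subseteq> S \<and> 0 \<in> I \<and> (\<forall>x\<in>I. \<forall>y\<in>I. x + y \<in> I) \<and> (\<forall>s\<in>S. \<forall>x\<in>I. s * x \<in> I)"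
proof
  assume "ideal I (type_ring S)"
  then interpret ideal I "type_ring S" .
  show "I \<subseteq> S \<and> 0 \<in> I \<and> (\<forall>x\<in>I. \<forall>y\<in>I. x + y \<in> I) \<and> (\<forall>s\<in>S. \<forall>x\<in>I. s * x \<in> I)"
    using a_subset additive_subgroup.zero_closed[OF is_additive_subgroup]
      additive_subgroup.a_closed[OF is_additive_subgroup] I_l_closed by auto
next
  assume *: "I \<subseteq> S \<and> 0 \<in> I \<and> (\<forall>x\<in>I. \<forall>y\<in>I. x + y \<in> I) \<and> (\<forall>s\<in>S. \<forall>x\<in>I. s * x \<in> I)"
  interpret cring "type_ring S" by (rule cring_type_ring)
  have "- x \<in> I" if "x \<in> I" for x
    using * that uminus_mem[OF one_mem] by (metis mult_minus_left mult_1)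
  then have "inv\<^bsub>add_monoid (type_ring S)\<^esub> x \<in> I" if "x \<in> I" for x
    using minus_type_ring[of x] that * by (auto simp: a_inv_def)
  then have "subgroup I (add_monoid (type_ring S))"
    using * by (intro subgroup.intro) (simp_all add: subset_iff)
  then show "ideal I (type_ring S)"
    using * by (intro idealI ring_axioms) (simp_all, metis mult.commute)
qed

lemma Spec_type_ring_iff:
  "P \<in> Spec (type_ring S) \<longleftrightarrow> P \<subseteq> S \<and> 0 \<in> P \<and> (\<forall>x\<in>P. \<forall>y\<in>P. x + y \<in> P) \<and>
     (\<forall>s\<in>S. \<forall>x\<in>P. s * x \<in> P) \<and> 1 \<notin> P \<and> (\<forall>x\<in>S. \<forall>y\<in>S. x * y \<in> P \<longrightarrow> x \<in> P \<or> y \<in> P)"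
proof
  assume "P \<in> Spec (type_ring S)"
  then interpret primeideal P "type_ring S" by (simp add: Spec_def)
  have "1 \<notin> P" using I_notcarr one_imp_carrier by auto
  then show "P \<subseteq> S \<and> 0 \<in> P \<and> (\<forall>x\<in>P. \<forall>y\<in>P. x + y \<in> P) \<and>
     (\<forall>s\<in>S. \<forall>x\<in>P. s * x \<in> P) \<and> 1 \<notin> P \<and> (\<forall>x\<in>S. \<forall>y\<in>S. x * y \<in> P \<longrightarrow> x \<in> P \<or> y \<in> P)"
    using is_ideal I_prime by (auto simp: ideal_type_ring_iff)
next
  assume "P \<subseteq> S \<and> 0 \<in> P \<and> (\<forall>x\<in>P. \<forall>y\<in>P. x + y \<in> P) \<and>
     (\<forall>s\<in>S. \<forall>x\<in>P. s * x \<in> P) \<and> 1 \<notin> P \<and> (\<forall>x\<in>S. \<forall>y\<in>S. x * y \<in> P \<longrightarrow> x \<in> P \<or> y \<in> P)"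
  then show "P \<in> Spec (type_ring S)"
    unfolding Spec_def mem_Collect_eq
    by (intro primeidealI cring_type_ring) (auto simp: ideal_type_ring_iff)
qed

lemma Spec_type_ringD:
  assumes "P \<in> Spec (type_ring S)"
  shows "P \<subseteq> S" "0 \<in> P" "1 \<notin> P" "x \<in> P \<Longrightarrow> y \<in> P \<Longrightarrow> x + y \<in> P" "x \<in> P \<Longrightarrow> y \<in> P \<Longrightarrow> x - y \<in> P"
    "s \<in> S \<Longrightarrow> x \<in> P \<Longrightarrow> s * x \<in> P" "s \<in> S \<Longrightarrow> x \<in> P \<Longrightarrow> x * s \<in> P"
    "x \<in> S \<Longrightarrow> y \<in> S \<Longrightarrow> x * y \<in> P \<longleftrightarrow> x \<in> P \<or> y \<in> P"
    "x \<in> S \<Longrightarrow> x ^ n \<in> P \<Longrightarrow> x \<in> P"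
proof -
  note * = assms[unfolded Spec_type_ring_iff]
  show "P \<subseteq> S" "0 \<in> P" "1 \<notin> P" "x \<in> P \<Longrightarrow> y \<in> P \<Longrightarrow> x + y \<in> P"
    "s \<in> S \<Longrightarrow> x \<in> P \<Longrightarrow> s * x \<in> P"
    using * by auto
  show "s \<in> S \<Longrightarrow> x \<in> P \<Longrightarrow> x * s \<in> P" using * by (metis mult.commute)
  show iff: "x \<in> S \<Longrightarrow> y \<in> S \<Longrightarrow> x * y \<in> P \<longleftrightarrow> x \<in> P \<or> y \<in> P" for x y
    using * by (metis mult.commute)
  show "x - y \<in> P" if "x \<in> P" "y \<in> P"
  proof -
    have "- 1 \<in> S" by (simp add: uminus_mem)
    then have "(- 1) * y \<in> P" using * that by blast
    then have "x + (- 1) * y \<in> P" using * that by blast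
    then show ?thesis by simp
  qed
  show "x \<in> S \<Longrightarrow> x ^ n \<in> P \<Longrightarrow> x \<in> P"
  proof (induction n)
    case (Suc n)
    then show ?case using iff[of x "x ^ n"] power_mem by auto
  qed (use * in auto)
qed

end

lemma type_subring_UNIV: "type_subring UNIV"
  by unfold_locales auto

lemma kernel_in_Spec:
  fixes h :: "'a::comm_ring_1 \<Rightarrow> 'b::idom"
  assumes "type_ring_hom h"
  shows "{p. h p = 0} \<in> Spec (type_ring UNIV)"
proof -
  interpret type_ring_hom h by fact
  show ?thesis
    unfolding type_subring.Spec_type_ring_iff[OF type_subring_UNIV] by (auto simp: hom_simps)
qed


section \<open>Arcs and their orders\<close>

lemma Spec_arcD:
  assumes "P \<in> Spec arc_ring"
  shows "0 \<in> P" "1 \<notin> P" "x \<in> P \<Longrightarrow> y \<in> P \<Longrightarrow> x + y \<in> P" "x \<in> P \<Longrightarrow> y \<in> P \<Longrightarrow> x - y \<in> P"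
    "x * y \<in> P \<longleftrightarrow> x \<in> P \<or> y \<in> P" "x ^ n \<in> P \<Longrightarrow> x \<in> P"
  by (fact type_subring.Spec_type_ringD(2-5)[OF type_subring_UNIV assms[unfolded arc_ring_eq]]
      type_subring.Spec_type_ringD(8-9)[OF type_subring_UNIV assms[unfolded arc_ring_eq] UNIV_I, simplified])+

lemma Spec_arc_sum:
  assumes P: "P \<in> Spec arc_ring" and "\<And>k. k \<in> A \<Longrightarrow> f k \<in> P"
  shows "sum f A \<in> P"
  using assms(2)
proof (induction A rule: infinite_finite_induct)
  case (insert x A)
  then have "f x \<in> P" "sum f A \<in> P" by simp_all
  then have "f x + sum f A \<in> P" by (rule Spec_arcD(3)[OF P])
  then show ?case using insert.hyps by simp
qed (simp_all add: Spec_arcD(1)[OF P])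

lemma arc_map_eq_zero_iff:
  assumes "P \<in> Spec arc_ring"
  shows "arc_map P f n = \<zero>\<^bsub>residue_field arc_ring P\<^esub> \<longleftrightarrow> fps_nth (universal_arc f) n \<in> P"
  unfolding arc_map_def by (rule residue_eq_zero_iff[OF assms]) (simp add: arc_ring_eq)

lemma arc_ord_ge_iff:
  assumes "P \<in> Spec arc_ring"
  shows "enat m \<le> arc_ord P f \<longleftrightarrow> (\<forall>n<m. fps_nth (universal_arc f) n \<in> P)"
  unfolding arc_ord_def series_ord_def le_INF_iff using arc_map_eq_zero_iff[OF assms]
  by (auto simp: not_le[symmetric])

lemma arc_ord_eq_iff:
  assumes "P \<in> Spec arc_ring"
  shows "arc_ord P f = enat m \<longleftrightarrow>
    (\<forall>n<m. fps_nth (universal_arc f) n \<in> P) \<and> fps_nth (universal_arc f) m \<notin> P"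
proof -
  have "arc_ord P f = enat m \<longleftrightarrow> enat m \<le> arc_ord P f \<and> \<not> enat (Suc m) \<le> arc_ord P f"
    by (cases "arc_ord P f") auto
  then show ?thesis
    unfolding arc_ord_ge_iff[OF assms] by (auto simp: less_Suc_eq)
qed

lemma arc_ord_eq_infinity_iff:
  assumes "P \<in> Spec arc_ring"
  shows "arc_ord P f = \<infinity> \<longleftrightarrow> (\<forall>n. fps_nth (universal_arc f) n \<in> P)"
proof -
  have "arc_ord P f = \<infinity> \<longleftrightarrow> (\<forall>m. enat m \<le> arc_ord P f)"
    by (cases "arc_ord P f") (auto, meson Suc_n_not_le_n)
  then show ?thesis unfolding arc_ord_ge_iff[OF assms] by blast
qed

text \<open>The lowest coefficients of the two factors that survive modulo \<open>P\<close> multiply to the only surviving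
  term of a coefficient of the product.  So the functions that vanish along an arc form a prime ideal.\<close>

lemma series_prime:
  assumes P: "P \<in> Spec arc_ring" and FG: "\<And>n. fps_nth (F * G) n \<in> P" and F: "fps_nth F i \<notin> P"
  shows "fps_nth G j \<in> P"
proof (rule ccontr)
  assume "fps_nth G j \<notin> P"
  define i0 where "i0 = (LEAST i. fps_nth F i \<notin> P)"
  define j0 where "j0 = (LEAST j. fps_nth G j \<notin> P)"
  have i0: "fps_nth F i0 \<notin> P" "\<And>k. k < i0 \<Longrightarrow> fps_nth F k \<in> P"
    using LeastI[of "\<lambda>i. fps_nth F i \<notin> P" i] F not_less_Least[of _ "\<lambda>i. fps_nth F i \<notin> P"]
    unfolding i0_def by blast+
  have j0: "fps_nth G j0 \<notin> P" "\<And>k. k < j0 \<Longrightarrow> fps_nth G k \<in> P"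
    using LeastI[of "\<lambda>j. fps_nth G j \<notin> P" j] \<open>fps_nth G j \<notin> P\<close>
      not_less_Least[of _ "\<lambda>j. fps_nth G j \<notin> P"]
    unfolding j0_def by blast+
  have rest: "(\<Sum>k\<in>{0..i0 + j0} - {i0}. fps_nth F k * fps_nth G (i0 + j0 - k)) \<in> P"
  proof -
    have "fps_nth F k * fps_nth G (i0 + j0 - k) \<in> P" if "k \<in> {0..i0 + j0} - {i0}" for k
    proof -
      have "k < i0 \<or> i0 + j0 - k < j0" using that by auto
      then show ?thesis using i0(2) j0(2) Spec_arcD(5)[OF P] by blast
    qed
    then show ?thesis by (rule Spec_arc_sum[OF P])
  qed
  have "fps_nth (F * G) (i0 + j0) = fps_nth F i0 * fps_nth G j0 +
      (\<Sum>k\<in>{0..i0 + j0} - {i0}. fps_nth F k * fps_nth G (i0 + j0 - k))"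
    unfolding fps_mult_nth by (subst sum.remove[of _ i0]) auto
  then have "fps_nth F i0 * fps_nth G j0 \<in> P"
    using Spec_arcD(4)[OF P FG[of "i0 + j0"] rest] by simp
  then show False using i0 j0 Spec_arcD(5)[OF P] by blast
qed

text \<open>The functions that vanish along an arc form a prime ideal \<open>I\<close>, and the zero set of \<open>I\<close> is the
  smallest closed subset containing the arc.  It is the whole plane iff \<open>I = 0\<close>, since the zero ideal
  is a point of the plane.\<close>

lemma fat_arc_iff:
  assumes P: "P \<in> Spec arc_ring"
  shows "fat_arc P \<longleftrightarrow> (\<forall>f. f \<noteq> 0 \<longrightarrow> arc_ord P f \<noteq> \<infinity>)"
proof
  assume fat: "fat_arc P"
  show "\<forall>f. f \<noteq> 0 \<longrightarrow> arc_ord P f \<noteq> \<infinity>"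
  proof (intro allI impI notI)
    fix f :: plane_poly
    assume f: "f \<noteq> 0" "arc_ord P f = \<infinity>"
    define I where "I = {f. \<forall>n. fps_nth (universal_arc f) n \<in> P}"
    interpret u: type_ring_hom universal_arc by (rule type_ring_hom_universal_arc)
    have "I \<in> Spec plane_ring"
      unfolding plane_ring_eq type_subring.Spec_type_ring_iff[OF type_subring_UNIV]
    proof (intro conjI ballI impI)
      show "0 \<in> I" by (simp add: I_def u.hom_zero Spec_arcD(1)[OF P])
      show "1 \<notin> I" using Spec_arcD(2)[OF P] by (auto simp: I_def u.hom_one intro!: exI[of _ 0])
      show "f + g \<in> I" if "f \<in> I" "g \<in> I" for f g
        using that by (auto simp: I_def u.hom_add intro: Spec_arcD(3)[OF P])
      show "g * f \<in> I" if "f \<in> I" for f g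
        using that by (auto simp: I_def u.hom_mult fps_mult_nth Spec_arcD(5)[OF P] intro!: Spec_arc_sum[OF P])
      show "f \<in> I \<or> g \<in> I" if "f * g \<in> I" for f g
        using that series_prime[OF P, of "universal_arc f" "universal_arc g"]
        by (auto simp: I_def u.hom_mult)
    qed simp
    then have I: "I \<in> zeros plane_ring I" "f \<in> I"
      using f P by (auto simp: zeros_def I_def arc_ord_eq_infinity_iff)
    have "{0} \<in> Spec plane_ring"
      using kernel_in_Spec[OF type_ring_hom_id[where 'a=plane_poly]] by (simp add: plane_ring_eq)
    moreover have "{0} \<notin> zeros plane_ring I" using f(1) I(2) by (auto simp: zeros_def)
    ultimately have "closedin (zariski plane_ring) (zeros plane_ring I)" "zeros plane_ring I \<noteq> Spec plane_ring"
      by (auto simp: closedin_zariski plane_ring_eq)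
    moreover have "\<forall>f \<in> \<Inter>(zeros plane_ring I). \<forall>n. arc_map P f n = \<zero>\<^bsub>residue_field arc_ring P\<^esub>"
      using I(1) by (auto simp: arc_map_eq_zero_iff[OF P] I_def)
    ultimately show False using fat unfolding fat_arc_def by blast
  qed
next
  assume fin: "\<forall>f. f \<noteq> 0 \<longrightarrow> arc_ord P f \<noteq> \<infinity>"
  have False if Z: "closedin (zariski plane_ring) Z" "Z \<noteq> Spec plane_ring"
    "\<forall>f \<in> \<Inter>Z. \<forall>n. arc_map P f n = \<zero>\<^bsub>residue_field arc_ring P\<^esub>" for Z
  proof -
    obtain T where T: "Z = zeros plane_ring T" using Z(1) by (auto simp: closedin_zariski)
    have "0 \<in> Q" if "Q \<in> Spec plane_ring" for Q
      using that type_subring.Spec_type_ringD(2)[OF type_subring_UNIV] by (auto simp: plane_ring_eq)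
    then obtain f where "f \<in> T" "f \<noteq> 0" using Z(2) T by (auto simp: zeros_def)
    moreover from this have "f \<in> \<Inter>Z" using T by (auto simp: zeros_def)
    ultimately have "arc_ord P f = \<infinity>"
      using Z(3) by (auto simp: arc_ord_eq_infinity_iff[OF P] arc_map_eq_zero_iff[OF P])
    then show False using fin \<open>f \<noteq> 0\<close> by blast
  qed
  then show "fat_arc P" unfolding fat_arc_def using P by blast
qed


subsection \<open>Arcs with coefficients in a domain\<close>

text \<open>Points of the arc space are given below as kernels of homomorphisms to domains; the order of a
  function along such a point is the order of an honest power series.\<close>

lemma kernel_in_Spec_arc:
  fixes h :: "arc_poly \<Rightarrow> 'b::idom"
  shows "type_ring_hom h \<Longrightarrow> {p. h p = 0} \<in> Spec arc_ring"
  unfolding arc_ring_eq by (rule kernel_in_Spec)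

lemma arc_ord_kernel:
  fixes h :: "arc_poly \<Rightarrow> 'b::idom"
  assumes h: "type_ring_hom h" and "arc_of h f \<noteq> 0"
  shows "arc_ord {p. h p = 0} f = enat (subdegree (arc_of h f))"
  using assms(2)
  by (auto simp: arc_ord_eq_iff[OF kernel_in_Spec_arc[OF h]] hom_universal_arc[OF h])

lemma fat_arc_kernel:
  fixes h :: "arc_poly \<Rightarrow> 'b::idom"
  assumes h: "type_ring_hom h" and "\<And>f. f \<noteq> 0 \<Longrightarrow> arc_of h f \<noteq> 0"
  shows "fat_arc {p. h p = 0}"
  using assms(2) by (auto simp: fat_arc_iff[OF kernel_in_Spec_arc[OF h]] arc_ord_kernel[OF h])


subsection \<open>Arcs through the origin with given contact with the axes\<close>

lemma Cont_iff:
  assumes "P \<in> Spec arc_ring"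
  shows "P \<in> Cont 2 xvar \<inter> Cont 3 yvar \<longleftrightarrow>
    arc_var (Ca 0) \<in> P \<and> arc_var (Ca 1) \<in> P \<and> arc_var (Ca 2) \<notin> P \<and>
    arc_var (Cb 0) \<in> P \<and> arc_var (Cb 1) \<in> P \<and> arc_var (Cb 2) \<in> P \<and> arc_var (Cb 3) \<notin> P"
  using assms
  by (auto simp: Cont_def arc_ord_eq_iff universal_arc_gens numeral_2_eq_2 numeral_3_eq_3 less_Suc_eq)


section \<open>The contact locus as a spectrum\<close>

definition laurent_const :: "complex \<Rightarrow> laurent_poly" where
  "laurent_const c = single 0 c"

definition contact_carrier :: "laurent_poly set" where
  "contact_carrier = carrier contact_ring"

lemma contact_carrier_iff:
  "p \<in> contact_carrier \<longleftrightarrow> (\<forall>u \<in> keys p. keys u \<subseteq> contact_coords \<and>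
     (\<forall>c. c \<noteq> Ca 2 \<and> c \<noteq> Cb 3 \<longrightarrow> lookup u c \<ge> 0))"
  by (simp add: contact_carrier_def contact_ring_def)

lemma contact_ring_eq: "contact_ring = type_ring contact_carrier"
  by (simp add: contact_carrier_def contact_ring_def type_ring_def)

interpretation contact: type_subring contact_carrier
proof
  show "p + q \<in> contact_carrier" if "p \<in> contact_carrier" "q \<in> contact_carrier" for p q
    using that Poly_Mapping.keys_add[of p q] unfolding contact_carrier_iff by blast
  show "p * q \<in> contact_carrier" if "p \<in> contact_carrier" "q \<in> contact_carrier" for p q
    unfolding contact_carrier_iff
  proof
    fix w assume "w \<in> keys (p * q)"
    then obtain u v where uv: "w = u + v" "u \<in> keys p" "v \<in> keys q"
      using keys_mult[of p q] by blast
    have "keys w \<subseteq> keys u \<union> keys v"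
      unfolding uv by (rule Poly_Mapping.keys_add)
    moreover have "keys u \<subseteq> contact_coords" "keys v \<subseteq> contact_coords"
      "\<And>c. c \<noteq> Ca 2 \<Longrightarrow> c \<noteq> Cb 3 \<Longrightarrow> lookup u c \<ge> 0"
      "\<And>c. c \<noteq> Ca 2 \<Longrightarrow> c \<noteq> Cb 3 \<Longrightarrow> lookup v c \<ge> 0"
      using that uv(2,3) unfolding contact_carrier_iff by simp_all
    ultimately show "keys w \<subseteq> contact_coords \<and>
        (\<forall>c. c \<noteq> Ca 2 \<and> c \<noteq> Cb 3 \<longrightarrow> lookup w c \<ge> 0)"
      unfolding uv(1) by (simp add: lookup_add) blast
  qed
  show "- p \<in> contact_carrier" if "p \<in> contact_carrier" for p
    using that by (simp add: contact_carrier_iff)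
qed (simp add: contact_carrier_iff)

lemma keys_map_int [simp]: "keys (Poly_Mapping.map int u) = keys u"
  by (auto simp: in_keys_iff map.rep_eq when_def split: if_splits)

lemma lookup_map_int [simp]: "lookup (Poly_Mapping.map int u) x = int (lookup u x)"
  by (auto simp: map.rep_eq when_def)

lemma map_int_add: "Poly_Mapping.map int (u + v) = Poly_Mapping.map int u + Poly_Mapping.map int v"
  by (rule poly_mapping_eqI) (simp add: lookup_add)

lemma map_int_inject: "Poly_Mapping.map int u = Poly_Mapping.map int v \<longleftrightarrow> u = v"
  by (metis lookup_map_int of_nat_eq_iff poly_mapping_eqI)

lemma type_ring_hom_laurent_const: "type_ring_hom laurent_const"
  unfolding laurent_const_def by unfold_locales (auto simp: single_add mult_single)

lemma contact_restrict_eq_pm_eval: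
  "contact_restrict = pm_eval laurent_const
     (\<lambda>u. if keys u \<subseteq> contact_coords then single (Poly_Mapping.map int u) 1 else 0)"
  unfolding contact_restrict_def[abs_def] pm_eval_def[abs_def] laurent_const_def
  by (intro ext sum.cong) (auto simp: mult_single)

interpretation restrict: type_ring_hom contact_restrict
  unfolding contact_restrict_eq_pm_eval
proof (rule type_ring_hom_pm_eval[OF type_ring_hom_laurent_const])
  have "Poly_Mapping.map int (0 :: coord \<Rightarrow>\<^sub>0 nat) = 0"
    by (rule poly_mapping_eqI) simp
  then show "(if keys (0 :: coord \<Rightarrow>\<^sub>0 nat) \<subseteq> contact_coords
      then single (Poly_Mapping.map int 0) 1 else 0) = (1 :: laurent_poly)"
    by simp
qed (auto simp: keys_add_nat map_int_add mult_single)

lemma contact_restrict_gens: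
  "contact_restrict (arc_const c) = laurent_const c"
  "contact_restrict (arc_var x) = (if x \<in> contact_coords then laurent_var x else 0)"
proof -
  have "Poly_Mapping.map int (0 :: coord \<Rightarrow>\<^sub>0 nat) = 0"
    by (rule poly_mapping_eqI) simp
  then show "contact_restrict (arc_const c) = laurent_const c"
    by (simp add: contact_restrict_eq_pm_eval arc_const_def pm_eval_single[OF type_ring_hom_laurent_const]
        laurent_const_def mult_single)
  show "contact_restrict (arc_var x) = (if x \<in> contact_coords then laurent_var x else 0)"
    by (simp add: contact_restrict_eq_pm_eval arc_var_def pm_eval_single[OF type_ring_hom_laurent_const]
        laurent_const_def mult_single laurent_var_def)
qed

lemma laurent_const_in [simp]: "laurent_const c \<in> contact_carrier"
  and laurent_var_in [simp]: "x \<in> contact_coords \<Longrightarrow> laurent_var x \<in> contact_carrier"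
  by (auto simp: contact_carrier_iff laurent_const_def laurent_var_def lookup_single when_def)

lemma contact_restrict_in [simp]: "contact_restrict p \<in> contact_carrier"
  by (induction p rule: arc_poly_induct)
     (auto simp: contact_restrict_gens restrict.hom_simps intro: contact.mem_intros)

lemma lookup_contact_restrict:
  assumes "keys u \<subseteq> contact_coords"
  shows "lookup (contact_restrict p) (Poly_Mapping.map int u) = lookup p u"
proof -
  have "lookup (contact_restrict p) (Poly_Mapping.map int u) =
      (\<Sum>v \<in> keys p. if v = u then lookup p u else 0)"
    unfolding contact_restrict_def lookup_sum
    by (rule sum.cong) (use assms in \<open>auto simp: lookup_single when_def map_int_inject\<close>)
  also have "\<dots> = lookup p u"
    by (simp add: sum.delta in_keys_iff)
  finally show ?thesis .
qed

text \<open>A polynomial killed by the restriction involves one of the killed coordinates in each of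
  its monomials.\<close>

lemma contact_restrict_kernel:
  assumes P: "P \<in> Spec arc_ring" and vars: "\<And>x. x \<notin> contact_coords \<Longrightarrow> arc_var x \<in> P"
    and r: "contact_restrict r = 0"
  shows "r \<in> P"
proof -
  have "single u (lookup r u) \<in> P" if u: "u \<in> keys r" for u
  proof -
    have "\<not> keys u \<subseteq> contact_coords"
      using lookup_contact_restrict[of u r] r u by (auto simp: in_keys_iff)
    then obtain x where x: "x \<in> keys u" "x \<notin> contact_coords" by blast
    define v where "v = u - single x 1"
    have "u = v + single x 1"
      unfolding v_def by (rule poly_mapping_eqI)
        (use x in \<open>auto simp: lookup_add lookup_minus lookup_single when_def in_keys_iff\<close>)
    then have "single u (lookup r u) =
        single v (lookup r u) * arc_var x"
      by (simp add: arc_var_def mult_single)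
    then show ?thesis using vars[OF x(2)] Spec_arcD(5)[OF P] by simp
  qed
  then have "(\<Sum>u \<in> keys r. single u (lookup r u)) \<in> P"
    by (rule Spec_arc_sum[OF P])
  then show ?thesis by (simp flip: pm_sum_single)
qed

text \<open>The contact ring arises from the arc ring by killing five coordinates and inverting this
  element.  The exponent of its \<open>n\<close>-th power, for an integer \<open>n\<close>, is \<open>unit_exp n\<close>.\<close>

definition arc_unit :: arc_poly where
  "arc_unit = arc_var (Ca 2) * arc_var (Cb 3)"

definition contact_unit :: laurent_poly where
  "contact_unit = laurent_var (Ca 2) * laurent_var (Cb 3)"

definition unit_exp :: "int \<Rightarrow> coord \<Rightarrow>\<^sub>0 int" where
  "unit_exp n = single (Ca 2) n + single (Cb 3) n"

lemma contact_coords_simps [simp]: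
  "Ca i \<in> contact_coords \<longleftrightarrow> 2 \<le> i" "Cb i \<in> contact_coords \<longleftrightarrow> 3 \<le> i"
  by (auto simp: contact_coords_def)

lemma contact_restrict_arc_unit [simp]: "contact_restrict arc_unit = contact_unit"
  by (simp add: arc_unit_def contact_unit_def restrict.hom_simps contact_restrict_gens)

lemma contact_unit_power: "contact_unit ^ n = single (unit_exp (int n)) 1"
proof (induction n)
  case 0
  then show ?case by (simp add: unit_exp_def)
next
  case (Suc n)
  have "unit_exp (int (Suc n)) = unit_exp 1 + unit_exp (int n)"
    by (simp add: unit_exp_def single_add ac_simps)
  then show ?case using Suc
    by (simp add: contact_unit_def laurent_var_def mult_single unit_exp_def)
qed

lemma contact_unit_in [simp]: "contact_unit \<in> contact_carrier"
  by (metis contact_restrict_arc_unit contact_restrict_in)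

lemma contact_unit_inverse:
  obtains w where "w \<in> contact_carrier" "w * contact_unit ^ n = 1"
proof
  show "single (unit_exp (- int n)) 1 \<in> contact_carrier"
    using Poly_Mapping.keys_add[of "single (Ca 2) (- int n)" "single (Cb 3) (- int n)"]
    by (auto simp: contact_carrier_iff unit_exp_def lookup_add lookup_single when_def split: if_splits)
  have "unit_exp (- int n) + unit_exp (int n) = 0"
    by (rule poly_mapping_eqI) (simp add: unit_exp_def lookup_add lookup_single when_def)
  then show "single (unit_exp (- int n)) 1 * contact_unit ^ n = 1"
    by (simp add: contact_unit_power mult_single)
qed

lemma contact_unit_notin:
  assumes "Q \<in> Spec contact_ring"
  shows "contact_unit ^ n \<notin> Q"
proof
  note Q = assms[unfolded contact_ring_eq]
  assume "contact_unit ^ n \<in> Q"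
  moreover obtain w where "w \<in> contact_carrier" "w * contact_unit ^ n = 1"
    by (rule contact_unit_inverse)
  ultimately show False using contact.Spec_type_ringD(3,6)[OF Q] by metis
qed

text \<open>A large power of the unit makes the finitely many negative exponents nonnegative.\<close>

lemma contact_clear_denominators:
  assumes "p \<in> contact_carrier"
  obtains n r where "contact_restrict r = contact_unit ^ n * p"
proof -
  have mono: "\<exists>n. \<forall>m\<ge>n. \<exists>r. contact_restrict r = contact_unit ^ m * single u a"
    if u: "keys u \<subseteq> contact_coords" "\<forall>c. c \<noteq> Ca 2 \<and> c \<noteq> Cb 3 \<longrightarrow> lookup u c \<ge> 0"
    for u a
  proof (rule exI, intro allI impI)
    fix m assume m: "nat (\<bar>lookup u (Ca 2)\<bar> + \<bar>lookup u (Cb 3)\<bar>) \<le> m"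
    define v where "v = unit_exp (int m) + u"
    have v0: "lookup v c \<ge> 0" for c
      using u(2) m by (cases "c = Ca 2 \<or> c = Cb 3") (auto simp: v_def unit_exp_def lookup_add lookup_single when_def)
    have vk: "keys v \<subseteq> contact_coords"
    proof
      fix c assume "c \<in> keys v"
      then have "c = Ca 2 \<or> c = Cb 3 \<or> c \<in> keys u"
        by (auto simp: v_def unit_exp_def in_keys_iff lookup_add lookup_single when_def split: if_splits)
      then show "c \<in> contact_coords" using u(1) by auto
    qed
    have nv: "Poly_Mapping.map int (Poly_Mapping.map nat v) = v"
    proof (rule poly_mapping_eqI)
      fix k show "lookup (Poly_Mapping.map int (Poly_Mapping.map nat v)) k = lookup v k"
        using v0[of k] by (simp add: map.rep_eq when_def)
    qed
    then have "keys (Poly_Mapping.map nat v) = keys v"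
      using keys_map_int by metis
    then have "contact_restrict (single (Poly_Mapping.map nat v) a) = single v a"
      using vk nv by (simp add: contact_restrict_eq_pm_eval pm_eval_single[OF type_ring_hom_laurent_const]
          laurent_const_def mult_single)
    then show "\<exists>r. contact_restrict r = contact_unit ^ m * single u a"
      by (intro exI[of _ "single (Poly_Mapping.map nat v) a"])
         (simp add: contact_unit_power mult_single v_def)
  qed
  have sum: "\<exists>n. \<forall>m\<ge>n. \<exists>r. contact_restrict r = contact_unit ^ m * sum f A"
    if "finite A" "\<And>u. u \<in> A \<Longrightarrow> \<exists>n. \<forall>m\<ge>n. \<exists>r. contact_restrict r = contact_unit ^ m * f u"
    for f and A :: "(coord \<Rightarrow>\<^sub>0 int) set"
    using that
  proof (induction A)
    case empty
    have "contact_restrict 0 = contact_unit ^ m * 0" for m by (simp add: restrict.hom_zero)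
    then show ?case by (metis sum.empty)
  next
    case (insert u A)
    obtain n1 where n1: "\<And>m. m \<ge> n1 \<Longrightarrow> \<exists>r. contact_restrict r = contact_unit ^ m * f u"
      using insert.prems by blast
    obtain n2 where n2: "\<And>m. m \<ge> n2 \<Longrightarrow> \<exists>r. contact_restrict r = contact_unit ^ m * sum f A"
      using insert.IH insert.prems by blast
    have "\<exists>r. contact_restrict r = contact_unit ^ m * sum f (insert u A)" if "m \<ge> max n1 n2" for m
    proof -
      obtain r s where "contact_restrict r = contact_unit ^ m * f u"
        "contact_restrict s = contact_unit ^ m * sum f A"
        using n1[of m] n2[of m] \<open>m \<ge> max n1 n2\<close> by auto
      then have "contact_restrict (r + s) = contact_unit ^ m * sum f (insert u A)"
        using insert.hyps by (simp add: restrict.hom_add distrib_left)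
      then show ?thesis by blast
    qed
    then show ?case by blast
  qed
  have "\<exists>n. \<forall>m\<ge>n. \<exists>r. contact_restrict r = contact_unit ^ m *
      (\<Sum>u \<in> keys p. single u (lookup p u))"
    by (rule sum) (use assms mono in \<open>auto simp: contact_carrier_iff\<close>)
  then show thesis using that by (fold pm_sum_single) blast
qed

lemma contact_point_iff: "p \<in> contact_point Q \<longleftrightarrow> contact_restrict p \<in> Q"
  by (simp add: contact_point_def arc_ring_eq)

lemma Spec_contact_mult_unit_iff:
  assumes "Q \<in> Spec contact_ring" "p \<in> contact_carrier"
  shows "contact_unit ^ n * p \<in> Q \<longleftrightarrow> p \<in> Q"
  using contact.Spec_type_ringD(8)[OF assms(1)[unfolded contact_ring_eq], of "contact_unit ^ n" p]
    contact_unit_notin[OF assms(1)] assms(2) contact.power_mem by auto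

lemma contact_point_in_Spec:
  assumes "Q \<in> Spec contact_ring"
  shows "contact_point Q \<in> Spec arc_ring"
proof -
  note Q = contact.Spec_type_ringD[OF assms[unfolded contact_ring_eq]]
  show ?thesis
    unfolding arc_ring_eq type_subring.Spec_type_ring_iff[OF type_subring_UNIV]
    using Q(2,3) Q(4,6) Q(8)
    by (auto simp: contact_point_iff restrict.hom_simps)
qed

text \<open>A point of the contact locus contains the killed coordinates but not the unit, so it extends to the
  localization: the extension consists of the fractions whose numerators lie in the point.\<close>

lemma contact_point_eq_Cont: "contact_point ` Spec contact_ring = Cont 2 xvar \<inter> Cont 3 yvar"
proof (intro equalityI subsetI)
  fix P assume "P \<in> contact_point ` Spec contact_ring"
  then obtain Q where Q: "Q \<in> Spec contact_ring" "P = contact_point Q" by blast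
  then have P: "P \<in> Spec arc_ring" by (simp add: contact_point_in_Spec)
  have "contact_unit \<notin> Q" using contact_unit_notin[OF Q(1), of 1] by simp
  then have "arc_unit \<notin> P" by (simp add: Q contact_point_iff)
  moreover have "arc_var x \<in> P" if "x \<notin> contact_coords" for x
    using that contact.Spec_type_ringD(2)[OF Q(1)[unfolded contact_ring_eq]]
    by (simp add: Q contact_point_iff contact_restrict_gens)
  ultimately show "P \<in> Cont 2 xvar \<inter> Cont 3 yvar"
    using Spec_arcD(5)[OF P] unfolding Cont_iff[OF P] arc_unit_def by simp
next
  fix P assume "P \<in> Cont 2 xvar \<inter> Cont 3 yvar"
  moreover from this have P: "P \<in> Spec arc_ring" by (simp add: Cont_def)
  ultimately have *: "arc_var (Ca 0) \<in> P" "arc_var (Ca 1) \<in> P" "arc_var (Cb 0) \<in> P" "arc_var (Cb 1) \<in> P"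
    "arc_var (Cb 2) \<in> P" "arc_unit \<notin> P"
    unfolding Cont_iff[OF P] arc_unit_def Spec_arcD(5)[OF P] by auto
  have vars: "arc_var x \<in> P" if "x \<notin> contact_coords" for x
  proof -
    have "x \<in> {Ca 0, Ca 1, Cb 0, Cb 1, Cb 2}"
      using that by (cases x) (auto simp: numeral_2_eq_2 numeral_3_eq_3 not_le less_Suc_eq)
    then show ?thesis using * by auto
  qed
  have unit: "arc_unit ^ n \<notin> P" for n
    using *(6) Spec_arcD(6)[OF P] by blast
  define Q where "Q = {p \<in> contact_carrier. \<exists>n r. contact_restrict r = contact_unit ^ n * p \<and> r \<in> P}"
  have Q_iff: "r \<in> P" if "p \<in> Q" "contact_restrict r = contact_unit ^ n * p" for p r n
  proof -
    obtain m s where s: "contact_restrict s = contact_unit ^ m * p" "s \<in> P"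
      using \<open>p \<in> Q\<close> by (auto simp: Q_def)
    have "contact_restrict (arc_unit ^ m * r - arc_unit ^ n * s) = 0"
      using that(2) s(1) by (simp add: restrict.hom_simps)
    then have "arc_unit ^ m * r - arc_unit ^ n * s \<in> P"
      using contact_restrict_kernel[OF P] vars by blast
    then have "(arc_unit ^ m * r - arc_unit ^ n * s) + arc_unit ^ n * s \<in> P"
      using s(2) Spec_arcD(3,5)[OF P] by blast
    then show ?thesis using unit Spec_arcD(5)[OF P] by simp
  qed
  have "Q \<in> Spec contact_ring"
    unfolding contact_ring_eq contact.Spec_type_ring_iff
  proof (intro conjI ballI impI)
    show "Q \<subseteq> contact_carrier" by (auto simp: Q_def)
    show "0 \<in> Q"
      using Spec_arcD(1)[OF P] by (auto simp: Q_def restrict.hom_zero intro!: exI[of _ 0])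
    show "1 \<notin> Q"
      using Q_iff[of 1 1 0] Spec_arcD(2)[OF P] by (auto simp: restrict.hom_one)
    show "p + q \<in> Q" if pq: "p \<in> Q" "q \<in> Q" for p q
    proof -
      obtain m r where r: "contact_restrict r = contact_unit ^ m * p" "r \<in> P" "p \<in> contact_carrier"
        using pq(1) by (auto simp: Q_def)
      obtain n s where s: "contact_restrict s = contact_unit ^ n * q" "s \<in> P" "q \<in> contact_carrier"
        using pq(2) by (auto simp: Q_def)
      note rs = r s
      have "contact_restrict (arc_unit ^ n * r + arc_unit ^ m * s) = contact_unit ^ (m + n) * (p + q)"
        using rs by (simp add: restrict.hom_simps power_add algebra_simps)
      moreover have "arc_unit ^ n * r + arc_unit ^ m * s \<in> P"
        using rs Spec_arcD(3,5)[OF P] by blast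
      ultimately show ?thesis using rs contact.add_mem unfolding Q_def by blast
    qed
    show "q * p \<in> Q" if pq: "q \<in> contact_carrier" "p \<in> Q" for p q
    proof -
      obtain m r where r: "contact_restrict r = contact_unit ^ m * p" "r \<in> P" "p \<in> contact_carrier"
        using pq(2) by (auto simp: Q_def)
      obtain n s where s: "contact_restrict s = contact_unit ^ n * q"
        using pq(1) by (elim contact_clear_denominators)
      have "contact_restrict (s * r) = contact_unit ^ (n + m) * (q * p)"
        using r s by (simp add: restrict.hom_simps power_add algebra_simps)
      moreover have "s * r \<in> P" using r Spec_arcD(5)[OF P] by blast
      ultimately show ?thesis using r pq contact.mult_mem unfolding Q_def by blast
    qed
    show "p \<in> Q \<or> q \<in> Q" if pq: "p \<in> contact_carrier" "q \<in> contact_carrier" "p * q \<in> Q" for p q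
    proof -
      obtain m r where r: "contact_restrict r = contact_unit ^ m * p"
        using pq(1) by (elim contact_clear_denominators)
      obtain n s where s: "contact_restrict s = contact_unit ^ n * q"
        using pq(2) by (elim contact_clear_denominators)
      have "contact_restrict (r * s) = contact_unit ^ (m + n) * (p * q)"
        using r s by (simp add: restrict.hom_simps power_add algebra_simps)
      then have "r * s \<in> P" by (rule Q_iff[OF pq(3)])
      then have "r \<in> P \<or> s \<in> P" using Spec_arcD(5)[OF P] by blast
      then show ?thesis using r s pq unfolding Q_def by blast
    qed
  qed
  moreover have "P = contact_point Q"
  proof (intro equalityI subsetI)
    fix r assume "r \<in> P"
    then show "r \<in> contact_point Q"
      by (auto simp: contact_point_iff Q_def intro!: exI[of _ 0] exI[of _ r])
  next
    fix r assume "r \<in> contact_point Q"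
    then show "r \<in> P" using Q_iff[of "contact_restrict r" r 0] by (simp add: contact_point_iff)
  qed
  ultimately show "P \<in> contact_point ` Spec contact_ring" by blast
qed

lemma contact_point_mono_iff:
  assumes I: "I \<in> Spec contact_ring" and Q: "Q \<in> Spec contact_ring"
  shows "contact_point I \<subseteq> contact_point Q \<longleftrightarrow> I \<subseteq> Q"
proof
  assume sub: "contact_point I \<subseteq> contact_point Q"
  show "I \<subseteq> Q"
  proof
    fix q assume q: "q \<in> I"
    then have qc: "q \<in> contact_carrier" using SpecD(1)[OF I] by (auto simp: contact_carrier_def)
    then obtain n r where r: "contact_restrict r = contact_unit ^ n * q"
      by (rule contact_clear_denominators)
    then have "r \<in> contact_point I"
      using Spec_contact_mult_unit_iff[OF I qc] q by (simp add: contact_point_iff)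
    then have "r \<in> contact_point Q" using sub by blast
    then show "q \<in> Q" using r Spec_contact_mult_unit_iff[OF Q qc] by (simp add: contact_point_iff)
  qed
qed (auto simp: contact_point_def)

lemma Spec_contact_subset: "Q \<in> Spec contact_ring \<Longrightarrow> Q \<subseteq> contact_carrier"
  using SpecD(1)[of Q contact_ring] by (simp add: contact_carrier_def)

lemma inj_on_contact_point: "inj_on contact_point (Spec contact_ring)"
  by (rule inj_onI) (metis contact_point_mono_iff equalityI order_refl)

text \<open>A closed set of the contact spectrum is cut out by elements \<open>t\<close>, hence also by their multiples by powers
  of the unit that come from the arc ring; the preimages of these multiples cut out its image.\<close>

lemma embedding_map_contact_point:
  "embedding_map (zariski contact_ring) (zariski arc_ring) contact_point"
  unfolding embedding_map_def
proof (rule bijective_closed_imp_homeomorphic_map)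
  let ?I = "contact_point ` topspace (zariski contact_ring)"
  show "continuous_map (zariski contact_ring) (subtopology (zariski arc_ring) ?I) contact_point"
    unfolding continuous_map_in_subtopology
  proof
    show "continuous_map (zariski contact_ring) (zariski arc_ring) contact_point"
      unfolding continuous_map_closedin
    proof (intro conjI allI impI ballI)
      fix C assume "closedin (zariski arc_ring) C"
      then obtain T where T: "C = zeros arc_ring T" by (auto simp: closedin_zariski)
      have "{Q \<in> topspace (zariski contact_ring). contact_point Q \<in> C} = zeros contact_ring (contact_restrict ` T)"
        using contact_point_in_Spec by (auto simp: T zeros_def contact_point_iff)
      then show "closedin (zariski contact_ring) {Q \<in> topspace (zariski contact_ring). contact_point Q \<in> C}"
        unfolding closedin_zariski
        by (auto simp: contact_ring_eq intro!: exI[of _ "contact_restrict ` T"])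
    qed (auto simp: contact_point_in_Spec)
  qed auto
  show "closed_map (zariski contact_ring) (subtopology (zariski arc_ring) ?I) contact_point"
    unfolding closed_map_def
  proof (intro allI impI)
    fix C assume "closedin (zariski contact_ring) C"
    then obtain T where T: "T \<subseteq> contact_carrier" "C = zeros contact_ring T"
      by (auto simp: closedin_zariski contact_carrier_def)
    define T' where "T' = {r. \<exists>t\<in>T. \<exists>n. contact_restrict r = contact_unit ^ n * t}"
    have "contact_point Q \<in> zeros arc_ring T' \<longleftrightarrow> Q \<in> C" if Q: "Q \<in> Spec contact_ring" for Q
    proof
      assume "contact_point Q \<in> zeros arc_ring T'"
      then have *: "contact_restrict r \<in> Q" if "r \<in> T'" for r
        using that by (auto simp: zeros_def contact_point_iff subset_iff)
      have "t \<in> Q" if t: "t \<in> T" for t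
      proof -
        obtain n r where r: "contact_restrict r = contact_unit ^ n * t"
          using t T(1) by (meson contact_clear_denominators subsetD)
        then show ?thesis
          using *[of r] t T Spec_contact_mult_unit_iff[OF Q, of t n] by (auto simp: T'_def)
      qed
      then show "Q \<in> C" using Q T by (auto simp: zeros_def)
    next
      assume "Q \<in> C"
      then show "contact_point Q \<in> zeros arc_ring T'"
        using T Spec_contact_mult_unit_iff[OF Q] contact_point_in_Spec[OF Q]
        by (auto simp: zeros_def T'_def contact_point_iff subset_iff)
    qed
    moreover have "C \<subseteq> Spec contact_ring" by (auto simp: T zeros_def)
    ultimately have "contact_point ` C = zeros arc_ring T' \<inter> ?I" by auto
    then show "closedin (subtopology (zariski arc_ring) ?I) (contact_point ` C)"
      unfolding closedin_subtopology closedin_zariski by (auto simp: arc_ring_eq)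
  qed
  show "contact_point ` topspace (zariski contact_ring) = topspace (subtopology (zariski arc_ring) ?I)"
    using contact_point_in_Spec by auto
  show "inj_on contact_point (topspace (zariski contact_ring))"
    by (simp add: inj_on_contact_point)
qed


section \<open>The generic point of \<open>D\<close>\<close>

text \<open>A linear order on the variables makes the exponents an ordered group, and therefore the ring of Laurent
  polynomials an integral domain.\<close>

instantiation coord :: linorder
begin

fun coord_code :: "coord \<Rightarrow> nat" where
  "coord_code (Ca i) = 2 * i"
| "coord_code (Cb i) = Suc (2 * i)"

definition less_eq_coord :: "coord \<Rightarrow> coord \<Rightarrow> bool" where
  "less_eq_coord x y \<longleftrightarrow> coord_code x \<le> coord_code y"

definition less_coord :: "coord \<Rightarrow> coord \<Rightarrow> bool" where
  "less_coord x y \<longleftrightarrow> coord_code x < coord_code y"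

instance
proof
  fix x y :: coord
  show "x \<le> y \<Longrightarrow> y \<le> x \<Longrightarrow> x = y"
    by (cases x; cases y) (auto simp: less_eq_coord_def, presburger+)
qed (auto simp: less_eq_coord_def less_coord_def)

end

definition par :: laurent_poly where
  "par = single (single (Cb 3) 1 - single (Ca 2) 1) 1"

text \<open>The coordinates of the generic arc of \<open>D\<close> in terms of \<open>par = b\<^sub>3 / a\<^sub>2\<close> and the free coordinates, with
  \<open>a\<^sub>4\<close> translated by \<open>c\<close>.  The translation does not change the generic point, but it changes the
  coefficient of \<open>t\<^sup>8\<close> in the equation of the cusp; this is how transcendence is detected.\<close>

fun D_coord :: "complex \<Rightarrow> coord \<Rightarrow> laurent_poly" where
  "D_coord c (Ca i) = (if i < 2 then 0 else if i = 2 then par ^ 2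
     else if i = 4 then laurent_var (Ca 4) + laurent_const c else laurent_var (Ca i))"
| "D_coord c (Cb i) = (if i < 3 then 0 else if i = 3 then par ^ 3
     else if i = 4 then laurent_const (3/2) * par * laurent_var (Ca 3) else laurent_var (Cb i))"

definition D_eval :: "complex \<Rightarrow> arc_poly \<Rightarrow> laurent_poly" where
  "D_eval c = arc_eval laurent_const (D_coord c)"

lemma type_ring_hom_D_eval: "type_ring_hom (D_eval c)"
  unfolding D_eval_def by (rule type_ring_hom_arc_eval[OF type_ring_hom_laurent_const])

interpretation D_eval: type_ring_hom "D_eval c"
  by (rule type_ring_hom_D_eval)

lemma D_eval_gens: "D_eval c (arc_const a) = laurent_const a" "D_eval c (arc_var x) = D_coord c x"
  by (simp_all add: D_eval_def arc_eval_gens[OF type_ring_hom_laurent_const])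

definition arc_eqn1 :: arc_poly where
  "arc_eqn1 = arc_var (Ca 2) ^ 3 - arc_var (Cb 3) ^ 2"

definition arc_eqn2 :: arc_poly where
  "arc_eqn2 = 3 * arc_var (Ca 2) ^ 2 * arc_var (Ca 3) - 2 * arc_var (Cb 3) * arc_var (Cb 4)"

definition eqn1 :: laurent_poly where
  "eqn1 = laurent_var (Ca 2) ^ 3 - laurent_var (Cb 3) ^ 2"

definition eqn2 :: laurent_poly where
  "eqn2 = 3 * laurent_var (Ca 2) ^ 2 * laurent_var (Ca 3) - 2 * laurent_var (Cb 3) * laurent_var (Cb 4)"

lemma contact_restrict_eqns: "contact_restrict arc_eqn1 = eqn1" "contact_restrict arc_eqn2 = eqn2"
  by (simp_all add: arc_eqn1_def arc_eqn2_def eqn1_def eqn2_def restrict.hom_simps contact_restrict_gens)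

lemma eqns_in [simp]: "eqn1 \<in> contact_carrier" "eqn2 \<in> contact_carrier"
  using contact_restrict_eqns contact_restrict_in by metis+

lemma D_ideal_eq: "D_ideal = genideal (type_ring contact_carrier) {eqn1, eqn2}"
  by (simp add: D_ideal_def contact_ring_eq eqn1_def eqn2_def)

lemma D_ideal_facts:
  shows D_ideal_subset: "D_ideal \<subseteq> contact_carrier"
    and D_ideal_zero: "0 \<in> D_ideal"
    and D_ideal_add: "p \<in> D_ideal \<Longrightarrow> q \<in> D_ideal \<Longrightarrow> p + q \<in> D_ideal"
    and D_ideal_mult: "s \<in> contact_carrier \<Longrightarrow> p \<in> D_ideal \<Longrightarrow> s * p \<in> D_ideal"
    and eqns_in_D_ideal: "eqn1 \<in> D_ideal" "eqn2 \<in> D_ideal"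
proof -
  interpret cring "type_ring contact_carrier" by (rule contact.cring_type_ring)
  have "ideal D_ideal (type_ring contact_carrier)"
    unfolding D_ideal_eq by (rule genideal_ideal) simp
  note * = this[unfolded contact.ideal_type_ring_iff]
  show "D_ideal \<subseteq> contact_carrier" "0 \<in> D_ideal"
    "p \<in> D_ideal \<Longrightarrow> q \<in> D_ideal \<Longrightarrow> p + q \<in> D_ideal"
    "s \<in> contact_carrier \<Longrightarrow> p \<in> D_ideal \<Longrightarrow> s * p \<in> D_ideal"
    using * by blast+
  show "eqn1 \<in> D_ideal" "eqn2 \<in> D_ideal"
    using genideal_self[of "{eqn1, eqn2}"] by (auto simp: D_ideal_eq)
qed

lemma D_ideal_least:
  assumes Q: "Q \<in> Spec contact_ring"
  shows "D_ideal \<subseteq> Q \<longleftrightarrow> eqn1 \<in> Q \<and> eqn2 \<in> Q"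
proof
  interpret cring "type_ring contact_carrier" by (rule contact.cring_type_ring)
  assume "eqn1 \<in> Q \<and> eqn2 \<in> Q"
  moreover have "ideal Q (type_ring contact_carrier)"
    using Q by (simp add: contact_ring_eq Spec_def primeideal_def)
  ultimately show "D_ideal \<subseteq> Q" unfolding D_ideal_eq by (intro genideal_minimal) auto
qed (use eqns_in_D_ideal in blast)

definition a2_inverse :: laurent_poly where
  "a2_inverse = single (- single (Ca 2) 1) 1"

definition b3_inverse :: laurent_poly where
  "b3_inverse = single (- single (Cb 3) 1) 1"

lemma inv_facts:
  "laurent_var (Ca 2) * a2_inverse = 1" "laurent_var (Cb 3) * b3_inverse = 1" "par = laurent_var (Cb 3) * a2_inverse"
  by (simp_all add: laurent_var_def a2_inverse_def b3_inverse_def par_def mult_single)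

lemma inv_in: "a2_inverse \<in> contact_carrier" "b3_inverse \<in> contact_carrier" "par \<in> contact_carrier"
proof -
  show 1: "a2_inverse \<in> contact_carrier" "b3_inverse \<in> contact_carrier"
    by (auto simp: contact_carrier_iff a2_inverse_def b3_inverse_def lookup_single when_def)
  show "par \<in> contact_carrier"
    unfolding inv_facts by (intro contact.mem_intros 1 laurent_var_in) simp
qed

lemma D_eval_in: "D_eval c r \<in> contact_carrier"
proof (induction r rule: arc_poly_induct)
  case (var x)
  show ?case
    by (cases x) (auto simp: D_eval_gens intro!: contact.mem_intros inv_in)
qed (auto simp: D_eval_gens D_eval.hom_simps intro: contact.mem_intros)

lemma laurent_const_numeral: "laurent_const (numeral n) = numeral n"
  by (simp add: laurent_const_def)

lemma laurent_const_three_halves: "laurent_const (3/2) * 2 = 3"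
proof -
  have "laurent_const (3/2 * 2) = laurent_const (3/2) * laurent_const 2"
    using type_ring_hom.hom_mult[OF type_ring_hom_laurent_const] .
  then show ?thesis by (simp add: laurent_const_numeral)
qed

text \<open>On \<open>D\<close> one has \<open>a\<^sub>2 = par\<^sup>2\<close>, \<open>b\<^sub>3 = par\<^sup>3\<close> and \<open>b\<^sub>4 = (3/2) par a\<^sub>3\<close>, so substituting the
  parametrization changes an element only by a member of the ideal.  Elements with
  \<open>D_eval 0 r = 0\<close> therefore lie in the ideal of \<open>D\<close>.\<close>

lemma D_eval_cong: "D_eval 0 r - contact_restrict r \<in> D_ideal"
proof (induction r rule: arc_poly_induct)
  case (const c)
  show ?case by (simp add: D_eval_gens contact_restrict_gens D_ideal_zero)
next
  case (var x)
  let ?a = "laurent_var (Ca 2)" and ?b = "laurent_var (Cb 3)" and ?c = "laurent_var (Ca 3)" and ?d = "laurent_var (Cb 4)"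
  note i = inv_facts(1,2)
  have l0: "laurent_const 0 = 0" by (simp add: laurent_const_def)
  have "x = Ca 2 \<or> x = Cb 3 \<or> x = Cb 4 \<or> D_coord 0 x = (if x \<in> contact_coords then laurent_var x else 0)"
    by (cases x) (auto simp: l0)
  then consider "x = Ca 2" | "x = Cb 3" | "x = Cb 4" | "D_coord 0 x = (if x \<in> contact_coords then laurent_var x else 0)"
    by blast
  then show ?case
  proof cases
    case 1
    have "a2_inverse ^ 2 * ?a ^ 3 = (?a * a2_inverse) ^ 2 * ?a" by (simp add: eval_nat_numeral mult_ac)
    then have "par ^ 2 - ?a = (- (a2_inverse ^ 2)) * eqn1"
      unfolding inv_facts(3) eqn1_def i by (simp add: power_mult_distrib algebra_simps)
    then show ?thesis
      using 1 by (auto simp: D_eval_gens contact_restrict_gens simp del: mult_minus_left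
        intro!: D_ideal_mult eqns_in_D_ideal contact.mem_intros inv_in)
  next
    case 2
    have "a2_inverse ^ 3 * ?a ^ 3 = (?a * a2_inverse) ^ 3" by (simp add: power_mult_distrib mult_ac)
    then have 1: "a2_inverse ^ 3 * ?a ^ 3 = 1" by (simp add: i)
    have "(- (?b * a2_inverse ^ 3)) * eqn1 = (?b * a2_inverse) ^ 3 - ?b * (a2_inverse ^ 3 * ?a ^ 3)"
      unfolding eqn1_def by (simp add: power_mult_distrib algebra_simps eval_nat_numeral)
    then have "par ^ 3 - ?b = (- (?b * a2_inverse ^ 3)) * eqn1"
      unfolding inv_facts(3) 1 by simp
    then show ?thesis
      using 2 by (auto simp: D_eval_gens contact_restrict_gens simp del: mult_minus_left
        intro!: D_ideal_mult eqns_in_D_ideal contact.mem_intros inv_in)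
  next
    case 3
    let ?h = "laurent_const (1/2)"
    have h: "?h * 2 = 1"
    proof -
      have "laurent_const (1/2 * 2) = ?h * laurent_const 2"
        using type_ring_hom.hom_mult[OF type_ring_hom_laurent_const] .
      then show ?thesis by (simp add: laurent_const_numeral) (simp add: laurent_const_def)
    qed
    have t: "laurent_const (3/2) = 3 * ?h"
    proof -
      have "laurent_const (3 * (1/2)) = laurent_const 3 * ?h"
        using type_ring_hom.hom_mult[OF type_ring_hom_laurent_const] .
      then show ?thesis by (simp add: laurent_const_numeral)
    qed
    have "3 * ?h * par * ?c - ?d = (?h * b3_inverse) * eqn2 + (- (3 * ?h * ?c * a2_inverse * b3_inverse)) * eqn1"
    proof -
      have "(?h * b3_inverse) * eqn2 + (- (3 * ?h * ?c * a2_inverse * b3_inverse)) * eqn1 =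
          3 * ?h * ?a ^ 2 * ?c * b3_inverse * (1 - ?a * a2_inverse) - (?h * 2) * (?b * b3_inverse) * ?d
          + 3 * ?h * ?c * a2_inverse * ?b * (?b * b3_inverse)"
        unfolding eqn1_def eqn2_def by (simp add: algebra_simps eval_nat_numeral)
      then show ?thesis unfolding i h inv_facts(3) by (simp add: mult_ac)
    qed
    then show ?thesis
      using 3 unfolding D_eval_gens contact_restrict_gens
      by (auto simp: t simp del: mult_minus_left
        intro!: D_ideal_add D_ideal_mult eqns_in_D_ideal contact.mem_intros inv_in)
  next
    case 4
    then show ?thesis by (simp add: D_eval_gens contact_restrict_gens D_ideal_zero)
  qed
next
  case (add f g)
  then have "(D_eval 0 f - contact_restrict f) + (D_eval 0 g - contact_restrict g) \<in> D_ideal"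
    by (rule D_ideal_add)
  then show ?case by (simp add: D_eval.hom_add restrict.hom_add algebra_simps)
next
  case (mult f g)
  then have "D_eval 0 f * (D_eval 0 g - contact_restrict g) + contact_restrict g * (D_eval 0 f - contact_restrict f) \<in> D_ideal"
    by (intro D_ideal_add D_ideal_mult D_eval_in contact_restrict_in)
  then show ?case by (simp add: D_eval.hom_mult restrict.hom_mult algebra_simps)
qed

definition D_point :: "arc_poly set" where
  "D_point = {r. D_eval 0 r = 0}"

lemma par_nonzero: "par \<noteq> 0"
proof -
  have "keys par \<noteq> {}"
    unfolding par_def by (subst keys_single) simp
  then show ?thesis by auto
qed

text \<open>The kernel is a prime in the contact locus, so it is the contraction of a point of the contact ring,
  and that point contains both equations because the parametrization satisfies them.\<close>

lemma D_eval_kernel_point: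
  obtains Q where "Q \<in> Spec contact_ring" "D_ideal \<subseteq> Q" "{r. D_eval c r = 0} = contact_point Q"
proof -
  have P: "{r. D_eval c r = 0} \<in> Spec arc_ring"
    by (rule kernel_in_Spec_arc[OF type_ring_hom_D_eval])
  have "{r. D_eval c r = 0} \<in> Cont 2 xvar \<inter> Cont 3 yvar"
    unfolding Cont_iff[OF P] by (simp add: D_eval_gens par_nonzero)
  then obtain Q where Q: "Q \<in> Spec contact_ring" "{r. D_eval c r = 0} = contact_point Q"
    unfolding contact_point_eq_Cont[symmetric] by blast
  have "D_eval c arc_eqn1 = 0"
    by (simp add: arc_eqn1_def D_eval.hom_simps D_eval_gens flip: power_mult)
  moreover have "D_eval c arc_eqn2 = (3 - laurent_const (3/2) * 2) * (par ^ 4 * laurent_var (Ca 3))"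
    by (simp add: arc_eqn2_def D_eval.hom_simps D_eval_gens algebra_simps eval_nat_numeral)
  then have "D_eval c arc_eqn2 = 0" by (simp add: laurent_const_three_halves)
  ultimately have "eqn1 \<in> Q" "eqn2 \<in> Q"
    using Q(2) by (auto simp: set_eq_iff contact_point_iff contact_restrict_eqns[symmetric])
  then show thesis using that Q D_ideal_least[OF Q(1)] by blast
qed

text \<open>The point found for the kernel of \<open>D_eval 0\<close> contains the ideal of \<open>D\<close>, and by the congruence above it
  is contained in it.\<close>

lemma D_ideal_prime: "D_ideal \<in> Spec contact_ring"
  and D_point_eq: "D_point = contact_point D_ideal"
proof -
  obtain Q where Q: "Q \<in> Spec contact_ring" "D_ideal \<subseteq> Q" "D_point = contact_point Q"
    unfolding D_point_def by (rule D_eval_kernel_point)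
  have *: "contact_restrict r \<in> D_ideal" if "r \<in> D_point" for r
  proof -
    have "- 1 * (D_eval 0 r - contact_restrict r) \<in> D_ideal"
      by (intro D_ideal_mult D_eval_cong contact.uminus_mem contact.one_mem)
    then show ?thesis using that by (simp add: D_point_def)
  qed
  have "Q \<subseteq> D_ideal"
  proof
    fix p assume p: "p \<in> Q"
    then have pc: "p \<in> contact_carrier" using Spec_contact_subset[OF Q(1)] by blast
    then obtain n r where r: "contact_restrict r = contact_unit ^ n * p"
      by (rule contact_clear_denominators)
    then have "contact_restrict r \<in> Q" using p pc Spec_contact_mult_unit_iff[OF Q(1)] by simp
    then have "r \<in> D_point" by (simp add: Q(3) contact_point_iff)
    then have "contact_unit ^ n * p \<in> D_ideal" using * r by metis
    moreover obtain w where "w \<in> contact_carrier" "w * contact_unit ^ n = 1"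
      by (rule contact_unit_inverse)
    ultimately show "p \<in> D_ideal"
      using D_ideal_mult[of w "contact_unit ^ n * p"] by (simp add: mult.assoc[symmetric])
  qed
  then have "Q = D_ideal" using Q(2) by blast
  then show "D_ideal \<in> Spec contact_ring" "D_point = contact_point D_ideal" using Q by auto
qed

lemma D_point_in_Spec: "D_point \<in> Spec arc_ring"
  unfolding D_point_eq by (rule contact_point_in_Spec[OF D_ideal_prime])

text \<open>The translation of \<open>a\<^sub>4\<close> on the arc ring carries the kernel of one parametrization into the kernel of the
  other.  Each kernel contains \<open>D_point\<close>, and translating back shows that each is equal to it.\<close>

definition arc_shift :: "complex \<Rightarrow> arc_poly \<Rightarrow> arc_poly" where
  "arc_shift c = arc_eval arc_const (\<lambda>x. arc_var x + (if x = Ca 4 then arc_const c else 0))"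

lemma type_ring_hom_arc_shift: "type_ring_hom (arc_shift c)"
  unfolding arc_shift_def by (rule type_ring_hom_arc_eval[OF type_ring_hom_arc_const])

lemma arc_shift_gens:
  "arc_shift c (arc_const a) = arc_const a"
  "arc_shift c (arc_var x) = arc_var x + (if x = Ca 4 then arc_const c else 0)"
  by (simp_all add: arc_shift_def arc_eval_gens[OF type_ring_hom_arc_const])

lemma D_eval_arc_shift: "D_eval 0 (arc_shift c r) = D_eval c r"
proof (rule arc_hom_eqI[OF type_ring_hom_comp[OF type_ring_hom_arc_shift type_ring_hom_D_eval] type_ring_hom_D_eval])
  fix x
  have "laurent_const 0 = 0" by (simp add: laurent_const_def)
  then show "D_eval 0 (arc_shift c (arc_var x)) = D_eval c (arc_var x)"
    by (cases x) (auto simp: arc_shift_gens D_eval_gens D_eval.hom_simps)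
qed (simp add: arc_shift_gens D_eval_gens)

lemma arc_shift_shift: "arc_shift (- c) (arc_shift c r) = r"
proof (rule arc_hom_eqI[OF type_ring_hom_comp[OF type_ring_hom_arc_shift type_ring_hom_arc_shift] type_ring_hom_id])
  fix x
  show "arc_shift (- c) (arc_shift c (arc_var x)) = arc_var x"
    using type_ring_hom.hom_uminus[OF type_ring_hom_arc_const, of c]
    by (simp add: arc_shift_gens type_ring_hom.hom_add[OF type_ring_hom_arc_shift]
        type_ring_hom.hom_zero[OF type_ring_hom_arc_shift])
qed (simp add: arc_shift_gens)

lemma D_eval_kernel: "D_eval c r = 0 \<longleftrightarrow> r \<in> D_point"
proof -
  have *: "D_eval c r = 0" if "r \<in> D_point" for c r
  proof -
    obtain Q where Q: "Q \<in> Spec contact_ring" "D_ideal \<subseteq> Q" "{r. D_eval c r = 0} = contact_point Q"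
      by (rule D_eval_kernel_point)
    then have "D_point \<subseteq> {r. D_eval c r = 0}"
      using contact_point_mono_iff[OF D_ideal_prime Q(1)] by (simp add: D_point_eq)
    then show ?thesis using that by blast
  qed
  show ?thesis
  proof
    assume "D_eval c r = 0"
    then have "arc_shift c r \<in> D_point" by (simp add: D_point_def D_eval_arc_shift)
    then have "D_eval (- c) (arc_shift c r) = 0" by (rule *)
    then have "D_eval 0 (arc_shift (- c) (arc_shift c r)) = 0" by (simp only: D_eval_arc_shift)
    then show "r \<in> D_point" by (simp add: arc_shift_shift D_point_def)
  qed (rule *)
qed


subsection \<open>Irreducibility and the generic point\<close>

lemma D_set_iff: "P \<in> D_set \<longleftrightarrow> P \<in> Cont 2 xvar \<inter> Cont 3 yvar \<and> D_point \<subseteq> P"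
proof -
  have "P \<in> D_set \<longleftrightarrow> (\<exists>Q \<in> Spec contact_ring. P = contact_point Q \<and> D_ideal \<subseteq> Q)"
    by (auto simp: D_set_def zeros_def)
  also have "\<dots> \<longleftrightarrow> (\<exists>Q \<in> Spec contact_ring. P = contact_point Q \<and> D_point \<subseteq> P)"
    using contact_point_mono_iff[OF D_ideal_prime] by (auto simp: D_point_eq)
  finally show ?thesis by (auto simp: contact_point_eq_Cont[symmetric])
qed

lemma D_point_in_D_set: "D_point \<in> D_set"
  unfolding D_set_def zeros_def D_point_eq using D_ideal_prime by auto

lemma D_set_subset_Spec: "D_set \<subseteq> Spec arc_ring"
  by (auto simp: D_set_iff Cont_def)

lemma D_set_subset_closure: "D_set \<subseteq> zariski arc_ring closure_of {D_point}"
  unfolding closure_of_zariski_point[OF D_point_in_Spec] using D_set_subset_Spec by (auto simp: D_set_iff)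

lemma closedin_D_set: "closedin (subtopology (zariski arc_ring) (Cont 2 xvar \<inter> Cont 3 yvar)) D_set"
proof -
  have "closedin (zariski contact_ring) (zeros contact_ring D_ideal)"
    unfolding closedin_zariski using D_ideal_subset by (auto simp: contact_carrier_def)
  moreover have "closed_map (zariski contact_ring)
      (subtopology (zariski arc_ring) (Cont 2 xvar \<inter> Cont 3 yvar)) contact_point"
    using embedding_map_contact_point unfolding embedding_map_def topspace_zariski contact_point_eq_Cont
    by (rule homeomorphic_imp_closed_map)
  ultimately show ?thesis unfolding D_set_def closed_map_def by blast
qed

lemma irreducible_D_set: "irreducible_subset (zariski arc_ring) D_set"
  unfolding irreducible_subset_def
proof (intro conjI allI impI)
  fix C C' assume C: "closedin (zariski arc_ring) C \<and> closedin (zariski arc_ring) C' \<and> D_set \<subseteq> C \<union> C'"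
  then have "D_point \<in> C \<or> D_point \<in> C'" using D_point_in_D_set by blast
  then have "zariski arc_ring closure_of {D_point} \<subseteq> C \<or> zariski arc_ring closure_of {D_point} \<subseteq> C'"
    using C by (auto intro: closure_of_minimal[THEN subsetD])
  then show "D_set \<subseteq> C \<or> D_set \<subseteq> C'" using D_set_subset_closure by blast
qed (use D_set_subset_Spec D_point_in_D_set in auto)

lemma generic_point_D_set: "generic_point (zariski arc_ring) D_set \<alpha> \<longleftrightarrow> \<alpha> = D_point"
proof
  assume \<alpha>: "generic_point (zariski arc_ring) D_set \<alpha>"
  then have "\<alpha> \<in> D_set" "D_point \<in> zariski arc_ring closure_of {\<alpha>}"
    using D_point_in_D_set by (auto simp: generic_point_def)
  moreover from this have "\<alpha> \<in> Spec arc_ring" using D_set_subset_Spec by blast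
  ultimately show "\<alpha> = D_point" by (auto simp: closure_of_zariski_point D_set_iff)
qed (auto simp: generic_point_def D_point_in_D_set D_set_subset_closure[THEN subsetD])

text \<open>Restriction induces a map from the residue field in the arc ring to the one in the contact ring; it is
  onto because a fraction in the contact ring can be expanded by a power of the unit.\<close>

lemma residue_field_D_point_iso:
  "\<exists>h \<in> ring_iso (residue_field contact_ring D_ideal) (residue_field arc_ring D_point).
     \<forall>p \<in> carrier arc_ring. h (residue contact_ring D_ideal (contact_restrict p)) = residue arc_ring D_point p"
proof -
  let ?L = "residue_field contact_ring D_ideal" and ?K = "residue_field arc_ring D_point"
  let ?\<phi> = "\<lambda>p. residue contact_ring D_ideal (contact_restrict p)"
  interpret L: field ?L by (rule field_residue_field[OF D_ideal_prime])
  interpret K: field ?K by (rule field_residue_field[OF D_point_in_Spec])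
  note res = residue_hom[OF D_ideal_prime]
  have cr: "contact_restrict \<in> ring_hom arc_ring contact_ring"
    by (auto simp: arc_ring_eq contact_ring_eq restrict.hom_simps intro: ring_hom_memI)
  have \<phi>: "?\<phi> \<in> ring_hom arc_ring ?L"
    using ring_hom_trans[OF cr res] by (simp add: comp_def)
  have zero: "residue contact_ring D_ideal q = \<zero>\<^bsub>?L\<^esub> \<longleftrightarrow> q \<in> D_ideal" if "q \<in> contact_carrier" for q
    by (rule residue_eq_zero_iff[OF D_ideal_prime]) (use that in \<open>simp add: contact_ring_eq\<close>)
  have ker: "?\<phi> a = \<zero>\<^bsub>?L\<^esub> \<longleftrightarrow> a \<in> D_point" for a
    by (simp add: zero D_point_eq contact_point_iff)
  have surj: "\<exists>a \<in> carrier arc_ring. \<exists>b \<in> carrier arc_ring. b \<notin> D_point \<and> y \<otimes>\<^bsub>?L\<^esub> ?\<phi> b = ?\<phi> a"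
    if "y \<in> carrier ?L" for y
  proof -
    obtain p q where pq: "p \<in> contact_carrier" "q \<in> contact_carrier" "q \<notin> D_ideal"
      "y = residue contact_ring D_ideal p \<otimes>\<^bsub>?L\<^esub> inv\<^bsub>?L\<^esub> (residue contact_ring D_ideal q)"
      using residue_fieldE[OF D_ideal_prime \<open>y \<in> carrier ?L\<close>] by (metis contact_carrier_def)
    let ?p = "residue contact_ring D_ideal p" and ?q = "residue contact_ring D_ideal q"
    have c: "?p \<in> carrier ?L" "?q \<in> carrier ?L"
      using pq ring_hom_closed[OF res] by (auto simp: contact_carrier_def)
    have u: "?q \<in> Units ?L" using c pq zero by (simp add: L.field_Units)
    obtain m r where r: "contact_restrict r = contact_unit ^ m * p"
      using pq(1) by (rule contact_clear_denominators)
    obtain n s where s: "contact_restrict s = contact_unit ^ n * q"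
      using pq(2) by (rule contact_clear_denominators)
    let ?a = "arc_unit ^ n * r" and ?b = "arc_unit ^ m * s"
    let ?w = "contact_unit ^ (m + n)"
    have a: "contact_restrict ?a = ?w * p" and b: "contact_restrict ?b = ?w * q"
      using r s by (simp_all add: restrict.hom_simps power_add mult_ac)
    have "?b \<notin> D_point"
      using b pq Spec_contact_mult_unit_iff[OF D_ideal_prime] by (simp add: D_point_eq contact_point_iff)
    have w: "residue contact_ring D_ideal ?w \<in> carrier ?L"
      using ring_hom_closed[OF res] contact.power_mem[OF contact_unit_in] by (simp add: contact_carrier_def)
    have m: "residue contact_ring D_ideal (?w * t) = residue contact_ring D_ideal ?w \<otimes>\<^bsub>?L\<^esub> residue contact_ring D_ideal t"
      if "t \<in> contact_carrier" for t
      using ring_hom_mult[OF res, of ?w t] contact.power_mem[OF contact_unit_in] that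
      by (simp add: contact_ring_eq)
    have yq: "y \<otimes>\<^bsub>?L\<^esub> ?q = ?p"
      using c u by (simp add: pq(4) L.m_assoc)
    have "y \<otimes>\<^bsub>?L\<^esub> ?\<phi> ?b = residue contact_ring D_ideal ?w \<otimes>\<^bsub>?L\<^esub> (y \<otimes>\<^bsub>?L\<^esub> ?q)"
      using m[OF pq(2)] \<open>y \<in> carrier ?L\<close> w c by (simp add: b L.m_lcomm)
    also have "\<dots> = ?\<phi> ?a" unfolding yq a by (simp add: m[OF pq(1)])
    finally show ?thesis using \<open>?b \<notin> D_point\<close> by (auto simp: arc_ring_eq)
  qed
  obtain \<iota> where \<iota>: "\<iota> \<in> ring_iso ?K ?L" "\<And>a. a \<in> carrier arc_ring \<Longrightarrow> \<iota> (residue arc_ring D_point a) = ?\<phi> a"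
    using residue_field_iso[OF D_point_in_Spec L.field_axioms \<phi> ker surj] by blast
  have inj: "inj_on \<iota> (carrier ?K)" using \<iota>(1) by (simp add: ring_iso_def bij_betw_def)
  have "inv_into (carrier ?K) \<iota> \<in> ring_iso ?L ?K"
    by (rule ring_iso_set_sym[OF K.ring_axioms \<iota>(1)])
  moreover have "inv_into (carrier ?K) \<iota> (?\<phi> p) = residue arc_ring D_point p" if "p \<in> carrier arc_ring" for p
    using that \<iota>(2)[OF that] ring_hom_closed[OF residue_hom[OF D_point_in_Spec] that] inv_into_f_f[OF inj]
    by metis
  ultimately show ?thesis by blast
qed


section \<open>Contact with the cusp\<close>

definition cusp :: plane_poly where
  "cusp = xvar ^ 3 - yvar ^ 2"

lemma fps_cusp_nth:
  fixes F G :: "'a::comm_ring_1 fps"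
  shows "fps_nth (F ^ 3 - G ^ 2) 0 = fps_nth F 0 ^ 3 - fps_nth G 0 ^ 2"
    and "fps_nth (F ^ 3 - G ^ 2) 1 = 3 * fps_nth F 0 ^ 2 * fps_nth F 1 - 2 * fps_nth G 0 * fps_nth G 1"
    and "fps_nth (F ^ 3 - G ^ 2) 2 = 3 * fps_nth F 0 ^ 2 * fps_nth F 2 + 3 * fps_nth F 0 * fps_nth F 1 ^ 2
      - 2 * fps_nth G 0 * fps_nth G 2 - fps_nth G 1 ^ 2"
  by (simp_all add: eval_nat_numeral fps_mult_nth algebra_simps)

text \<open>If \<open>x = t\<^sup>2 F\<close> and \<open>y = t\<^sup>3 G\<close>, then \<open>x\<^sup>3 - y\<^sup>2 = t\<^sup>6 (F\<^sup>3 - G\<^sup>2)\<close>: the lowest coefficients of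
  the equation of the cusp are those of \<open>F\<^sup>3 - G\<^sup>2\<close>.\<close>

lemma arc_of_contact:
  fixes h :: "arc_poly \<Rightarrow> 'b::comm_ring_1"
  assumes h: "type_ring_hom h" and vars: "\<And>x. x \<notin> contact_coords \<Longrightarrow> h (arc_var x) = 0"
  defines "F \<equiv> Abs_fps (\<lambda>k. h (arc_var (Ca (k + 2))))" and "G \<equiv> Abs_fps (\<lambda>k. h (arc_var (Cb (k + 3))))"
  shows "arc_of h xvar = fps_X ^ 2 * F" "arc_of h yvar = fps_X ^ 3 * G"
    "arc_of h cusp = fps_X ^ 6 * (F ^ 3 - G ^ 2)"
proof -
  interpret a: type_ring_hom "arc_of h" by (rule type_ring_hom_arc_of[OF h])
  show 1: "arc_of h xvar = fps_X ^ 2 * F"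
  proof (rule fps_ext)
    fix n
    show "fps_nth (arc_of h xvar) n = fps_nth (fps_X ^ 2 * F) n"
    proof (cases "n < 2")
      case True
      then show ?thesis using vars[of "Ca n"] by (simp add: arc_of_gens[OF h] fps_X_power_mult_nth)
    next
      case False
      then obtain k where "n = k + 2" by (metis le_add_diff_inverse2 not_less)
      then show ?thesis by (simp add: arc_of_gens[OF h] fps_X_power_mult_nth F_def)
    qed
  qed
  show 2: "arc_of h yvar = fps_X ^ 3 * G"
  proof (rule fps_ext)
    fix n
    show "fps_nth (arc_of h yvar) n = fps_nth (fps_X ^ 3 * G) n"
    proof (cases "n < 3")
      case True
      then show ?thesis using vars[of "Cb n"] by (simp add: arc_of_gens[OF h] fps_X_power_mult_nth)
    next
      case False
      then obtain k where "n = k + 3" by (metis le_add_diff_inverse2 not_less)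
      then show ?thesis by (simp add: arc_of_gens[OF h] fps_X_power_mult_nth G_def)
    qed
  qed
  have "(fps_X ^ 2 * F) ^ 3 - (fps_X ^ 3 * G) ^ 2 = fps_X ^ 6 * (F ^ 3 - G ^ 2)"
    by (simp add: power_mult_distrib right_diff_distrib flip: power_mult)
  then show "arc_of h cusp = fps_X ^ 6 * (F ^ 3 - G ^ 2)"
    unfolding cusp_def a.hom_simps 1 2 .
qed

lemma cusp_coeffs_below_8:
  assumes Q: "Q \<in> Spec contact_ring"
  shows "(\<forall>n<8. fps_nth (universal_arc cusp) n \<in> contact_point Q) \<longleftrightarrow> eqn1 \<in> Q \<and> eqn2 \<in> Q"
proof -
  define F where "F = Abs_fps (\<lambda>k. contact_restrict (arc_var (Ca (k + 2))))"
  define G where "G = Abs_fps (\<lambda>k. contact_restrict (arc_var (Cb (k + 3))))"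
  have "arc_of contact_restrict cusp = fps_X ^ 6 * (F ^ 3 - G ^ 2)"
    unfolding F_def G_def
    by (rule arc_of_contact(3)[OF restrict.type_ring_hom_axioms]) (simp add: contact_restrict_gens)
  then have *: "fps_nth (universal_arc cusp) n \<in> contact_point Q \<longleftrightarrow>
      (if n < 6 then 0 else fps_nth (F ^ 3 - G ^ 2) (n - 6)) \<in> Q" for n
    by (simp add: contact_point_iff hom_universal_arc[OF restrict.type_ring_hom_axioms] fps_X_power_mult_nth)
  have 0: "0 \<in> Q" using contact.Spec_type_ringD(2)[OF Q[unfolded contact_ring_eq]] .
  have e: "fps_nth (F ^ 3 - G ^ 2) 0 = eqn1" "fps_nth (F ^ 3 - G ^ 2) (Suc 0) = eqn2"
    using fps_cusp_nth(1,2)[of F G]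
    by (simp_all add: F_def G_def contact_restrict_gens eqn1_def eqn2_def numeral_2_eq_2 numeral_3_eq_3
        eval_nat_numeral)
  have "(\<forall>n<8. fps_nth (universal_arc cusp) n \<in> contact_point Q) \<longleftrightarrow>
      fps_nth (universal_arc cusp) 6 \<in> contact_point Q \<and> fps_nth (universal_arc cusp) 7 \<in> contact_point Q"
  proof (intro iffI conjI allI impI)
    fix n :: nat
    assume a: "fps_nth (universal_arc cusp) 6 \<in> contact_point Q \<and> fps_nth (universal_arc cusp) 7 \<in> contact_point Q"
    assume "n < 8"
    then consider "n < 6" | "n = 6" | "n = 7" by linarith
    then show "fps_nth (universal_arc cusp) n \<in> contact_point Q"
      using a 0 by cases (auto simp: *)
  qed auto
  then show ?thesis by (simp add: * e del: fps_sub_nth)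
qed

lemma D_set_eq_Cont_ge: "D_set = Cont 2 xvar \<inter> Cont 3 yvar \<inter> Cont_ge 8 cusp"
proof -
  have "P \<in> D_set \<longleftrightarrow> P \<in> Cont_ge 8 cusp" if "P \<in> Cont 2 xvar \<inter> Cont 3 yvar" for P
  proof -
    obtain Q where Q: "Q \<in> Spec contact_ring" "P = contact_point Q"
      using \<open>P \<in> Cont 2 xvar \<inter> Cont 3 yvar\<close> by (auto simp: contact_point_eq_Cont[symmetric])
    have P: "P \<in> Spec arc_ring" using Q contact_point_in_Spec by simp
    have "P \<in> D_set \<longleftrightarrow> D_ideal \<subseteq> Q"
      using that contact_point_mono_iff[OF D_ideal_prime Q(1)] by (simp add: D_set_iff D_point_eq Q(2))
    also have "\<dots> \<longleftrightarrow> P \<in> Cont_ge 8 cusp"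
      using P cusp_coeffs_below_8[OF Q(1)] D_ideal_least[OF Q(1)]
      by (simp add: Cont_ge_def arc_ord_ge_iff Q(2))
    finally show ?thesis .
  qed
  then show ?thesis using D_set_iff by blast
qed


subsection \<open>Division by the equation of the cusp\<close>

text \<open>Up to sign the equation is monic of degree two in \<open>y\<close>, so division with remainder by it is possible.\<close>

lemma cusp_division:
  "\<exists>p q f'. f = [:p, q:] + cusp * f' \<and> (f' = 0 \<or> degree f' < degree f)"
proof (induction "degree f" arbitrary: f rule: less_induct)
  case less
  show ?case
  proof (cases "degree f \<le> 1")
    case True
    have "f = [:coeff f 0, coeff f 1:]"
      by (rule poly_eqI) (use True in \<open>auto simp: coeff_pCons coeff_eq_0 split: nat.splits\<close>)
    then show ?thesis by (intro exI[of _ "coeff f 0"] exI[of _ "coeff f 1"] exI[of _ 0]) simp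
  next
    case False
    define d where "d = degree f"
    define m where "m = monom (Polynomial.lead_coeff f) (d - 2)"
    have cusp: "cusp = [:[:0, 1:] ^ 3, 0, - 1:]"
      by (simp add: cusp_def xvar_def yvar_def eval_nat_numeral one_pCons)
    have "coeff (f + cusp * m) i = 0" if "i > d - 1" for i
    proof -
      have c: "cusp * m = Polynomial.smult ([:0, 1:] ^ 3) m - pCons 0 (pCons 0 m)"
        unfolding cusp by simp
      show ?thesis
      proof (cases "i = d")
        case True
        obtain k where k: "d = Suc (Suc k)" using False d_def by (metis One_nat_def not_less_eq_eq not0_implies_Suc le0)
        define l where "l = Polynomial.lead_coeff f"
        have "coeff f (Suc (Suc k)) = l" using k by (simp add: l_def d_def)
        moreover have "m = monom l k" using k by (simp add: m_def l_def)
        ultimately show ?thesis using True k unfolding c by (simp add: coeff_pCons)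
      next
        case neq: False
        then have "i > d" using that by simp
        then obtain k where k: "i = Suc (Suc k)" using False d_def
          by (metis One_nat_def not_less_eq_eq not0_implies_Suc le0 less_imp_le_nat le_trans)
        have "coeff f i = 0" using \<open>i > d\<close> by (simp add: d_def coeff_eq_0)
        moreover have "coeff m i = 0" "coeff m k = 0"
          using \<open>i > d\<close> False k by (simp_all add: m_def d_def)
        ultimately show ?thesis unfolding c k by simp
      qed
    qed
    then have "degree (f + cusp * m) \<le> d - 1" by (intro degree_le) auto
    then have lt: "degree (f + cusp * m) < d" using False d_def by simp
    then obtain p q f' where f': "f + cusp * m = [:p, q:] + cusp * f'"
      "f' = 0 \<or> degree f' < degree (f + cusp * m)"
      using less unfolding d_def by blast
    have "f = [:p, q:] + cusp * (f' - m)" using f'(1) by (simp add: algebra_simps)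
    moreover have "degree (f' - m) < d"
    proof (rule degree_diff_less)
      show "degree f' < d" using f'(2) lt False d_def by auto
      have "degree m \<le> d - 2" unfolding m_def by (rule degree_monom_le)
      then show "degree m < d" using False d_def by simp
    qed
    ultimately show ?thesis unfolding d_def by blast
  qed
qed

text \<open>The parametrization of the cusp.  Even and odd powers of the parameter separate the two
  parts of a remainder, so a remainder vanishes on the cusp only if it is zero.\<close>

definition cusp_param :: "plane_poly \<Rightarrow> complex poly" where
  "cusp_param = plane_eval (\<lambda>c. [:c:]) (monom 1 2) (monom 1 3)"

lemma type_ring_hom_cusp_param: "type_ring_hom cusp_param"
  unfolding cusp_param_def by (rule type_ring_hom_plane_eval[OF type_ring_hom_pCons])

lemma cusp_param_gens:
  "cusp_param (pconst c) = [:c:]" "cusp_param xvar = monom 1 2" "cusp_param yvar = monom 1 3"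
  unfolding cusp_param_def by (rule plane_eval_gens[OF type_ring_hom_pCons])+

lemma cusp_param_cusp: "cusp_param cusp = 0"
proof -
  interpret type_ring_hom cusp_param by (rule type_ring_hom_cusp_param)
  show ?thesis by (simp add: cusp_def hom_simps cusp_param_gens monom_power)
qed

lemma coeff_poly_hom_square:
  "coeff (poly_hom (\<lambda>c. [:c:]) (monom 1 2) p) k =
     (if even k then coeff p (k div 2) else (0 :: complex))"
proof -
  have "poly_hom (\<lambda>c. [:c:]) (monom 1 2) p =
      (\<Sum>i \<le> degree p. monom (coeff p i) (2 * i))"
    unfolding poly_hom_def by (rule sum.cong) (auto simp: monom_power smult_monom)
  then have "coeff (poly_hom (\<lambda>c. [:c:]) (monom 1 2) p) k =
      (\<Sum>i \<le> degree p. if 2 * i = k then coeff p i else 0)"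
    by (simp add: coeff_sum)
  also have "\<dots> = (\<Sum>i \<le> degree p. if even k \<and> i = k div 2 then coeff p (k div 2) else 0)"
    by (rule sum.cong) auto
  also have "\<dots> = (if even k then coeff p (k div 2) else 0)"
    by (auto simp: coeff_eq_0)
  finally show ?thesis .
qed

lemma coeff_cusp_param_remainder:
  "coeff (cusp_param [:p, q:]) (2 * i) = coeff p i"
  "coeff (cusp_param [:p, q:]) (2 * i + 3) = coeff q i"
proof -
  note c = type_ring_hom_poly_hom[OF type_ring_hom_pCons]
  have "cusp_param [:p, q:] = poly_hom (\<lambda>c. [:c:]) (monom 1 2) p +
      monom 1 3 * poly_hom (\<lambda>c. [:c:]) (monom 1 2) q"
    by (simp add: cusp_param_def plane_eval_def poly_hom_pCons[OF c] poly_hom_0[OF c])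
  then show "coeff (cusp_param [:p, q:]) (2 * i) = coeff p i"
    "coeff (cusp_param [:p, q:]) (2 * i + 3) = coeff q i"
    by (auto simp: coeff_poly_hom_square coeff_monom_mult)
qed

text \<open>The kernel of the parametrization is a point of the cusp, so a function in the ideal of the cusp has
  parametrization zero, and then the remainder of the division is zero.\<close>

lemma ideal_of_cusp:
  assumes "f \<in> \<Inter>(zeros plane_ring {cusp})"
  shows "cusp dvd f"
proof -
  interpret type_ring_hom cusp_param by (rule type_ring_hom_cusp_param)
  have "{f. cusp_param f = 0} \<in> zeros plane_ring {cusp}"
    using kernel_in_Spec[OF type_ring_hom_cusp_param] by (auto simp: zeros_def plane_ring_eq cusp_param_cusp)
  then have 0: "cusp_param f = 0" using assms by blast
  obtain p q f' where f: "f = [:p, q:] + cusp * f'" using cusp_division by blast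
  then have "cusp_param [:p, q:] = 0" using 0 by (simp add: hom_add hom_mult cusp_param_cusp)
  then have "coeff p i = 0" "coeff q i = 0" for i
    using coeff_cusp_param_remainder[of p q i] by auto
  then have "p = 0" "q = 0" by (auto intro: poly_eqI)
  then show ?thesis using f by simp
qed

lemma cusp_in_ideal: "cusp \<in> \<Inter>(zeros plane_ring {cusp})"
  by (auto simp: zeros_def)


subsection \<open>Jets\<close>

definition jet_carrier :: "nat \<Rightarrow> arc_poly set" where
  "jet_carrier m = carrier (jet_ring m)"

lemma jet_carrier_iff:
  "p \<in> jet_carrier m \<longleftrightarrow> (\<forall>u \<in> keys p. \<forall>c \<in> keys u. coord_index c \<le> m)"
  by (simp add: jet_carrier_def jet_ring_def)

lemma jet_ring_eq: "jet_ring m = type_ring (jet_carrier m)"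
  by (simp add: jet_carrier_def jet_ring_def type_ring_def arc_ring_def)

lemma type_subring_jet: "type_subring (jet_carrier m)"
proof
  show "p + q \<in> jet_carrier m" if "p \<in> jet_carrier m" "q \<in> jet_carrier m" for p q
    using that Poly_Mapping.keys_add[of p q] unfolding jet_carrier_iff by blast
  show "p * q \<in> jet_carrier m" if pq: "p \<in> jet_carrier m" "q \<in> jet_carrier m" for p q
    unfolding jet_carrier_iff
  proof (intro ballI)
    fix w c assume "w \<in> keys (p * q)" and c: "c \<in> keys w"
    then obtain u v where uv: "w = u + v" "u \<in> keys p" "v \<in> keys q"
      using keys_mult[of p q] by blast
    then have "c \<in> keys u \<or> c \<in> keys v" using c by (simp add: keys_add_nat)
    then show "coord_index c \<le> m" using pq uv unfolding jet_carrier_iff by blast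
  qed
  show "- p \<in> jet_carrier m" if "p \<in> jet_carrier m" for p
    using that by (auto simp: jet_carrier_iff in_keys_iff)
qed (simp add: jet_carrier_iff)

lemma universal_arc_in_jet: "n \<le> m \<Longrightarrow> fps_nth (universal_arc f) n \<in> jet_carrier m"
proof -
  interpret u: type_ring_hom universal_arc by (rule type_ring_hom_universal_arc)
  interpret j: type_subring "jet_carrier m" by (rule type_subring_jet)
  have "\<forall>n\<le>m. fps_nth (universal_arc f) n \<in> jet_carrier m"
  proof (induction f rule: plane_induct)
    case (mult f g)
    then show ?case by (auto simp: u.hom_mult fps_mult_nth intro!: j.sum_mem j.mult_mem)
  next
    case (const c)
    have "arc_const c \<in> jet_carrier m" by (simp add: jet_carrier_iff arc_const_def)
    then show ?case by (simp add: universal_arc_gens)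
  next
    case x
    have "arc_var (Ca n) \<in> jet_carrier m" if "n \<le> m" for n
      using that by (simp add: jet_carrier_iff arc_var_def)
    then show ?case by (simp add: universal_arc_gens)
  next
    case y
    have "arc_var (Cb n) \<in> jet_carrier m" if "n \<le> m" for n
      using that by (simp add: jet_carrier_iff arc_var_def)
    then show ?case by (simp add: universal_arc_gens)
  qed (simp add: u.hom_add j.add_mem)
  then show "n \<le> m \<Longrightarrow> ?thesis" by blast
qed

text \<open>The first coefficients of the universal arc already lie in the jet ring, and the jet of \<open>P\<close> is its
  contraction to that ring.\<close>

lemma jet_proj_in_jets_in_iff:
  assumes P: "P \<in> Spec arc_ring"
  shows "jet_proj m P \<in> jets_in m Z \<longleftrightarrow> (\<forall>f \<in> \<Inter>Z. \<forall>n\<le>m. fps_nth (universal_arc f) n \<in> P)"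
proof -
  interpret j: type_subring "jet_carrier m" by (rule type_subring_jet)
  have eq: "jet_proj m P = P \<inter> jet_carrier m" by (simp add: jet_proj_def jet_carrier_def)
  have S: "jet_proj m P \<in> Spec (type_ring (jet_carrier m))"
    unfolding j.Spec_type_ring_iff eq using Spec_arcD[OF P] j.mem_intros by auto
  have "residue (jet_ring m) (jet_proj m P) (fps_nth (universal_arc f) n) =
      \<zero>\<^bsub>residue_field (jet_ring m) (jet_proj m P)\<^esub> \<longleftrightarrow> fps_nth (universal_arc f) n \<in> P" if "n \<le> m" for f n
    using residue_eq_zero_iff[OF S, of "fps_nth (universal_arc f) n"] universal_arc_in_jet[OF that, of f]
    by (simp add: jet_ring_eq eq)
  then show ?thesis using S by (auto simp: jets_in_def jet_ring_eq)
qed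

lemma D_set_eq_jets:
  "D_set = Cont 2 xvar \<inter> Cont 3 yvar \<inter>
     {P \<in> Spec arc_ring. jet_proj 7 P \<in> jets_in 7 (zeros plane_ring {cusp})}"
proof -
  interpret u: type_ring_hom universal_arc by (rule type_ring_hom_universal_arc)
  have "P \<in> Cont_ge 8 cusp \<longleftrightarrow> jet_proj 7 P \<in> jets_in 7 (zeros plane_ring {cusp})"
    if P: "P \<in> Spec arc_ring" for P
  proof -
    have lt: "n < 8 \<longleftrightarrow> n \<le> 7" for n :: nat by linarith
    have "(\<forall>n\<le>7. fps_nth (universal_arc cusp) n \<in> P) \<longleftrightarrow>
        (\<forall>f \<in> \<Inter>(zeros plane_ring {cusp}). \<forall>n\<le>7. fps_nth (universal_arc f) n \<in> P)"
    proof (intro iffI ballI allI impI)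
      fix f n assume *: "\<forall>n\<le>7. fps_nth (universal_arc cusp) n \<in> P" "f \<in> \<Inter>(zeros plane_ring {cusp})" "n \<le> (7::nat)"
      obtain g where "f = cusp * g" using ideal_of_cusp[OF *(2)] by (rule dvdE)
      then show "fps_nth (universal_arc f) n \<in> P"
        using * Spec_arcD(5)[OF P] by (auto simp: u.hom_mult fps_mult_nth intro!: Spec_arc_sum[OF P])
    qed (use cusp_in_ideal in blast)
    then show ?thesis
      using P by (simp add: Cont_ge_def arc_ord_ge_iff jet_proj_in_jets_in_iff lt)
  qed
  then show ?thesis unfolding D_set_eq_Cont_ge by (auto simp: Cont_def)
qed


section \<open>A chart of the divisor\<close>

text \<open>The chart is \<open>\<complex>[z][u]\<close>, represented by the same type as \<open>\<complex>[x][y]\<close>: \<open>xvar\<close> stands for \<open>z\<close> and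
  \<open>yvar\<close> for \<open>u\<close>.  The map \<open>chart_eval\<close> writes functions on the plane in the chart, and
  \<open>chart_embed\<close> below identifies the chart with a subring of the function field.\<close>

definition chart_eval :: "plane_poly \<Rightarrow> plane_poly" where
  "chart_eval = plane_eval pconst (yvar ^ 2 + yvar ^ 4 * xvar) (yvar ^ 3 + yvar ^ 5 * xvar)"

interpretation chart_eval: type_ring_hom chart_eval
  unfolding chart_eval_def by (rule type_ring_hom_plane_eval[OF type_ring_hom_pconst])

lemma chart_eval_gens:
  "chart_eval (pconst c) = pconst c" "chart_eval xvar = yvar ^ 2 + yvar ^ 4 * xvar"
  "chart_eval yvar = yvar ^ 3 + yvar ^ 5 * xvar"
  unfolding chart_eval_def by (rule plane_eval_gens[OF type_ring_hom_pconst])+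

definition chart_u :: plane_fun where
  "chart_u = to_fract yvar / to_fract xvar"

definition chart_z :: plane_fun where
  "chart_z = (to_fract xvar - chart_u ^ 2) / chart_u ^ 4"

definition chart_embed :: "plane_poly \<Rightarrow> plane_fun" where
  "chart_embed = plane_eval (\<lambda>c. to_fract (pconst c)) chart_z chart_u"

lemma type_ring_hom_fract_const: "type_ring_hom (\<lambda>c. to_fract (pconst c))"
  by (rule type_ring_hom_comp[OF type_ring_hom_pconst type_ring_hom_to_fract])

interpretation chart_embed: type_ring_hom chart_embed
  unfolding chart_embed_def by (rule type_ring_hom_plane_eval[OF type_ring_hom_fract_const])

lemma chart_embed_gens:
  "chart_embed (pconst c) = to_fract (pconst c)" "chart_embed xvar = chart_z" "chart_embed yvar = chart_u"
  unfolding chart_embed_def by (rule plane_eval_gens[OF type_ring_hom_fract_const])+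

lemma xvar_nonzero [simp]: "xvar \<noteq> 0" and yvar_nonzero [simp]: "yvar \<noteq> 0"
  by (simp_all add: xvar_def yvar_def)

lemma chart_u_nonzero: "chart_u \<noteq> 0"
  by (simp add: chart_u_def)

lemma chart_embed_eval: "chart_embed (chart_eval f) = to_fract f"
proof (rule plane_hom_eqI[OF type_ring_hom_comp[OF chart_eval.type_ring_hom_axioms chart_embed.type_ring_hom_axioms]
      type_ring_hom_to_fract])
  have x: "chart_u ^ 2 + chart_u ^ 4 * chart_z = to_fract xvar"
    using chart_u_nonzero by (simp add: chart_z_def)
  then show "chart_embed (chart_eval xvar) = to_fract xvar"
    by (simp add: chart_eval_gens chart_embed.hom_simps chart_embed_gens)
  have "chart_u ^ 3 + chart_u ^ 5 * chart_z = chart_u * (chart_u ^ 2 + chart_u ^ 4 * chart_z)"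
    by (simp add: eval_nat_numeral algebra_simps)
  also have "\<dots> = to_fract yvar"
    unfolding x by (simp add: chart_u_def)
  finally show "chart_embed (chart_eval yvar) = to_fract yvar"
    by (simp add: chart_eval_gens chart_embed.hom_simps chart_embed_gens)
qed (simp add: chart_eval_gens chart_embed_gens)

text \<open>The chart is an isomorphism away from \<open>x y = 0\<close>: both \<open>u = y / x\<close> and \<open>z\<close> have a power of \<open>x y\<close> as a
  denominator.  This makes \<open>chart_embed\<close> injective.\<close>

lemma chart_localization:
  "\<exists>p N. chart_eval p = chart_eval (xvar * yvar) ^ N * h"
proof (induction h rule: plane_induct)
  case (const c)
  show ?case by (rule exI[of _ "pconst c"], rule exI[of _ 0]) (simp add: chart_eval_gens)
next
  case x
  have "chart_eval (xvar ^ 4 * (xvar ^ 5 - xvar ^ 2 * yvar ^ 2)) = chart_eval (xvar * yvar) ^ 4 * xvar"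
    by (simp add: chart_eval.hom_simps chart_eval_gens eval_nat_numeral algebra_simps)
  then show ?case by blast
next
  case y
  have "chart_eval (yvar ^ 2) = chart_eval (xvar * yvar) ^ 1 * yvar"
    by (simp add: chart_eval.hom_simps chart_eval_gens eval_nat_numeral algebra_simps)
  then show ?case by blast
next
  case (add f g)
  then obtain p m q n where "chart_eval p = chart_eval (xvar * yvar) ^ m * f"
    "chart_eval q = chart_eval (xvar * yvar) ^ n * g" by blast
  moreover define A where "A = xvar * yvar"
  ultimately have "chart_eval (A ^ n * p + A ^ m * q) = chart_eval A ^ (m + n) * (f + g)"
    by (simp add: chart_eval.hom_simps power_add algebra_simps)
  then show ?case unfolding A_def by blast
next
  case (mult f g)
  then obtain p m q n where "chart_eval p = chart_eval (xvar * yvar) ^ m * f"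
    "chart_eval q = chart_eval (xvar * yvar) ^ n * g" by blast
  then have "chart_eval (p * q) = chart_eval (xvar * yvar) ^ (m + n) * (f * g)"
    by (simp add: chart_eval.hom_mult[of p] power_add mult_ac)
  then show ?case by blast
qed

lemma chart_eval_eq_0_iff: "chart_eval f = 0 \<longleftrightarrow> f = 0"
  by (metis chart_embed_eval chart_embed.hom_zero chart_eval.hom_zero to_fract_eq_0_iff)

lemma chart_embed_eq_0_iff: "chart_embed h = 0 \<longleftrightarrow> h = 0"
proof
  assume h: "chart_embed h = 0"
  obtain p N where p: "chart_eval p = chart_eval (xvar * yvar) ^ N * h" using chart_localization by blast
  then have "to_fract p = 0" using h by (metis chart_embed_eval chart_embed.hom_mult mult_zero_right)
  then have "chart_eval p = 0" by (simp add: chart_eval.hom_zero)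
  then show "h = 0" using p by (simp add: chart_eval_eq_0_iff)
qed (simp add: chart_embed.hom_zero)

lemma chart_embed_inject: "chart_embed h = chart_embed k \<longleftrightarrow> h = k"
  using chart_embed_eq_0_iff[of "h - k"] by (simp add: chart_embed.hom_diff)

lemma yvar_dvd_iff: "yvar dvd h \<longleftrightarrow> coeff h 0 = 0"
  using poly_eq_0_iff_dvd[of h 0] by (simp add: yvar_def poly_0_coeff_0)

lemma yvar_dvd_mult_iff: "yvar dvd h * k \<longleftrightarrow> yvar dvd h \<or> yvar dvd k"
  by (simp add: yvar_dvd_iff coeff_mult_0)

definition chart_ord :: "plane_poly \<Rightarrow> nat" where
  "chart_ord f = Polynomial.order 0 (chart_eval f)"

lemma order_0_decomp:
  assumes "h \<noteq> 0"
  obtains k where "h = yvar ^ Polynomial.order 0 h * k" "\<not> yvar dvd k"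
  using order_decomp[OF assms, of 0] by (auto simp: yvar_def)

definition chart_ring :: "plane_fun set" where
  "chart_ring = range chart_embed"

definition chart_divisor :: "plane_fun set" where
  "chart_divisor = chart_embed ` {h. yvar dvd h}"

lemma fun_field_eq: "fun_field \<lparr> carrier := B \<rparr> = type_ring B"
  by (simp add: fun_field_def type_ring_def)

lemma fun_field_simps [simp]:
  "x \<otimes>\<^bsub>fun_field\<^esub> y = x * y" "x \<oplus>\<^bsub>fun_field\<^esub> y = x + y" "\<one>\<^bsub>fun_field\<^esub> = 1" "carrier fun_field = UNIV"
  by (simp_all add: fun_field_def ring_of_type_algebra_def)

lemma fun_field_minus [simp]: "\<ominus>\<^bsub>fun_field\<^esub> x = - x"
  using type_subring.minus_type_ring[OF type_subring_UNIV, of x] by (simp add: type_ring_UNIV fun_field_def)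

interpretation chart: type_subring chart_ring
proof
  show "1 \<in> chart_ring" unfolding chart_ring_def by (metis chart_embed.hom_one rangeI)
  show "x + y \<in> chart_ring" "x * y \<in> chart_ring" if "x \<in> chart_ring" "y \<in> chart_ring" for x y
    using that unfolding chart_ring_def by (auto simp flip: chart_embed.hom_add chart_embed.hom_mult)
  show "- x \<in> chart_ring" if "x \<in> chart_ring" for x
    using that unfolding chart_ring_def by (auto simp flip: chart_embed.hom_uminus)
qed

lemma chart_ring_generated:
  "chart_ring = generate_ring fun_field (range (\<lambda>c. to_fract [:[:c:]:]) \<union> {chart_z, chart_u})" (is "_ = ?R")
proof (intro equalityI subsetI)
  fix \<phi> assume "\<phi> \<in> chart_ring"
  then obtain h where "\<phi> = chart_embed h" by (auto simp: chart_ring_def)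
  moreover have "chart_embed h \<in> ?R"
  proof (induction h rule: plane_induct)
    case (const c)
    have "chart_embed (pconst c) = to_fract [:[:c:]:]"
      unfolding chart_embed_gens by (simp add: pconst_def)
    then show ?case by (auto intro!: generate_ring.incl)
  next
    case (add f g)
    then show ?case using generate_ring.eng_add[OF add] by (simp add: chart_embed.hom_add)
  next
    case (mult f g)
    then show ?case using generate_ring.eng_mult[OF mult] by (simp add: chart_embed.hom_mult)
  qed (auto simp: chart_embed_gens intro: generate_ring.incl)
  ultimately show "\<phi> \<in> ?R" by simp
next
  fix \<phi> assume "\<phi> \<in> ?R"
  then show "\<phi> \<in> chart_ring"
  proof induction
    case (incl \<phi>)
    have "to_fract [:[:c:]:] = chart_embed (pconst c)" for c
      unfolding chart_embed_gens by (simp add: pconst_def)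
    with incl have "\<phi> \<in> chart_embed ` (range pconst \<union> {xvar, yvar})"
      by (auto simp: image_Un image_image chart_embed_gens(2,3))
    then show ?case by (auto simp: chart_ring_def)
  qed (auto intro: chart.mem_intros)
qed

lemma to_fract_in_chart_ring: "to_fract f \<in> chart_ring"
  unfolding chart_ring_def by (metis chart_embed_eval rangeI)

lemma fun_eq_chart_quotient:
  obtains a b where "coprime a b" "b \<noteq> 0" "\<phi> = chart_embed a / chart_embed b"
proof -
  define f g where "f = fst (quot_of_fract \<phi>)" and "g = snd (quot_of_fract \<phi>)"
  have \<phi>: "\<phi> = to_fract f / to_fract g"
    unfolding f_def g_def by (simp flip: Fract_conv_to_fract)
  have "g \<noteq> 0" by (simp add: g_def)
  then have "chart_eval g \<noteq> 0" by (simp add: chart_eval_eq_0_iff)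
  define d where "d = gcd (chart_eval f) (chart_eval g)"
  have "d \<noteq> 0" using \<open>chart_eval g \<noteq> 0\<close> by (simp add: d_def)
  then obtain a b where ab: "chart_eval f = a * d" "chart_eval g = b * d" "coprime a b"
    using gcd_coprime_exists[of "chart_eval f" "chart_eval g", folded d_def] by blast
  have "\<phi> = chart_embed (a * d) / chart_embed (b * d)"
    unfolding \<phi> by (simp flip: chart_embed_eval ab(1,2))
  also have "\<dots> = chart_embed a / chart_embed b"
    using \<open>d \<noteq> 0\<close> by (simp add: chart_embed.hom_mult chart_embed_eq_0_iff)
  finally have "\<phi> = chart_embed a / chart_embed b" .
  moreover have "b \<noteq> 0" using ab(2) \<open>chart_eval g \<noteq> 0\<close> by auto
  ultimately show thesis using that ab(3) by blast
qed

text \<open>The coordinate ring of the chart is a unique factorization domain, hence integrally closed.\<close>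

lemma chart_integrally_closed:
  assumes p: "Polynomial.lead_coeff p = 1" "range (coeff p) \<subseteq> chart_ring" "poly p \<phi> = 0"
  shows "\<phi> \<in> chart_ring"
proof -
  obtain a b where ab: "coprime a b" "b \<noteq> 0" "\<phi> = chart_embed a / chart_embed b"
    by (rule fun_eq_chart_quotient)
  define n where "n = degree p"
  have "\<forall>i. \<exists>c. coeff p i = chart_embed c" using p(2) by (auto simp: chart_ring_def)
  then obtain c where c: "\<And>i. coeff p i = chart_embed (c i)" by metis
  have b0: "chart_embed b \<noteq> 0" using ab by (simp add: chart_embed_eq_0_iff)
  have "chart_embed (\<Sum>i\<le>n. c i * a ^ i * b ^ (n - i)) =
      (\<Sum>i\<le>n. coeff p i * \<phi> ^ i) * chart_embed b ^ n"
    unfolding sum_distrib_right chart_embed.hom_sum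
  proof (rule sum.cong)
    fix i assume "i \<in> {..n}"
    then have "chart_embed b ^ n = chart_embed b ^ i * chart_embed b ^ (n - i)" by (simp flip: power_add)
    then show "chart_embed (c i * a ^ i * b ^ (n - i)) = coeff p i * \<phi> ^ i * chart_embed b ^ n"
      using b0 by (simp add: chart_embed.hom_simps c ab(3) power_divide)
  qed simp
  also have "\<dots> = 0" using p(3) by (simp add: poly_altdef n_def)
  finally have 0: "(\<Sum>i\<le>n. c i * a ^ i * b ^ (n - i)) = 0" by (simp add: chart_embed_eq_0_iff)
  have "c n = 1"
    using c[of n] p(1) by (metis n_def chart_embed.hom_one chart_embed_inject)
  moreover have "{..n} = insert n {..<n}" by auto
  ultimately have "a ^ n = - (\<Sum>i<n. c i * a ^ i * b ^ (n - i))"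
    using 0 by (simp add: eq_neg_iff_add_eq_0)
  also have "b dvd \<dots>"
    unfolding dvd_minus_iff by (rule dvd_sum) (auto intro!: dvd_mult)
  finally have "b dvd a ^ n" .
  then have "is_unit b" using ab(1) by (metis coprime_absorb_right coprime_commute coprime_power_right_iff)
  then obtain d where "1 = b * d" by (elim dvdE)
  then have "chart_embed b * chart_embed d = 1"
    by (metis chart_embed.hom_mult chart_embed.hom_one)
  then have "\<phi> = chart_embed (a * d)"
    using b0 by (simp add: ab(3) chart_embed.hom_mult field_simps)
  then show ?thesis by (simp add: chart_ring_def)
qed

lemma normal_chart_chart_ring: "normal_chart chart_ring"
  unfolding normal_chart_def
proof (intro conjI allI impI)
  show "\<exists>G. finite G \<and> chart_ring = generate_ring fun_field (range (\<lambda>c. to_fract [:[:c:]:]) \<union> G)"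
    using chart_ring_generated by (intro exI[of _ "{chart_z, chart_u}"]) simp
  show "range to_fract \<subseteq> chart_ring" using to_fract_in_chart_ring by auto
qed (use chart_integrally_closed in blast)

lemma chart_divisor_iff: "chart_embed h \<in> chart_divisor \<longleftrightarrow> yvar dvd h"
  by (auto simp: chart_divisor_def chart_embed_inject image_iff)

text \<open>A nonzero prime inside \<open>(u)\<close> contains some \<open>u\<^sup>n k\<close> with \<open>k\<close> prime to \<open>u\<close>, hence \<open>u\<close>.\<close>

lemma height_one_chart_divisor: "height_one_prime chart_ring chart_divisor"
  unfolding height_one_prime_def fun_field_eq
proof (intro conjI ballI impI)
  show P: "chart_divisor \<in> Spec (type_ring chart_ring)"
    unfolding chart.Spec_type_ring_iff
  proof (intro conjI ballI impI)
    show "chart_divisor \<subseteq> chart_ring" by (auto simp: chart_divisor_def chart_ring_def)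
    show "0 \<in> chart_divisor" using chart_divisor_iff[of 0] by (simp add: chart_embed.hom_zero)
    show "1 \<notin> chart_divisor"
      using chart_divisor_iff[of 1] by (simp add: chart_embed.hom_one yvar_dvd_iff)
    show "x + y \<in> chart_divisor" if "x \<in> chart_divisor" "y \<in> chart_divisor" for x y
      using that by (auto simp: chart_divisor_def simp flip: chart_embed.hom_add)
    show "s * x \<in> chart_divisor" if "s \<in> chart_ring" "x \<in> chart_divisor" for s x
      using that by (auto simp: chart_divisor_def chart_ring_def simp flip: chart_embed.hom_mult)
    show "x \<in> chart_divisor \<or> y \<in> chart_divisor"
      if "x \<in> chart_ring" "y \<in> chart_ring" "x * y \<in> chart_divisor" for x y
      using that by (auto simp: chart_ring_def chart_divisor_iff yvar_dvd_mult_iff simp flip: chart_embed.hom_mult)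
  qed
  have "chart_u \<in> chart_divisor" using chart_divisor_iff[of yvar] by (simp add: chart_embed_gens)
  then show "chart_divisor \<noteq> {0}" using chart_u_nonzero by blast
  fix Q assume Q: "Q \<in> Spec (type_ring chart_ring)" "Q \<subseteq> chart_divisor"
  note QD = chart.Spec_type_ringD[OF Q(1)]
  show "Q = {0} \<or> Q = chart_divisor"
  proof (cases "Q = {0}")
    case False
    then obtain \<phi> where "\<phi> \<in> Q" "\<phi> \<noteq> 0" using QD(2) by blast
    then obtain h where h: "chart_embed h \<in> Q" "h \<noteq> 0"
      using QD(1) by (auto simp: chart_ring_def chart_embed_eq_0_iff subset_iff)
    obtain k where k: "h = yvar ^ Polynomial.order 0 h * k" "\<not> yvar dvd k" using h(2) by (rule order_0_decomp)
    have m: "chart_embed g \<in> chart_ring" for g by (simp add: chart_ring_def)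
    have "chart_embed (yvar ^ Polynomial.order 0 h) * chart_embed k \<in> Q"
      using h(1) k(1) by (metis chart_embed.hom_mult)
    then have "chart_embed (yvar ^ Polynomial.order 0 h) \<in> Q \<or> chart_embed k \<in> Q"
      using QD(8)[OF m m] by blast
    moreover have "chart_embed k \<notin> Q" using Q(2) k(2) chart_divisor_iff by blast
    ultimately have "chart_u \<in> Q"
      using QD(9)[OF m, of yvar] by (simp add: chart_embed.hom_power chart_embed_gens)
    then have "chart_embed (yvar * g) \<in> Q" for g
      using QD(7)[OF m, of chart_u g] by (simp add: chart_embed.hom_mult chart_embed_gens)
    then have "chart_divisor \<subseteq> Q" by (auto simp: chart_divisor_def dvd_def)
    then show ?thesis using Q(2) by blast
  qed simp
qed

lemma localized_chart_ring:
  "\<not> yvar dvd s \<Longrightarrow> chart_embed b / chart_embed s \<in> localized chart_ring chart_divisor chart_ring"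
  unfolding localized_def using chart_divisor_iff by (auto simp: chart_ring_def)

text \<open>Writing numerator and denominator in the chart as a power of \<open>u\<close> times an element prime to \<open>u\<close>
  exhibits every function as a power of the uniformizer \<open>u\<close> times a unit of the local ring.\<close>

lemma divisorial_chart_ord:
  assumes w: "\<And>f. f \<noteq> 0 \<Longrightarrow> w f = int (chart_ord f)"
  shows "divisorial_valuation (frac_val w)"
  unfolding divisorial_valuation_def
proof (rule exI[of _ chart_ring], rule exI[of _ chart_divisor], rule exI[of _ 1], rule exI[of _ chart_u],
    intro conjI allI impI)
  show "normal_chart chart_ring" by (rule normal_chart_chart_ring)
  show "height_one_prime chart_ring chart_divisor" by (rule height_one_chart_divisor)
  show "0 < (1 :: nat)" by simp
  show "localized chart_ring chart_divisor chart_divisor = (*) chart_u ` localized chart_ring chart_divisor chart_ring"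
  proof (intro equalityI subsetI)
    fix \<phi> assume "\<phi> \<in> localized chart_ring chart_divisor chart_divisor"
    then obtain g s where "\<phi> = chart_embed (yvar * g) / s" "s \<in> chart_ring - chart_divisor"
      unfolding localized_def chart_divisor_def by (auto simp: dvd_def)
    then have "\<phi> = chart_u * (chart_embed g / s)" "chart_embed g / s \<in> localized chart_ring chart_divisor chart_ring"
      unfolding localized_def by (auto simp: chart_embed.hom_mult chart_embed_gens chart_ring_def)
    then show "\<phi> \<in> (*) chart_u ` localized chart_ring chart_divisor chart_ring" by blast
  next
    fix \<phi> assume "\<phi> \<in> (*) chart_u ` localized chart_ring chart_divisor chart_ring"
    then obtain g s where "\<phi> = chart_u * (chart_embed g / s)" and s: "s \<in> chart_ring - chart_divisor"
      unfolding localized_def chart_ring_def by auto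
    then have "\<phi> = chart_embed (yvar * g) / s" by (simp add: chart_embed.hom_mult chart_embed_gens)
    moreover have "chart_embed (yvar * g) \<in> chart_divisor" by (simp add: chart_divisor_iff)
    ultimately show "\<phi> \<in> localized chart_ring chart_divisor chart_divisor"
      using s unfolding localized_def by blast
  qed
  fix \<phi> :: plane_fun assume "\<phi> \<noteq> 0"
  define f g where "f = fst (quot_of_fract \<phi>)" and "g = snd (quot_of_fract \<phi>)"
  have \<phi>: "\<phi> = to_fract f / to_fract g"
    unfolding f_def g_def by (simp flip: Fract_conv_to_fract)
  have g0: "g \<noteq> 0" by (simp add: g_def)
  have f0: "f \<noteq> 0" using \<open>\<phi> \<noteq> 0\<close> \<phi> by auto
  obtain a where a: "chart_eval f = yvar ^ chart_ord f * a" "\<not> yvar dvd a"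
    using order_0_decomp[of "chart_eval f"] f0 unfolding chart_ord_def by (auto simp: chart_eval_eq_0_iff)
  obtain b where b: "chart_eval g = yvar ^ chart_ord g * b" "\<not> yvar dvd b"
    using order_0_decomp[of "chart_eval g"] g0 unfolding chart_ord_def by (auto simp: chart_eval_eq_0_iff)
  let ?n = "int (chart_ord f) - int (chart_ord g)"
  let ?u = "chart_embed a / chart_embed b"
  have 1: "?u \<in> localized chart_ring chart_divisor chart_ring"
    using b(2) by (rule localized_chart_ring)
  have 2: "inverse ?u \<in> localized chart_ring chart_divisor chart_ring"
    using localized_chart_ring[OF a(2)] by simp
  have "\<phi> = chart_embed (chart_eval f) / chart_embed (chart_eval g)"
    by (simp add: \<phi> chart_embed_eval)
  also have "\<dots> = (chart_u ^ chart_ord f / chart_u ^ chart_ord g) * ?u"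
    by (simp add: a(1) b(1) chart_embed.hom_simps chart_embed_gens)
  also have "chart_u ^ chart_ord f / chart_u ^ chart_ord g = chart_u powi ?n"
    using chart_u_nonzero by (simp add: power_int_diff)
  finally have 3: "\<phi> = chart_u powi ?n * ?u" .
  have 4: "frac_val w \<phi> = int 1 * ?n"
    using w f0 g0 by (simp add: frac_val_def f_def[symmetric] g_def[symmetric])
  show "\<exists>n u. u \<in> localized chart_ring chart_divisor chart_ring \<and>
      inverse u \<in> localized chart_ring chart_divisor chart_ring \<and>
      \<phi> = chart_u powi n * u \<and> frac_val w \<phi> = int 1 * n"
    using 1 2 3 4 by blast
qed


section \<open>The valuation of the generic arc\<close>

type_synonym arc_field = "laurent_poly fract"

definition field_const :: "complex \<Rightarrow> arc_field" where
  "field_const c = to_fract (laurent_const c)"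

definition field_par :: arc_field where
  "field_par = to_fract par"

definition D_arc :: "complex \<Rightarrow> arc_poly \<Rightarrow> arc_field" where
  "D_arc c r = to_fract (D_eval c r)"

interpretation field_const: type_ring_hom field_const
  unfolding field_const_def[abs_def]
  by (rule type_ring_hom_comp[OF type_ring_hom_laurent_const type_ring_hom_to_fract])

lemma type_ring_hom_D_arc: "type_ring_hom (D_arc c)"
  unfolding D_arc_def[abs_def] by (rule type_ring_hom_comp[OF type_ring_hom_D_eval type_ring_hom_to_fract])

interpretation D_arc: type_ring_hom "D_arc c"
  by (rule type_ring_hom_D_arc)

lemma field_const_eq_0_iff: "field_const c = 0 \<longleftrightarrow> c = 0"
proof
  assume "field_const c = 0"
  then have "laurent_const c = 0" by (simp add: field_const_def)
  then have "lookup (laurent_const c) 0 = 0" by simp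
  then show "c = 0" by (simp add: laurent_const_def)
qed (simp add: field_const.hom_zero)

lemma inj_field_const: "inj field_const"
  by (rule injI) (metis field_const.hom_diff field_const_eq_0_iff right_minus_eq)

lemma field_par_nonzero: "field_par \<noteq> 0"
  by (simp add: field_par_def par_nonzero)

lemma D_arc_kernel: "D_arc c r = 0 \<longleftrightarrow> r \<in> D_point"
  by (simp add: D_arc_def D_eval_kernel)

lemma D_arc_kernel_set: "{r. D_arc c r = 0} = D_point"
  by (simp add: D_arc_kernel)

lemma D_arc_gens:
  "D_arc c (arc_const a) = field_const a"
  "D_arc c (arc_var (Ca 2)) = field_par ^ 2"
  "D_arc c (arc_var (Cb 3)) = field_par ^ 3"
  "x \<notin> contact_coords \<Longrightarrow> D_arc c (arc_var x) = 0"
  "D_arc c (arc_var (Ca 4)) = D_arc 0 (arc_var (Ca 4)) + field_const c"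
  "x \<noteq> Ca 4 \<Longrightarrow> D_arc c (arc_var x) = D_arc 0 (arc_var x)"
proof -
  interpret f: type_ring_hom "to_fract :: laurent_poly \<Rightarrow> arc_field" by (rule type_ring_hom_to_fract)
  show "D_arc c (arc_const a) = field_const a" "D_arc c (arc_var (Ca 2)) = field_par ^ 2"
    "D_arc c (arc_var (Cb 3)) = field_par ^ 3"
    by (simp_all add: D_arc_def D_eval_gens field_const_def field_par_def f.hom_power)
  show "x \<notin> contact_coords \<Longrightarrow> D_arc c (arc_var x) = 0"
    by (cases x) (auto simp: D_arc_def D_eval_gens)
  have "laurent_const 0 = 0" by (simp add: laurent_const_def)
  then show "D_arc c (arc_var (Ca 4)) = D_arc 0 (arc_var (Ca 4)) + field_const c"
    by (simp add: D_arc_def D_eval_gens field_const_def)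
  show "x \<noteq> Ca 4 \<Longrightarrow> D_arc c (arc_var x) = D_arc 0 (arc_var x)"
    by (cases x) (auto simp: D_arc_def D_eval_gens)
qed

text \<open>The coefficient of \<open>t\<^sup>8\<close> in the equation of the cusp is linear in \<open>a\<^sub>4\<close>, with coefficient
  \<open>3 a\<^sub>2\<^sup>2\<close>.\<close>

definition cusp_coeff :: arc_poly where
  "cusp_coeff = fps_nth (universal_arc cusp) 8"

lemma D_arc_cusp_coeff: "D_arc c cusp_coeff = D_arc 0 cusp_coeff + 3 * field_par ^ 4 * field_const c"
proof -
  define F where "F c = Abs_fps (\<lambda>k. D_arc c (arc_var (Ca (k + 2))))" for c
  define G where "G c = Abs_fps (\<lambda>k. D_arc c (arc_var (Cb (k + 3))))" for c
  have "D_arc c cusp_coeff = fps_nth (fps_X ^ 6 * (F c ^ 3 - G c ^ 2)) 8" for c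
    unfolding cusp_coeff_def hom_universal_arc[OF type_ring_hom_D_arc] F_def G_def
    by (subst arc_of_contact(3)[OF type_ring_hom_D_arc]) (simp_all add: D_arc_gens(1-4))
  then have *: "D_arc c cusp_coeff = fps_nth (F c ^ 3 - G c ^ 2) 2" for c
    by (simp add: fps_X_power_mult_nth del: fps_sub_nth)
  have n0: "fps_nth (F c) 0 = field_par ^ 2" for c
    by (simp only: F_def fps_nth_Abs_fps add_0 D_arc_gens(2))
  have n: "fps_nth (F c) 2 = fps_nth (F 0) 2 + field_const c"
    "fps_nth (F c) 1 = fps_nth (F 0) 1" "fps_nth (G c) i = fps_nth (G 0) i" for c i
    using D_arc_gens(5)[of c] D_arc_gens(6)[of _ c] by (simp_all add: F_def G_def)
  show ?thesis
    unfolding *[of c] *[of 0] fps_cusp_nth n0 n(1)[of c] n(2)[of c] n(3)[of c] by (simp add: algebra_simps flip: power_mult)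
qed

text \<open>A nonzero polynomial has finitely many roots, but the constants are infinitely many.\<close>

lemma poly_eq_0_of_line:
  assumes "b \<noteq> 0" "\<And>c. poly p (a + b * field_const c) = 0"
  shows "p = 0"
proof (rule ccontr)
  assume "p \<noteq> 0"
  then have "finite {x. poly p x = 0}" by (rule poly_roots_finite)
  moreover have "range (\<lambda>c. a + b * field_const c) \<subseteq> {x. poly p x = 0}" using assms(2) by auto
  moreover have "inj (\<lambda>c. a + b * field_const c)"
    using assms(1) inj_field_const by (auto simp: inj_def)
  ultimately have "finite (UNIV :: complex set)"
    by (metis finite_subset finite_imageD)
  then show False by (simp add: infinite_UNIV_char_0)
qed

text \<open>This will be the constant term of \<open>z\<close> along the generic arc, because \<open>z = (x\<^sup>3 - y\<^sup>2) / (x\<^sup>2 u\<^sup>4)\<close>.\<close>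

definition chart_coeff :: arc_field where
  "chart_coeff = D_arc 0 cusp_coeff / field_par ^ 8"

text \<open>A relation over the constants, multiplied by a power of \<open>a\<^sub>2\<close>, is a polynomial in the arc coordinates that
  lies in \<open>D_point\<close>.  It is then in the kernel of all translated parametrizations, which gives infinitely
  many roots.\<close>

lemma chart_coeff_transcendental:
  assumes "q \<noteq> 0"
  shows "poly_hom field_const chart_coeff q \<noteq> 0"
proof
  assume z: "poly_hom field_const chart_coeff q = 0"
  define d where "d = degree q"
  define r where "r = (\<Sum>i\<le>d. arc_const (coeff q i) * cusp_coeff ^ i * (arc_var (Ca 2) ^ 4) ^ (d - i))"
  have r: "D_arc c r = field_par ^ (8 * d) * poly_hom field_const (D_arc c cusp_coeff / field_par ^ 8) q" for c
  proof -
    have "D_arc c r = (\<Sum>i\<le>d. field_par ^ (8 * d) *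
        (field_const (coeff q i) * (D_arc c cusp_coeff / field_par ^ 8) ^ i))"
      unfolding r_def D_arc.hom_sum
    proof (rule sum.cong)
      fix i assume "i \<in> {..d}"
      then have "field_par ^ (8 * d) = (field_par ^ 8) ^ (d - i) * (field_par ^ 8) ^ i"
        by (simp flip: power_mult power_add add: algebra_simps)
      moreover have "((field_par ^ 2) ^ 4) = field_par ^ 8" by (simp flip: power_mult)
      ultimately show "D_arc c (arc_const (coeff q i) * cusp_coeff ^ i * (arc_var (Ca 2) ^ 4) ^ (d - i)) =
          field_par ^ (8 * d) * (field_const (coeff q i) * (D_arc c cusp_coeff / field_par ^ 8) ^ i)"
        using field_par_nonzero by (simp add: D_arc.hom_simps D_arc_gens(1-4) power_divide)
    qed simp
    then show ?thesis by (simp add: poly_hom_def d_def sum_distrib_left)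
  qed
  have "D_arc 0 r = 0" using z by (simp add: r chart_coeff_def)
  then have "D_arc c r = 0" for c by (simp add: D_arc_kernel)
  then have 0: "poly_hom field_const (D_arc c cusp_coeff / field_par ^ 8) q = 0" for c
    using field_par_nonzero by (simp add: r)
  have deg: "degree (map_poly field_const q) = degree q"
    using assms by (intro degree_map_poly) (simp add: field_const_eq_0_iff)
  have "poly_hom field_const x q = poly (map_poly field_const q) x" for x
    by (simp add: poly_hom_def poly_altdef deg coeff_map_poly field_const.hom_zero)
  then have "poly (map_poly field_const q) (chart_coeff + (3 * field_par ^ 4 / field_par ^ 8) * field_const c) = 0" for c
    using 0[of c] by (simp add: D_arc_cusp_coeff[of c] chart_coeff_def add_divide_distrib)
  moreover have "3 * field_par ^ 4 / field_par ^ 8 \<noteq> 0"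
  proof -
    have "field_const 3 \<noteq> 0" by (simp add: field_const_eq_0_iff)
    then show ?thesis using field_par_nonzero by (simp add: field_const.hom_numeral)
  qed
  ultimately have "map_poly field_const q = 0" by (intro poly_eq_0_of_line)
  then show False
    using assms deg by (metis field_const_eq_0_iff coeff_map_poly field_const.hom_zero leading_coeff_0_iff coeff_0)
qed

lemma poly_hom_commute:
  assumes h: "type_ring_hom h" and c: "type_ring_hom c"
  shows "h (poly_hom c x p) = poly_hom (\<lambda>a. h (c a)) (h x) p"
proof -
  interpret h: type_ring_hom h by fact
  show ?thesis by (simp add: poly_hom_def h.hom_simps)
qed

lemma type_ring_hom_fps_nth_0: "type_ring_hom (\<lambda>F :: 'a::comm_ring_1 fps. fps_nth F 0)"
  by unfold_locales (simp_all add: fps_mult_nth)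

text \<open>The generic arc of \<open>D\<close> lifts to the chart: its lift has \<open>u\<close> of order one, and its \<open>z\<close> starts
  with a transcendental constant.  So the order along the arc is the order along \<open>u = 0\<close>.\<close>

lemma subdegree_generic_arc:
  assumes "f \<noteq> 0"
  shows "arc_of (D_arc 0) f \<noteq> 0" "subdegree (arc_of (D_arc 0) f) = chart_ord f"
proof -
  let ?h = "D_arc 0"
  let ?t = "fps_X :: arc_field fps"
  define F where "F = Abs_fps (\<lambda>k. ?h (arc_var (Ca (k + 2))))"
  define G where "G = Abs_fps (\<lambda>k. ?h (arc_var (Cb (k + 3))))"
  have arc: "arc_of ?h xvar = ?t ^ 2 * F" "arc_of ?h yvar = ?t ^ 3 * G"
    "arc_of ?h cusp = ?t ^ 6 * (F ^ 3 - G ^ 2)"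
    unfolding F_def G_def by (rule arc_of_contact[OF type_ring_hom_D_arc]; simp add: D_arc_gens(1-4))+
  define C where "C = fps_shift 8 (arc_of ?h cusp)"
  have low: "fps_nth (arc_of ?h cusp) n = 0" if "n < 8" for n
    using cusp_coeffs_below_8[OF D_ideal_prime] eqns_in_D_ideal that
    by (simp add: D_arc_kernel D_point_eq flip: hom_universal_arc[OF type_ring_hom_D_arc])
  have C8: "arc_of ?h cusp = ?t ^ 8 * C"
    using low by (auto simp: fps_eq_iff fps_X_power_mult_nth C_def)
  have FG: "F ^ 3 - G ^ 2 = ?t ^ 2 * C"
  proof -
    have "?t ^ 6 * (F ^ 3 - G ^ 2) = ?t ^ 6 * (?t ^ 2 * C)"
      using arc(3) C8 by (simp add: mult.assoc[symmetric] flip: power_add)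
    moreover have "?t ^ 6 \<noteq> 0" by simp
    ultimately show ?thesis by (metis mult_left_cancel)
  qed
  have F0: "fps_nth F 0 = field_par ^ 2" and G0: "fps_nth G 0 = field_par ^ 3"
    by (simp_all only: F_def G_def fps_nth_Abs_fps add_0 D_arc_gens(2,3))
  have C0: "fps_nth C 0 = ?h cusp_coeff"
    by (simp add: C_def cusp_coeff_def hom_universal_arc[OF type_ring_hom_D_arc])
  define F' where "F' = inverse F"
  define G' where "G' = inverse G"
  have FF': "F * F' = 1" and GG': "G * G' = 1"
    unfolding F'_def G'_def using F0 G0 field_par_nonzero by (auto intro!: inverse_mult_eq_1')
  \<comment> \<open>the power series of \<open>u = y / x\<close> and \<open>z = (x\<^sup>3 - y\<^sup>2) / (x\<^sup>2 u\<^sup>4)\<close>\<close>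
  define u where "u = ?t * (G * F')"
  define z where "z = C * F ^ 2 * G' ^ 4"
  let ?k = "\<lambda>c. fps_const (?h (arc_const c))"
  note k = type_ring_hom_arc_of_const[OF type_ring_hom_D_arc, of 0]
  interpret e: type_ring_hom "plane_eval ?k z u" by (rule type_ring_hom_plane_eval[OF k])
  have x: "u ^ 2 + u ^ 4 * z = ?t ^ 2 * F"
  proof -
    have "u ^ 2 + u ^ 4 * z = ?t ^ 2 * F' ^ 2 * (G ^ 2 + ?t ^ 2 * C * (G * G') ^ 4 * (F * F') ^ 2)"
      unfolding u_def z_def by (simp add: power_mult_distrib algebra_simps eval_nat_numeral)
    also have "\<dots> = ?t ^ 2 * F' ^ 2 * (F ^ 3)"
      unfolding FF' GG' power_one mult_1_right FG[symmetric] by simp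
    also have "\<dots> = ?t ^ 2 * F * (F * F') ^ 2"
      by (simp add: power_mult_distrib algebra_simps eval_nat_numeral)
    finally show ?thesis by (simp add: FF')
  qed
  have y: "u ^ 3 + u ^ 5 * z = ?t ^ 3 * G"
  proof -
    have "u ^ 3 + u ^ 5 * z = u * (u ^ 2 + u ^ 4 * z)" by (simp add: algebra_simps eval_nat_numeral)
    also have "\<dots> = u * (?t ^ 2 * F)" by (simp only: x)
    also have "\<dots> = ?t ^ 3 * G * (F * F')" by (simp add: u_def algebra_simps eval_nat_numeral)
    finally show ?thesis by (simp add: FF')
  qed
  have lift: "arc_of ?h f = plane_eval ?k z u (chart_eval f)" for f
    by (rule plane_hom_eqI[OF type_ring_hom_arc_of[OF type_ring_hom_D_arc]
          type_ring_hom_comp[OF chart_eval.type_ring_hom_axioms e.type_ring_hom_axioms]])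
       (simp_all add: chart_eval_gens e.hom_simps plane_eval_gens[OF k] arc_of_gens[OF type_ring_hom_D_arc] x y
          flip: arc(1,2)[unfolded arc_of_gens[OF type_ring_hom_D_arc]])
  obtain g where g: "chart_eval f = yvar ^ chart_ord f * g" "\<not> yvar dvd g"
    using order_0_decomp[of "chart_eval f"] assms unfolding chart_ord_def by (auto simp: chart_eval_eq_0_iff)
  define g0 where "g0 = coeff g 0"
  obtain g' where g': "g = pCons g0 g'" unfolding g0_def by (cases g) auto
  have g0: "g0 \<noteq> 0" using g(2) by (simp add: g0_def yvar_dvd_iff)
  define W where "W = (G * F') ^ chart_ord f * plane_eval ?k z u g"
  have W: "arc_of ?h f = ?t ^ chart_ord f * W"
  proof -
    have "arc_of ?h f = u ^ chart_ord f * plane_eval ?k z u g"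
      unfolding lift g(1) e.hom_mult e.hom_power plane_eval_gens[OF k] ..
    also have "u ^ chart_ord f = ?t ^ chart_ord f * (G * F') ^ chart_ord f"
      by (simp only: u_def power_mult_distrib)
    finally show ?thesis by (simp only: W_def mult.assoc)
  qed
  have z0: "fps_nth z 0 = chart_coeff"
    unfolding z_def G'_def using field_par_nonzero
    by (simp add: fps_power_zeroth F0 G0 C0 chart_coeff_def fps_mult_nth_0 power_inverse field_simps flip: power_mult power_add)
  have k1: "type_ring_hom (poly_hom ?k z)" by (rule type_ring_hom_poly_hom[OF k])
  have "fps_nth (plane_eval ?k z u g) 0 = fps_nth (poly_hom ?k z g0) 0"
    unfolding plane_eval_def g' poly_hom_pCons[OF k1] by (simp add: u_def fps_mult_nth_0)
  also have "\<dots> = poly_hom field_const chart_coeff g0"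
    using poly_hom_commute[OF type_ring_hom_fps_nth_0 k, of z g0] by (simp add: z0 D_arc_gens(1-4))
  finally have "fps_nth (plane_eval ?k z u g) 0 \<noteq> 0" using chart_coeff_transcendental[OF g0] by simp
  moreover have "fps_nth (G * F') 0 \<noteq> 0"
    using field_par_nonzero by (simp add: F'_def F0 G0 fps_mult_nth_0)
  ultimately have W0: "fps_nth W 0 \<noteq> 0" by (simp add: W_def fps_mult_nth_0 fps_power_zeroth)
  then have n: "fps_nth (arc_of ?h f) (chart_ord f) \<noteq> 0" unfolding W by (simp add: fps_X_power_mult_nth)
  then show "arc_of ?h f \<noteq> 0" by auto
  show "subdegree (arc_of ?h f) = chart_ord f"
    using n by (rule subdegreeI) (simp add: W fps_X_power_mult_nth)
qed

lemma arc_ord_D_point: "f \<noteq> 0 \<Longrightarrow> arc_ord D_point f = enat (chart_ord f)"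
  using arc_ord_kernel[OF type_ring_hom_D_arc, of 0 f] subdegree_generic_arc[of f]
  by (simp add: D_arc_kernel_set)

lemma fat_arc_D_point: "fat_arc D_point"
  using fat_arc_iff[OF D_point_in_Spec] arc_ord_D_point by simp

lemma divisorial_D_point: "divisorial_valuation (arc_val D_point)"
  unfolding arc_val_def by (rule divisorial_chart_ord) (simp add: arc_ord_D_point)


subsection \<open>Transcendence of the leading coefficient along the cusp\<close>

text \<open>Polynomials over a ring with a carrier are lists of coefficients, highest first.\<close>

fun list_to_poly :: "'a::comm_ring_1 list \<Rightarrow> 'a poly" where
  "list_to_poly [] = 0"
| "list_to_poly (a # p) = monom a (length p) + list_to_poly p"

lemma coeff_list_to_poly: "length p \<le> i \<Longrightarrow> coeff (list_to_poly p) i = 0"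
  by (induction p) auto

text \<open>Each translate of the parametrization has the kernel \<open>D_point\<close>, so each embeds the residue field
  into the same field.\<close>

lemma residue_field_homs:
  obtains \<iota> :: "complex \<Rightarrow> (arc_poly set \<times> arc_poly set) set \<Rightarrow> arc_field"
  where "\<And>c. \<iota> c \<in> ring_hom (residue_field arc_ring D_point) (type_ring UNIV)"
    "\<And>c r. \<iota> c (residue arc_ring D_point r) = D_arc c r"
proof -
  have "\<exists>\<iota>. \<iota> \<in> ring_hom (residue_field arc_ring D_point) (type_ring UNIV) \<and>
      (\<forall>r. \<iota> (residue arc_ring D_point r) = D_arc c r)" for c
  proof (rule residue_field_extend[OF D_point_in_Spec])
    show "field (type_ring (UNIV :: arc_field set))"
      unfolding type_ring_UNIV by (rule field_from_type_algebra)
    show "D_arc c \<in> ring_hom arc_ring (type_ring UNIV)"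
      by (rule ring_hom_memI) (simp_all add: arc_ring_eq D_arc.hom_simps)
    show "D_arc c r = \<zero>\<^bsub>type_ring UNIV\<^esub> \<longleftrightarrow> r \<in> D_point" for r
      by (simp add: D_arc_kernel)
  qed (auto simp: arc_ring_eq)
  then show thesis using that by metis
qed

text \<open>All these embeddings agree on the subfield generated by the constants and \<open>a\<^sub>2, a\<^sub>3, b\<^sub>3, b\<^sub>4\<close>,
  since only \<open>a\<^sub>4\<close> is translated.  An algebraic relation over that subfield thus yields one polynomial
  that vanishes at the images of the coefficient of \<open>t\<^sup>8\<close> under all embeddings.\<close>

lemma cusp_coeff_transcendental:
  defines "K \<equiv> residue_field arc_ring D_point" and "res \<equiv> residue arc_ring D_point"
  shows "ring.transcendental K
     (generate_field K (res ` (range arc_const \<union>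
        {arc_var (Ca 2), arc_var (Ca 3), arc_var (Cb 3), arc_var (Cb 4)}))) (res cusp_coeff)"
proof (rule ccontr)
  let ?H = "res ` (range arc_const \<union> {arc_var (Ca 2), arc_var (Ca 3), arc_var (Cb 3), arc_var (Cb 4)})"
  let ?k = "generate_field K ?H"
  interpret K: field K unfolding K_def by (rule field_residue_field[OF D_point_in_Spec])
  assume alg: "\<not> K.transcendental ?k (res cusp_coeff)"
  have res: "res r \<in> carrier K" for r
    using ring_hom_closed[OF residue_hom[OF D_point_in_Spec], of r] by (simp add: K_def res_def arc_ring_eq)
  have H: "?H \<subseteq> carrier K" using res by auto
  note sub = K.generate_field_is_subfield[OF H]
  obtain p where p: "p \<in> carrier (?k[X]\<^bsub>K\<^esub>)" "p \<noteq> []" "K.eval p (res cusp_coeff) = \<zero>\<^bsub>K\<^esub>"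
    using K.algebraicE[OF subfieldE(1)[OF sub] res] alg unfolding over_def by blast
  then have pk: "set p \<subseteq> ?k" "hd p \<noteq> \<zero>\<^bsub>K\<^esub>"
    by (auto simp: univ_poly_carrier[symmetric] polynomial_def)
  obtain \<iota> :: "complex \<Rightarrow> (arc_poly set \<times> arc_poly set) set \<Rightarrow> arc_field"
    where hom: "\<And>c. \<iota> c \<in> ring_hom K (type_ring UNIV)" and \<iota>: "\<And>c r. \<iota> c (res r) = D_arc c r"
    unfolding K_def res_def by (rule residue_field_homs) blast
  have F: "field (type_ring (UNIV :: arc_field set))"
    unfolding type_ring_UNIV by (rule field_from_type_algebra)
  interpret F: field "type_ring (UNIV :: arc_field set)" by (rule F)
  have add: "\<iota> c (x \<oplus>\<^bsub>K\<^esub> y) = \<iota> c x + \<iota> c y" and mult: "\<iota> c (x \<otimes>\<^bsub>K\<^esub> y) = \<iota> c x * \<iota> c y"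
    if "x \<in> carrier K" "y \<in> carrier K" for c x y
    using ring_hom_add[OF hom that] ring_hom_mult[OF hom that] by simp_all
  have one: "\<iota> c \<one>\<^bsub>K\<^esub> = 1" and zero: "\<iota> c \<zero>\<^bsub>K\<^esub> = 0" for c
    using ring_hom_one[OF hom] ring_hom_zero[OF hom K.ring_axioms F.ring_axioms] by simp_all
  have pow: "\<iota> c (x [^]\<^bsub>K\<^esub> n) = \<iota> c x ^ n" if "x \<in> carrier K" for c x and n :: nat
    using that by (induction n) (simp_all add: one mult mult.commute)
  have inj: "inj_on (\<iota> c) (carrier K)" for c
    by (rule inj_onI) (use non_trivial_field_hom_is_inj[OF hom K.field_axioms F, of c] in \<open>auto dest: inj_onD\<close>)
  have fixed: "\<iota> c x = \<iota> 0 x" if "x \<in> ?k" for c x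
    using that
  proof induction
    case (incl x)
    then show ?case by (auto simp: \<iota> D_arc_gens(1) D_arc_gens(6)[of _ c])
  next
    case (a_inv x)
    then have x: "x \<in> carrier K" using K.generate_field_in_carrier[OF H] by blast
    then have "\<iota> c (\<ominus>\<^bsub>K\<^esub> x) + \<iota> c x = 0" for c
      by (simp add: add[symmetric] K.l_neg zero)
    then show ?case using a_inv.IH by (metis add_right_cancel)
  next
    case (m_inv x)
    then have x: "x \<in> carrier K" using K.generate_field_in_carrier[OF H] by blast
    then have u: "x \<in> Units K" using m_inv by (simp add: K.field_Units)
    then have "\<iota> c (inv\<^bsub>K\<^esub> x) * \<iota> c x = 1" for c
      using x by (simp add: mult[symmetric] one)
    then show ?case using m_inv.IH by (metis inverse_unique mult.commute)
  next
    case (eng_add x y)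
    then show ?case using K.generate_field_in_carrier[OF H] by (simp add: add)
  next
    case (eng_mult x y)
    then show ?case using K.generate_field_in_carrier[OF H] by (simp add: mult)
  qed (simp add: one)
  have ev: "\<iota> c (K.eval q x) = poly (list_to_poly (map (\<iota> c) q)) (\<iota> c x)"
    if "set q \<subseteq> carrier K" "x \<in> carrier K" for c q x
    using that by (induction q) (simp_all add: zero add mult pow poly_monom K.eval_in_carrier)
  have carr: "set p \<subseteq> carrier K" using pk K.generate_field_in_carrier[OF H] by blast
  have same: "map (\<iota> c) p = map (\<iota> 0) p" for c using fixed pk by auto
  have "poly (list_to_poly (map (\<iota> 0) p)) (D_arc c cusp_coeff) = 0" for c
    using ev[OF carr res, of c cusp_coeff] p(3) zero[of c] same[of c] \<iota>[of c cusp_coeff] by metis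
  then have "poly (list_to_poly (map (\<iota> 0) p)) (D_arc 0 cusp_coeff + 3 * field_par ^ 4 * field_const c) = 0" for c
    by (simp flip: D_arc_cusp_coeff)
  moreover have "3 * field_par ^ 4 \<noteq> 0"
  proof -
    have "field_const 3 \<noteq> 0" by (simp add: field_const_eq_0_iff)
    then show ?thesis using field_par_nonzero by (simp add: field_const.hom_numeral)
  qed
  ultimately have 0: "list_to_poly (map (\<iota> 0) p) = 0" by (intro poly_eq_0_of_line)
  obtain a q where q: "p = a # q" using p(2) by (cases p) auto
  have "coeff (list_to_poly (map (\<iota> 0) p)) (length q) = \<iota> 0 a"
    by (simp add: q coeff_list_to_poly)
  then have "\<iota> 0 a = \<iota> 0 \<zero>\<^bsub>K\<^esub>" using 0 zero by simp
  then have "a = \<zero>\<^bsub>K\<^esub>" using inj[of 0] carr q by (auto dest: inj_onD)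
  then show False using pk q by simp
qed


section \<open>Comparison with the toric valuation\<close>

text \<open>Restriction to the curve \<open>z = 0\<close> of the chart, with \<open>u\<close> as parameter; on this curve \<open>x = u\<^sup>2\<close> and
  \<open>y = u\<^sup>3\<close>, so it is the strict transform of the cusp.\<close>

definition chart_restrict :: "plane_poly \<Rightarrow> complex poly" where
  "chart_restrict = plane_eval (\<lambda>c. [:c:]) 0 (monom 1 1)"

interpretation chart_restrict: type_ring_hom chart_restrict
  unfolding chart_restrict_def by (rule type_ring_hom_plane_eval[OF type_ring_hom_pCons])

lemma chart_restrict_gens:
  "chart_restrict (pconst c) = [:c:]" "chart_restrict xvar = 0" "chart_restrict yvar = monom 1 1"
  unfolding chart_restrict_def by (rule plane_eval_gens[OF type_ring_hom_pCons])+

lemma chart_restrict_eval: "chart_restrict (chart_eval f) = cusp_param f"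
  by (rule plane_hom_eqI[OF type_ring_hom_comp[OF chart_eval.type_ring_hom_axioms chart_restrict.type_ring_hom_axioms]
        type_ring_hom_cusp_param])
     (simp_all add: chart_eval_gens chart_restrict.hom_simps chart_restrict_gens cusp_param_gens monom_power)

lemma power_yvar_dvd_iff: "h \<noteq> 0 \<Longrightarrow> yvar ^ n dvd h \<longleftrightarrow> n \<le> Polynomial.order 0 h"
  using order_divides[of 0 n h] by (simp add: yvar_def)

lemma chart_ord_le_cusp_param:
  assumes "coeff (cusp_param f) k \<noteq> 0"
  shows "chart_ord f \<le> k"
proof (rule ccontr)
  assume k: "\<not> chart_ord f \<le> k"
  have "yvar ^ chart_ord f dvd chart_eval f"
    using power_yvar_dvd_iff[of "chart_eval f" "chart_ord f"]
    by (cases "chart_eval f = 0") (auto simp: chart_ord_def)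
  then have "chart_restrict (yvar ^ chart_ord f) dvd cusp_param f"
    unfolding chart_restrict_eval[symmetric] by (rule chart_restrict.hom_dvd)
  then obtain g where "cusp_param f = monom 1 (chart_ord f) * g"
    by (auto simp: chart_restrict.hom_power chart_restrict_gens monom_power dvd_def)
  then show False using assms k by (simp add: coeff_monom_mult)
qed

text \<open>In the chart, \<open>x\<^sup>i y\<^sup>j\<close> is \<open>u\<close> to the power \<open>2 i + 3 j\<close> times a function.\<close>

lemma power_yvar_dvd_chart_eval:
  assumes "\<And>i j. plane_coeff f i j \<noteq> 0 \<Longrightarrow> n \<le> 2 * i + 3 * j"
  shows "yvar ^ n dvd chart_eval f"
  unfolding chart_eval_def plane_eval_def poly_hom_def sum_distrib_right
proof (intro dvd_sum)
  fix j i
  let ?c = "plane_coeff f i j"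
  have x: "yvar ^ 2 + yvar ^ 4 * xvar = yvar ^ 2 * (1 + yvar ^ 2 * xvar)"
    and y: "yvar ^ 3 + yvar ^ 5 * xvar = yvar ^ 3 * (1 + yvar ^ 2 * xvar)"
    by (simp_all add: algebra_simps eval_nat_numeral)
  have e: "(yvar ^ 2 + yvar ^ 4 * xvar) ^ i * (yvar ^ 3 + yvar ^ 5 * xvar) ^ j =
      yvar ^ (2 * i + 3 * j) * (1 + yvar ^ 2 * xvar) ^ (i + j)"
    unfolding x y power_mult_distrib by (simp add: power_add mult_ac flip: power_mult)
  have "yvar ^ (2 * i + 3 * j) dvd
      pconst ?c * (yvar ^ 2 + yvar ^ 4 * xvar) ^ i * (yvar ^ 3 + yvar ^ 5 * xvar) ^ j"
    unfolding mult.assoc e by (intro dvd_mult dvd_triv_left)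
  then show "yvar ^ n dvd pconst ?c * (yvar ^ 2 + yvar ^ 4 * xvar) ^ i * (yvar ^ 3 + yvar ^ 5 * xvar) ^ j"
  proof (cases "?c = 0")
    case True
    then show ?thesis by (simp add: pconst_def)
  next
    case False
    then have "yvar ^ n dvd yvar ^ (2 * i + 3 * j)" using assms by (intro le_imp_power_dvd)
    then show ?thesis using \<open>yvar ^ (2 * i + 3 * j) dvd _\<close> by (rule dvd_trans)
  qed
qed

text \<open>In the chart the equation of the cusp is \<open>u\<^sup>8 z (1 + u\<^sup>2 z)\<^sup>2\<close>.\<close>

lemma order_chart_eval_cusp: "Polynomial.order 0 (chart_eval cusp) = 8"
proof -
  let ?e = "xvar * (1 + yvar ^ 2 * xvar) ^ 2"
  have e: "chart_eval cusp = yvar ^ 8 * ?e"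
    by (simp add: cusp_def chart_eval.hom_simps chart_eval_gens algebra_simps eval_nat_numeral)
  have "coeff ?e 0 \<noteq> 0"
    by (simp add: coeff_mult_0 coeff_0_power xvar_def yvar_def)
  then have "\<not> yvar dvd ?e" by (simp only: yvar_dvd_iff not_False_eq_True)
  then have "\<not> yvar ^ Suc 8 dvd chart_eval cusp"
    unfolding e power_Suc2 by (subst dvd_times_left_cancel_iff) auto
  moreover have "yvar ^ 8 dvd chart_eval cusp" unfolding e by simp
  ultimately show ?thesis
    by (intro order_unique_lemma) (simp_all add: yvar_def)
qed

lemma coeff_cusp_mult:
  "plane_coeff (cusp * f) i j =
    (if 3 \<le> i then plane_coeff f (i - 3) j else 0) -
    (if 2 \<le> j then plane_coeff f i (j - 2) else 0)"
proof -
  have "xvar ^ 3 = [:monom 1 3:]" "yvar ^ 2 = monom 1 2"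
    by (simp_all add: xvar_def yvar_def monom_altdef eval_nat_numeral)
  then have "cusp * f = Polynomial.smult (monom 1 3) f - monom 1 2 * f"
    by (simp add: cusp_def left_diff_distrib)
  then show ?thesis by (simp add: coeff_monom_mult)
qed

text \<open>Expand in powers of the cusp.  The remainder is seen on the curve \<open>z = 0\<close> of the chart,
  where its monomials stay apart, so it cannot cancel against the multiple of the cusp; the cusp
  has order 8 for both valuations, and monomials have larger toric order.\<close>

lemma chart_ord_le_toric:
  assumes "plane_coeff f i j \<noteq> 0"
  shows "chart_ord f \<le> 3 * i + 4 * j"
  using assms
proof (induction "degree f" arbitrary: f i j rule: less_induct)
  case less
  interpret cusp_param: type_ring_hom cusp_param by (rule type_ring_hom_cusp_param)
  obtain p q f' where f: "f = [:p, q:] + cusp * f'"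
    and deg: "f' = 0 \<or> degree f' < degree f"
    using cusp_division by blast
  have "f \<noteq> 0" using less.prems by auto
  have par: "cusp_param f = cusp_param [:p, q:]"
    unfolding f by (simp add: cusp_param.hom_add cusp_param.hom_mult cusp_param_cusp)
  have rem: "chart_ord f \<le> 2 * i + 3 * j" if "plane_coeff [:p, q:] i j \<noteq> 0" for i j
  proof -
    have "j = 0 \<or> j = 1" using that by (auto simp: coeff_pCons split: nat.splits)
    then have "coeff (cusp_param f) (2 * i + 3 * j) = plane_coeff [:p, q:] i j"
      unfolding par using coeff_cusp_param_remainder[of p q i] by auto
    then show ?thesis using that by (intro chart_ord_le_cusp_param) simp
  qed
  have quot: "chart_ord f \<le> 8 + chart_ord f'" if "f' \<noteq> 0"
  proof -
    have "yvar ^ chart_ord f dvd chart_eval f"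
      using \<open>f \<noteq> 0\<close> by (simp add: power_yvar_dvd_iff chart_eval_eq_0_iff chart_ord_def)
    moreover have "yvar ^ chart_ord f dvd chart_eval [:p, q:]"
      by (rule power_yvar_dvd_chart_eval) (rule rem)
    moreover have "chart_eval f = chart_eval [:p, q:] + chart_eval cusp * chart_eval f'"
      by (subst f) (simp only: chart_eval.hom_add chart_eval.hom_mult)
    ultimately have "yvar ^ chart_ord f dvd chart_eval cusp * chart_eval f'"
      by (metis dvd_add_right_iff)
    moreover have "chart_eval cusp \<noteq> 0" using order_chart_eval_cusp cusp_param_cusp
      by (auto simp: chart_eval_eq_0_iff cusp_def xvar_def yvar_def eval_nat_numeral)
    then have "chart_eval cusp * chart_eval f' \<noteq> 0" using that by (simp add: chart_eval_eq_0_iff)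
    ultimately show ?thesis
      by (simp add: power_yvar_dvd_iff order_mult order_chart_eval_cusp chart_ord_def)
  qed
  show ?case
  proof (cases "plane_coeff [:p, q:] i j = 0")
    case False
    then have "chart_ord f \<le> 2 * i + 3 * j" by (rule rem)
    then show ?thesis by simp
  next
    case True
    then have ne: "plane_coeff (cusp * f') i j \<noteq> 0"
      using less.prems f by (metis add_0 coeff_add)
    then have "f' \<noteq> 0" by auto
    then have IH: "chart_ord f' \<le> 3 * i' + 4 * j'" if "plane_coeff f' i' j' \<noteq> 0" for i' j'
      using less.hyps[OF _ that] deg by blast
    have "3 \<le> i \<and> plane_coeff f' (i - 3) j \<noteq> 0 \<or>
        2 \<le> j \<and> plane_coeff f' i (j - 2) \<noteq> 0"
      using ne unfolding coeff_cusp_mult by (auto split: if_splits)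
    then consider "3 \<le> i" "plane_coeff f' (i - 3) j \<noteq> 0"
      | "2 \<le> j" "plane_coeff f' i (j - 2) \<noteq> 0" by blast
    then show ?thesis
    proof cases
      case 1
      then show ?thesis using IH[OF 1(2)] quot[OF \<open>f' \<noteq> 0\<close>] by simp
    next
      case 2
      then show ?thesis using IH[OF 2(2)] quot[OF \<open>f' \<noteq> 0\<close>] by simp
    qed
  qed
qed

definition toric_weights :: "plane_poly \<Rightarrow> int set" where
  "toric_weights f = {int (3 * i + 4 * j) | i j. plane_coeff f i j \<noteq> 0}"

lemma toric_val_eq: "toric_val 3 4 = frac_val (\<lambda>f. Min (toric_weights f))"
  by (simp add: toric_val_def toric_weights_def)

lemma finite_toric_weights: "finite (toric_weights f)"
proof -
  have "toric_weights f \<subseteq> (\<lambda>(j, i). int (3 * i + 4 * j)) `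
      (SIGMA j:{..degree f}. {..degree (coeff f j)})"
  proof
    fix w assume "w \<in> toric_weights f"
    then obtain i j where "w = int (3 * i + 4 * j)" "plane_coeff f i j \<noteq> 0"
      by (auto simp: toric_weights_def)
    moreover from this have "j \<le> degree f" "i \<le> degree (coeff f j)"
      by (auto intro!: le_degree)
    ultimately show "w \<in> (\<lambda>(j, i). int (3 * i + 4 * j)) `
      (SIGMA j:{..degree f}. {..degree (coeff f j)})" by force
  qed
  then show ?thesis by (rule finite_subset) auto
qed

lemma toric_weights_nonempty: "f \<noteq> 0 \<Longrightarrow> toric_weights f \<noteq> {}"
  unfolding toric_weights_def by (auto simp: poly_eq_iff)

lemma frac_val_to_fract: "frac_val w (to_fract f) = w f - w 1"
  by (simp add: frac_val_def)

lemma arc_ord_1: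
  assumes "P \<in> Spec arc_ring"
  shows "arc_ord P 1 = enat 0"
  using assms Spec_arcD(2)[OF assms]
  by (simp add: arc_ord_eq_iff type_ring_hom.hom_one[OF type_ring_hom_universal_arc])

lemma arc_val_to_fract:
  "P \<in> Spec arc_ring \<Longrightarrow> arc_val P (to_fract f) = int (the_enat (arc_ord P f))"
  by (simp add: arc_val_def frac_val_to_fract arc_ord_1)

lemma arc_val_D_point_le_toric:
  assumes "f \<noteq> 0"
  shows "arc_val D_point (to_fract f) \<le> toric_val 3 4 (to_fract f)"
proof -
  have "toric_weights 1 = {0}" by (auto simp: toric_weights_def of_bool_def split: if_splits)
  then have "toric_val 3 4 (to_fract f) = Min (toric_weights f)"
    by (simp add: toric_val_eq frac_val_to_fract)
  moreover have "int (chart_ord f) \<le> Min (toric_weights f)"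
  proof (rule Min.boundedI[OF finite_toric_weights toric_weights_nonempty[OF assms]])
    fix w assume "w \<in> toric_weights f"
    then obtain i j where "w = int (3 * i + 4 * j)" "plane_coeff f i j \<noteq> 0"
      by (auto simp: toric_weights_def)
    then show "int (chart_ord f) \<le> w" using chart_ord_le_toric by (simp only: of_nat_le_iff)
  qed
  ultimately show ?thesis
    using assms by (simp add: arc_val_to_fract[OF D_point_in_Spec] arc_ord_D_point)
qed


section \<open>The maximal divisorial sets\<close>

text \<open>One inclusion holds since \<open>D_point\<close> is itself an arc with this valuation.  For the other, a fat arc
  with this valuation has the same orders along \<open>x\<close>, \<open>y\<close> and \<open>x\<^sup>3 - y\<^sup>2\<close> as \<open>D_point\<close>, and these
  three orders decide membership in \<open>D\<close>.\<close>

lemma maximal_divisorial_set_D_point: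
  "maximal_divisorial_set (arc_val D_point) = zariski arc_ring closure_of D_set"
proof (rule antisym)
  have "P \<in> D_set" if P: "fat_arc P" "\<And>\<phi>. \<phi> \<noteq> 0 \<Longrightarrow> arc_val P \<phi> = arc_val D_point \<phi>" for P
  proof -
    have S: "P \<in> Spec arc_ring" using P(1) by (simp add: fat_arc_def)
    have ord: "arc_ord P f = arc_ord D_point f" if "f \<noteq> 0" for f
    proof -
      have "the_enat (arc_ord P f) = chart_ord f"
        using P(2)[of "to_fract f"] that
        by (simp add: arc_val_to_fract[OF S] arc_val_to_fract[OF D_point_in_Spec] arc_ord_D_point)
      moreover have "arc_ord P f \<noteq> \<infinity>" using P(1) fat_arc_iff[OF S] that by blast
      ultimately show ?thesis using that by (cases "arc_ord P f") (auto simp: arc_ord_D_point)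
    qed
    have "cusp \<noteq> 0" by (simp add: cusp_def xvar_def yvar_def eval_nat_numeral)
    then show ?thesis
      using D_point_in_D_set S ord[of xvar] ord[of yvar] ord[of cusp]
      unfolding D_set_eq_Cont_ge by (simp add: Cont_def Cont_ge_def)
  qed
  then show "maximal_divisorial_set (arc_val D_point) \<subseteq> zariski arc_ring closure_of D_set"
    unfolding maximal_divisorial_set_def by (intro closure_of_mono) blast
  have "zariski arc_ring closure_of D_set \<subseteq> zariski arc_ring closure_of {D_point}"
    using D_set_subset_closure by (intro closure_of_minimal) auto
  also have "\<dots> \<subseteq> maximal_divisorial_set (arc_val D_point)"
    unfolding maximal_divisorial_set_def by (intro closure_of_mono) (simp add: fat_arc_D_point)
  finally show "zariski arc_ring closure_of D_set \<subseteq> maximal_divisorial_set (arc_val D_point)" .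
qed


subsection \<open>A toric arc outside the closure of \<open>D\<close>\<close>

text \<open>The arc \<open>x = t\<^sup>3\<close>, \<open>y = w t\<^sup>4\<close> over \<open>\<complex>[w]\<close>.\<close>

definition toric_eval :: "arc_poly \<Rightarrow> complex poly" where
  "toric_eval = arc_eval (\<lambda>c. [:c:]) (\<lambda>x. if x = Ca 3 then 1 else if x = Cb 4 then [:0, 1:] else 0)"

interpretation toric_eval: type_ring_hom toric_eval
  unfolding toric_eval_def by (rule type_ring_hom_arc_eval[OF type_ring_hom_pCons])

lemma toric_eval_gens:
  "toric_eval (arc_const c) = [:c:]"
  "toric_eval (arc_var x) = (if x = Ca 3 then 1 else if x = Cb 4 then [:0, 1:] else 0)"
  unfolding toric_eval_def by (simp_all add: arc_eval_gens[OF type_ring_hom_pCons])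

definition toric_point :: "arc_poly set" where
  "toric_point = {r. toric_eval r = 0}"

lemma toric_arc_nth:
  "fps_nth (arc_of toric_eval f) n = (\<Sum>j\<le>degree f. \<Sum>i\<le>degree (coeff f j).
     if n = 3 * i + 4 * j then monom (plane_coeff f i j) j else 0)"
proof -
  note h = toric_eval.type_ring_hom_axioms
  have x: "Abs_fps (\<lambda>k. toric_eval (arc_var (Ca k))) = fps_X ^ 3"
    by (simp add: fps_eq_iff toric_eval_gens fps_X_power_nth)
  have y: "Abs_fps (\<lambda>k. toric_eval (arc_var (Cb k))) = fps_const [:0, 1:] * fps_X ^ 4"
    by (simp add: fps_eq_iff toric_eval_gens fps_X_power_nth)
  have m: "fps_const [:c:] * (fps_X ^ 3) ^ i * (fps_const [:0, 1:] * fps_X ^ 4) ^ j =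
      fps_const (monom c j) * fps_X ^ (3 * i + 4 * j)" for c :: complex and i j
  proof -
    have "monom c j = [:c:] * [:0, 1:] ^ j" by (simp add: monom_altdef)
    then show ?thesis
      by (simp only: fps_const_mult[symmetric] fps_const_power[symmetric] power_mult_distrib
          power_mult[symmetric] power_add mult_ac)
  qed
  show ?thesis
    unfolding arc_of_def plane_eval_def poly_hom_def sum_distrib_right x y
    unfolding toric_eval_gens(1) m
    by (simp add: fps_sum_nth fps_X_power_nth if_distrib[where f = "\<lambda>a. _ * a"] cong: if_cong)
qed

text \<open>Monomials of the same weight \<open>3 i + 4 j\<close> have different \<open>j\<close>, and are told apart by the power of \<open>w\<close>.\<close>

lemma coeff_toric_arc_nth:
  "coeff (fps_nth (arc_of toric_eval f) (3 * i + 4 * j)) j = plane_coeff f i j"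
proof -
  have "coeff (fps_nth (arc_of toric_eval f) (3 * i + 4 * j)) j =
      (\<Sum>j'\<le>degree f. \<Sum>i'\<le>degree (coeff f j').
        if j' = j \<and> i' = i then plane_coeff f i j else 0)"
    unfolding toric_arc_nth coeff_sum by (intro sum.cong) auto
  also have "\<dots> = (\<Sum>j'\<le>degree f. if j' = j then plane_coeff f i j else 0)"
    by (intro sum.cong) (auto simp: coeff_eq_0)
  also have "\<dots> = plane_coeff f i j"
    by (auto simp: coeff_eq_0)
  finally show ?thesis .
qed

lemma subdegree_toric_arc:
  assumes "f \<noteq> 0"
  shows "arc_of toric_eval f \<noteq> 0" "int (subdegree (arc_of toric_eval f)) = Min (toric_weights f)"
proof -
  have fin: "finite (toric_weights f)" "toric_weights f \<noteq> {}"
    using finite_toric_weights toric_weights_nonempty[OF assms] by auto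
  then have "Min (toric_weights f) \<in> toric_weights f" by (rule Min_in)
  then obtain i j where ij: "Min (toric_weights f) = int (3 * i + 4 * j)"
    "plane_coeff f i j \<noteq> 0" by (auto simp: toric_weights_def)
  then have ne: "fps_nth (arc_of toric_eval f) (3 * i + 4 * j) \<noteq> 0"
    using coeff_toric_arc_nth[of f i j] by auto
  then show "arc_of toric_eval f \<noteq> 0" by auto
  have "fps_nth (arc_of toric_eval f) n = 0" if "n < 3 * i + 4 * j" for n
    unfolding toric_arc_nth
  proof (intro sum.neutral ballI)
    fix j' i'
    have "plane_coeff f i' j' = 0" if "n = 3 * i' + 4 * j'"
    proof (rule ccontr)
      assume "plane_coeff f i' j' \<noteq> 0"
      then have "int n \<in> toric_weights f" using that unfolding toric_weights_def by blast
      then have "Min (toric_weights f) \<le> int n" using fin by simp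
      then show False using ij(1) \<open>n < 3 * i + 4 * j\<close> by simp
    qed
    then show "(if n = 3 * i' + 4 * j' then monom (plane_coeff f i' j') j' else 0) = 0"
      by auto
  qed
  then have "subdegree (arc_of toric_eval f) = 3 * i + 4 * j" by (intro subdegreeI ne)
  then show "int (subdegree (arc_of toric_eval f)) = Min (toric_weights f)" using ij by simp
qed

lemma fat_arc_toric_point: "fat_arc toric_point"
  unfolding toric_point_def
  by (rule fat_arc_kernel[OF toric_eval.type_ring_hom_axioms subdegree_toric_arc(1)])

lemma arc_val_toric_point:
  assumes "\<phi> \<noteq> 0"
  shows "arc_val toric_point \<phi> = toric_val 3 4 \<phi>"
proof -
  have *: "int (the_enat (arc_ord toric_point f)) = Min (toric_weights f)" if "f \<noteq> 0" for f
    using arc_ord_kernel[OF toric_eval.type_ring_hom_axioms] subdegree_toric_arc[OF that]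
    by (simp add: toric_point_def)
  have "fst (quot_of_fract \<phi>) \<noteq> 0" using assms by simp
  then show ?thesis by (simp add: arc_val_def toric_val_eq frac_val_def *)
qed

lemma toric_point_in_maximal_divisorial_set: "toric_point \<in> maximal_divisorial_set (toric_val 3 4)"
proof -
  let ?S = "{P. fat_arc P \<and> (\<forall>\<phi>. \<phi> \<noteq> 0 \<longrightarrow> arc_val P \<phi> = toric_val 3 4 \<phi>)}"
  have "?S \<subseteq> topspace (zariski arc_ring)" by (auto simp: fat_arc_def)
  moreover have "toric_point \<in> ?S" using fat_arc_toric_point arc_val_toric_point by simp
  ultimately show ?thesis
    unfolding maximal_divisorial_set_def using closure_of_subset by blast
qed

text \<open>On \<open>D\<close> the equations \<open>a\<^sub>2 = s\<^sup>2\<close> and \<open>2 b\<^sub>4 = 3 s a\<^sub>3\<close> give \<open>4 b\<^sub>4\<^sup>2 = 9 a\<^sub>2 a\<^sub>3\<^sup>2\<close>; this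
  fails on a toric arc, where \<open>a\<^sub>2 = 0\<close> and \<open>b\<^sub>4 \<noteq> 0\<close>.\<close>

lemma toric_point_notin_closure: "toric_point \<notin> zariski arc_ring closure_of D_set"
proof
  assume "toric_point \<in> zariski arc_ring closure_of D_set"
  then have "\<Inter>D_set \<subseteq> toric_point"
    unfolding closure_of_zariski[OF D_set_subset_Spec] by (simp add: arc_ring_eq)
  moreover have "D_point \<subseteq> \<Inter>D_set" by (auto simp: D_set_iff)
  ultimately have "D_point \<subseteq> toric_point" by (rule order_trans[rotated])
  define r where "r = 4 * arc_var (Cb 4) ^ 2 - 9 * arc_var (Ca 2) * arc_var (Ca 3) ^ 2"
  have "D_eval 0 r = ((laurent_const (3/2) * 2) ^ 2 - 9) * (par * laurent_var (Ca 3)) ^ 2"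
    by (simp add: r_def D_eval.hom_simps D_eval_gens algebra_simps power_mult_distrib)
  also have "\<dots> = 0" by (simp add: laurent_const_three_halves)
  finally have "r \<in> toric_point" using \<open>D_point \<subseteq> toric_point\<close> by (auto simp: D_point_def)
  moreover have "toric_eval r = 4 * [:0, 1:] ^ 2"
    by (simp add: r_def toric_eval.hom_simps toric_eval_gens)
  ultimately show False by (simp add: toric_point_def)
qed

theorem theorem4p3:
  shows
    "embedding_map (zariski contact_ring) (zariski arc_ring) contact_point \<and>
     contact_point ` Spec contact_ring = Cont 2 xvar \<inter> Cont 3 yvar \<and>
     closedin (subtopology (zariski arc_ring) (Cont 2 xvar \<inter> Cont 3 yvar)) D_set \<and>
     irreducible_subset (zariski arc_ring) D_set \<and>
     (\<exists>!\<alpha>. generic_point (zariski arc_ring) D_set \<alpha>) \<and>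
     (\<forall>\<alpha>. generic_point (zariski arc_ring) D_set \<alpha> \<longrightarrow>
       (let K = residue_field arc_ring \<alpha>;
            res = residue arc_ring \<alpha>;
            v = arc_val \<alpha>;
            v' = toric_val 3 4;
            g = xvar ^ 3 - yvar ^ 2;
            Z = zeros plane_ring {g}
        in
          (\<exists>h \<in> ring_iso (residue_field contact_ring D_ideal) K.
             \<forall>p \<in> carrier arc_ring. h (residue contact_ring D_ideal (contact_restrict p)) = res p) \<and>
          fat_arc \<alpha> \<and>
          divisorial_valuation v \<and>
          \<comment> \<open>(i)\<close>
          ((\<forall>n < 8. arc_map \<alpha> g n = \<zero>\<^bsub>K\<^esub>) \<and>
           ring.transcendental K
             (generate_field K (res ` (range arc_const \<union>
                {arc_var (Ca 2), arc_var (Ca 3), arc_var (Cb 3), arc_var (Cb 4)})))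
             (arc_map \<alpha> g 8)) \<and>
          \<comment> \<open>(ii)\<close>
          (D_set = Cont 2 xvar \<inter> Cont 3 yvar \<inter>
                     {P \<in> Spec arc_ring. jet_proj 7 P \<in> jets_in 7 Z} \<and>
           D_set = Cont 2 xvar \<inter> Cont 3 yvar \<inter> Cont_ge 8 g) \<and>
          \<comment> \<open>(iii)\<close>
          maximal_divisorial_set v = zariski arc_ring closure_of D_set \<and>
          \<comment> \<open>(iv)\<close>
          (\<forall>f. f \<noteq> 0 \<longrightarrow> v (to_fract f) \<le> v' (to_fract f)) \<and>
          \<comment> \<open>(v)\<close>
          \<not> maximal_divisorial_set v' \<subseteq> maximal_divisorial_set v))"
proof -
  have i: "arc_map D_point cusp n = \<zero>\<^bsub>residue_field arc_ring D_point\<^esub>" if "n < 8" for n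
    unfolding arc_map_eq_zero_iff[OF D_point_in_Spec] unfolding D_point_eq
    using iffD2[OF cusp_coeffs_below_8[OF D_ideal_prime] conjI[OF eqns_in_D_ideal]] that by simp
  have c8: "arc_map D_point cusp 8 = residue arc_ring D_point cusp_coeff"
    by (simp add: arc_map_def cusp_coeff_def)
  have v: "\<not> maximal_divisorial_set (toric_val 3 4) \<subseteq> maximal_divisorial_set (arc_val D_point)"
    unfolding maximal_divisorial_set_D_point
    using toric_point_in_maximal_divisorial_set toric_point_notin_closure by (auto dest: subsetD)
  show ?thesis
    unfolding generic_point_D_set Let_def cusp_def[symmetric]
    by (intro conjI allI impI; hypsubst?;
        (rule embedding_map_contact_point contact_point_eq_Cont closedin_D_set irreducible_D_set ex1_eq(1)
          residue_field_D_point_iso fat_arc_D_point divisorial_D_point i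
          cusp_coeff_transcendental[folded c8] D_set_eq_jets D_set_eq_Cont_ge
          maximal_divisorial_set_D_point arc_val_D_point_le_toric v; assumption?))
qed

end
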